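(* Let $n\ge 3$, let $\alpha=2k\in(0,n)$ be an even integer ($k\ge 1$ an integer), let $L\ge 1$, and for $i=1,\dots,L$ let $\sigma_i\in[0,\alpha)$ and let $f_i=f_i(x,u_1,\dots,u_L)$ be smooth with respect to its variables. Consider the system of integral equations $$u_i(x)=\int_{\mathbb{R}^n}\frac{1}{|x-y|^{n-\alpha}|y|^{\sigma_i}}f_i(y,u_1(y),\dots,u_L(y))\,dy,\qquad i=1,\dots,L, \qquad (\mathrm{IE})$$ and the system of differential equations $$(-\Delta)^{\alpha/2}u_i(x)=|x|^{-\sigma_i}f_i(x,u_1(x),\dots,u_L(x))\ \text{ in }\mathbb{R}^n\setminus\{0\},\qquad i=1,\dots,L, \qquad (\mathrm{PDE})$$ where both systems are subject to the structural conditions stated in the context. Then (IE) and (PDE) are equivalent. That is, every positive solution of (IE), multiplied by a suitable constant if necessary, is a positive solution of (PDE), and vice versa: every positive solution of (PDE), multiplied by a suitable constant if necessary, is a positive solution of (IE).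
   Context: A positive solution of either system means a classical solution $u=(u_1,\dots,u_L)$ whose components are positive and belong to $C^{2k}(\mathbb{R}^n\setminus\{0\})\cap C(\mathbb{R}^n)$, and which satisfies the system pointwise except at the origin. Structural conditions imposed on both systems: for $u=(u_1,\dots,u_L)$ a positive solution of either system, $f_i(x,u)>0$ and $f_i(x,0)=0$ for $x\in\mathbb{R}^n$ and $i=1,\dots,L$, and there exist $p_i>1$ ($i=1,\dots,L$), $\sigma\in[0,\alpha)$ and a constant $C>0$ such that $$\sum_{i=1}^L|x|^{-\sigma_i}f_i(x,u_1,\dots,u_L)\ \ge\ C|x|^{-\sigma}\sum_{i=1}^L u_i(x)^{p_i}\quad\text{for } x\neq 0.$$
   Formalization: For general f the suitable constant is placed before the integral in (IE), as multiplying solutions fails (e.g. f=u^5+u^6, n=3); literal multiplication, allowed componentwise, is claimed only for f_i whose scaling absorbs the constant, such as homogeneous f of degree other than 1. *)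

theory Defs
  imports "HOL-Analysis.Analysis"
begin

text \<open>For open \<open>S\<close>, \<open>C_diff_on m S g\<close> says that \<open>g\<close> is of class \<open>C\<^sup>m\<close> on \<open>S\<close>.\<close>

fun C_diff_on ::
  "nat \<Rightarrow> 'a::euclidean_space set \<Rightarrow> ('a \<Rightarrow> 'b::real_normed_vector) \<Rightarrow> bool"
where
  "C_diff_on 0 S g \<longleftrightarrow> continuous_on S g"
| "C_diff_on (Suc m) S g \<longleftrightarrow>
     (\<forall>x\<in>S. g differentiable (at x)) \<and>
     (\<forall>b\<in>Basis. C_diff_on m S (\<lambda>x. frechet_derivative g (at x) b))"

definition C_inf_on ::
  "'a::euclidean_space set \<Rightarrow> ('a \<Rightarrow> 'b::real_normed_vector) \<Rightarrow> bool"
where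
  "C_inf_on S g \<longleftrightarrow> (\<forall>m. C_diff_on m S g)"

definition laplacian :: "('a::euclidean_space \<Rightarrow> real) \<Rightarrow> 'a \<Rightarrow> real" where
  "laplacian g x =
     (\<Sum>b\<in>Basis. frechet_derivative (\<lambda>y. frechet_derivative g (at y) b) (at x) b)"

definition neg_laplacian_power ::
  "nat \<Rightarrow> ('a::euclidean_space \<Rightarrow> real) \<Rightarrow> 'a \<Rightarrow> real"
where
  "neg_laplacian_power k g = ((\<lambda>h x. - laplacian h x) ^^ k) g"

definition positive_classical :: "nat \<Rightarrow> (real^'n \<Rightarrow> real^'l) \<Rightarrow> bool" where
  "positive_classical k u \<longleftrightarrow>
     (\<forall>x i. 0 < u x $ i) \<and> C_diff_on (2 * k) (- {0}) u \<and> continuous_on UNIV u"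

text \<open>
  Throughout, \<open>\<alpha> = 2 * k\<close> and \<open>f i x v\<close> is the \<open>i\<close>-th nonlinearity at the point \<open>x\<close> and the
  vector \<open>v = (u\<^sub>1, \<dots>, u\<^sub>L)\<close>. The exponent \<open>n - \<alpha>\<close> is a subtraction on \<^typ>\<open>nat\<close>, so the kernel is
  meaningful only for \<open>2 * k < n\<close>. The factor \<open>c\<close> in front of the integral is the normalisation of
  the Riesz kernel; \<open>c = 1\<close> gives the unnormalised integral system. Integrability is required
  because the Bochner integral of a non-integrable function is \<open>0\<close>.
\<close>

definition riesz_integrand ::
  "nat \<Rightarrow> ('l \<Rightarrow> real) \<Rightarrow> ('l \<Rightarrow> real^'n \<Rightarrow> real^'l \<Rightarrow> real) \<Rightarrow>
   (real^'n \<Rightarrow> real^'l) \<Rightarrow> 'l \<Rightarrow> real^'n \<Rightarrow> real^'n \<Rightarrow> real"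
where
  "riesz_integrand k \<sigma> f u i x y =
     1 / (norm (x - y) ^ (CARD('n) - 2 * k) * norm y powr \<sigma> i) * f i y (u y)"

definition positive_solution_IE ::
  "nat \<Rightarrow> real \<Rightarrow> ('l \<Rightarrow> real) \<Rightarrow> ('l \<Rightarrow> real^'n \<Rightarrow> real^'l \<Rightarrow> real) \<Rightarrow>
   (real^'n \<Rightarrow> real^'l) \<Rightarrow> bool"
where
  "positive_solution_IE k c \<sigma> f u \<longleftrightarrow>
     positive_classical k u \<and>
     (\<forall>i x. x \<noteq> 0 \<longrightarrow>
        integrable lborel (riesz_integrand k \<sigma> f u i x) \<and>
        u x $ i = c * (LINT y|lborel. riesz_integrand k \<sigma> f u i x y))"

definition positive_solution_PDE ::
  "nat \<Rightarrow> ('l \<Rightarrow> real) \<Rightarrow> ('l \<Rightarrow> real^'n \<Rightarrow> real^'l \<Rightarrow> real) \<Rightarrow>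
   (real^'n \<Rightarrow> real^'l) \<Rightarrow> bool"
where
  "positive_solution_PDE k \<sigma> f u \<longleftrightarrow>
     positive_classical k u \<and>
     (\<forall>i x. x \<noteq> 0 \<longrightarrow>
        neg_laplacian_power k (\<lambda>y. u y $ i) x = norm x powr (- \<sigma> i) * f i x (u x))"

definition structural_conditions ::
  "nat \<Rightarrow> real \<Rightarrow> ('l::finite \<Rightarrow> real) \<Rightarrow> ('l \<Rightarrow> real^'n \<Rightarrow> real^'l \<Rightarrow> real) \<Rightarrow> bool"
where
  "structural_conditions k c \<sigma> f \<longleftrightarrow>
     (\<forall>u. positive_solution_IE k c \<sigma> f u \<or> positive_solution_PDE k \<sigma> f u \<longrightarrow>
        (\<forall>i x. 0 < f i x (u x) \<and> f i x 0 = 0) \<and>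
        (\<exists>p :: 'l \<Rightarrow> real. \<exists>s C :: real.
           (\<forall>i. 1 < p i) \<and> 0 \<le> s \<and> s < 2 * real k \<and> 0 < C \<and>
           (\<forall>x. x \<noteq> 0 \<longrightarrow>
              (\<Sum>i\<in>UNIV. norm x powr (- \<sigma> i) * f i x (u x))
                \<ge> C * norm x powr (- s) * (\<Sum>i\<in>UNIV. (u x $ i) powr p i))))"

text \<open>
  Nonlinearities are smooth in \<open>(x, v)\<close> for \<open>x\<close> in the whole space and \<open>v\<close> in the open positive
  orthant, where positive solutions take their values. This includes \<open>v\<^sub>j powr p\<close> with
  non-integer \<open>p\<close>, which is not smooth at \<open>v\<^sub>j = 0\<close>.
\<close>

definition smooth_nonlinearity :: "(real^'n \<Rightarrow> real^'l \<Rightarrow> real) \<Rightarrow> bool" where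
  "smooth_nonlinearity g \<longleftrightarrow>
     C_inf_on {(x, v). \<forall>j. 0 < v $ j} (\<lambda>(x, v). g x v)"

definition scale_components :: "real^'l \<Rightarrow> real^'l \<Rightarrow> real^'l" where
  "scale_components \<mu> v = (\<chi> i. \<mu> $ i * v $ i)"

text \<open>
  The unnormalised Riesz kernel inverts \<open>(-\<Delta>)\<^sup>k\<close> only up to a dimensional constant \<open>1 / c\<close>.
  Multiplying a solution componentwise by \<open>\<mu>\<close> removes this constant when the
  nonlinearities scale as follows. For \<open>f\<close> homogeneous of degree \<open>p \<noteq> 1\<close> all \<open>\<mu>\<^sub>i\<close> can be taken
  to be \<open>c powr (- 1 / (p - 1))\<close>.
\<close>

definition absorbs_constant ::
  "real \<Rightarrow> real^'l \<Rightarrow> ('l \<Rightarrow> real^'n \<Rightarrow> real^'l \<Rightarrow> real) \<Rightarrow> bool"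
where
  "absorbs_constant c \<mu> f \<longleftrightarrow>
     (\<forall>i. 0 < \<mu> $ i) \<and>
     (\<forall>i x v. (\<forall>j. 0 < v $ j) \<longrightarrow> c * f i x (scale_components \<mu> v) = \<mu> $ i * f i x v)"

end

theory Submission
  imports Defs "HOL-Computational_Algebra.Polynomial"
begin

text \<open>
  Write \<open>n\<close> for the dimension and \<open>h\<close> for the right-hand side of one equation. Both directions rest on
  one representation formula (\<open>riesz_representation\<close>): a function \<open>u\<close> whose averages over large
  balls tend to \<open>0\<close> and with \<open>(-\<Delta>) ^ k u = h\<close> in a weak sense is \<open>c\<close> times the Riesz potential of \<open>h\<close>.

  The formula is proved with the test functions \<open>max 0 (1 - |y - x|\<^sup>2 / t) ^ (2 * k + 2)\<close> only. Polynomials in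
  this cap are stable under the Laplacian and under the dilation \<open>t * d/dt\<close>, and a commutation relation
  between the two operators (\<open>pderiv_scaling_op\<close>, \<open>neglap_op_power_eq\<close>) shows that the integral of
  \<open>u\<close> against \<open>(-\<Delta>) ^ k\<close> of the test function is, up to a power of \<open>t\<close>, the derivative in \<open>t\<close> of a weighted
  mean of \<open>u\<close> over the ball of radius \<open>sqrt t\<close> around \<open>x\<close> (\<open>radial_mean_derivative\<close>). This mean tends to
  a multiple of \<open>u x\<close> as \<open>t\<close> tends to \<open>0\<close>, and to \<open>0\<close> at infinity. Integrating over \<open>t\<close> and exchanging
  integrals turns the caps into the kernel \<open>|x - y| powr (2 * k - n)\<close>, because
  \<open>t powr (k - 1 - n / 2) * max 0 (1 - s / t) ^ (2 * k + 2)\<close> has an integral over \<open>t > 0\<close> that is homogeneous of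
  degree \<open>k - n / 2\<close> in \<open>s\<close>. If \<open>h\<close> is nonnegative, the same computation first shows that \<open>h\<close> is integrable
  against the kernel (\<open>riesz_integrable\<close>).

  For a solution of the differential equations two facts have to be supplied. The origin does not
  contribute to the weak equation, since \<open>u\<close> is continuous there and \<open>2 * k < n\<close> (\<open>origin_removable\<close>). The
  averages over large balls vanish because the nonlinearity is superlinear: testing the sum of the
  equations with a high power of the cap bounds the integral of the powers of \<open>u\<close> by that of \<open>u\<close>
  itself, with a factor that tends to \<open>0\<close> at large radii because the weight in the lower bound
  decays more slowly than \<open>|x| powr (- 2 * k)\<close> (\<open>averages_vanish\<close>).

  For a solution of the integral equations the representation formula is applied to the test
  functions themselves. By Fubini's theorem the potential then satisfies the differential equation weakly
  (\<open>potential_weak\<close>), and hence pointwise, as both sides are continuous away from the origin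
  (\<open>neg_laplacian_power_potential\<close>).
\<close>

section \<open>Functions of class \<open>C\<^sup>m\<close>\<close>

abbreviation partial :: "'a::euclidean_space \<Rightarrow> ('a \<Rightarrow> 'b::real_normed_vector) \<Rightarrow> 'a \<Rightarrow> 'b" where
  "partial b g \<equiv> \<lambda>y. frechet_derivative g (at y) b"

lemma partial_eqI: "(g has_derivative g') (at x) \<Longrightarrow> partial b g x = g' b"
  by (metis frechet_derivative_at)

text \<open>
  The definitions of \<^const>\<open>C_diff_on\<close> and \<^const>\<open>laplacian\<close> iterate \<^const>\<open>frechet_derivative\<close>, which
  is meaningful only where the function is differentiable. This lemma is what makes both notions
  local, so that a function may be replaced by one that agrees with it on an open set.
\<close>

lemma differentiable_transform_open:
  assumes "g differentiable (at x)" "open S" "x \<in> S" "\<And>y. y \<in> S \<Longrightarrow> g y = h y"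
  shows "h differentiable (at x)" "partial b h x = partial b g x"
proof -
  have d: "(g has_derivative frechet_derivative g (at x)) (at x)"
    using assms(1) frechet_derivative_works by blast
  then have "(h has_derivative frechet_derivative g (at x)) (at x)"
    by (rule has_derivative_transform_within_open[OF _ assms(2,3)]) (use assms(4) in auto)
  then show "h differentiable (at x)" "partial b h x = partial b g x"
    by (auto simp: differentiable_def partial_eqI)
qed

lemma C_diff_on_cong:
  assumes "open S" "\<And>x. x \<in> S \<Longrightarrow> f x = g x" "C_diff_on m S f"
  shows "C_diff_on m S g"
  using assms(2,3)
proof (induction m arbitrary: f g)
  case 0
  then show ?case by (simp add: continuous_on_cong[OF refl, of S f g])
next
  case (Suc m)
  have *: "g differentiable (at x)" "partial b g x = partial b f x" if "x \<in> S" for x b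
    using differentiable_transform_open[of f x S g] Suc.prems that \<open>open S\<close> by auto
  show ?case using Suc * by auto
qed

lemma C_diff_on_continuous:
  assumes "C_diff_on m S f" shows "continuous_on S f"
  using assms
  by (cases m) (auto intro!: continuous_at_imp_continuous_on differentiable_imp_continuous_within)

lemma C_diff_on_Suc: "C_diff_on (Suc m) S f \<Longrightarrow> C_diff_on m S f"
proof (induction m arbitrary: f)
  case 0 then show ?case using C_diff_on_continuous[of "Suc 0" S f] by simp
next
  case (Suc m)
  then show ?case by (metis C_diff_on.simps(2))
qed

lemma C_diff_on_le: "m \<le> m' \<Longrightarrow> C_diff_on m' S f \<Longrightarrow> C_diff_on m S f"
  by (induction m' rule: dec_induct) (auto intro: C_diff_on_Suc simp del: C_diff_on.simps)

lemma C_diff_on_subset: "T \<subseteq> S \<Longrightarrow> C_diff_on m S f \<Longrightarrow> C_diff_on m T f"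
  by (induction m arbitrary: f) (auto intro: continuous_on_subset)

lemma C_diff_on_partial: "C_diff_on (Suc m) S f \<Longrightarrow> b \<in> Basis \<Longrightarrow> C_diff_on m S (partial b f)"
  by simp

lemma C_diff_on_SucI:
  assumes "open S" "\<And>x. x \<in> S \<Longrightarrow> (f has_derivative f' x) (at x)"
    "\<And>b. b \<in> Basis \<Longrightarrow> C_diff_on m S (\<lambda>x. f' x b)"
  shows "C_diff_on (Suc m) S f"
proof -
  have "C_diff_on m S (partial b f)" if "b \<in> Basis" for b
    by (rule C_diff_on_cong[OF assms(1) _ assms(3)[OF that]]) (simp add: partial_eqI[OF assms(2)])
  then show ?thesis using assms(2) by (auto simp: differentiable_def)
qed

lemma has_derivative_partial:
  "C_diff_on (Suc m) S f \<Longrightarrow> x \<in> S \<Longrightarrow> (f has_derivative (\<lambda>b. partial b f x)) (at x)"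
  using frechet_derivative_works[of f "at x"] by simp

lemma C_diff_on_const: "open S \<Longrightarrow> C_diff_on m S (\<lambda>x. c)"
proof (induction m arbitrary: c)
  case (Suc m)
  show ?case
    by (rule C_diff_on_SucI[OF Suc.prems, where f'="\<lambda>x h. 0"]) (auto intro: Suc)
qed simp

lemma C_diff_on_bounded_linear:
  assumes "open S" "bounded_linear L" "C_diff_on m S f"
  shows "C_diff_on m S (\<lambda>x. L (f x))"
  using assms(3)
proof (induction m arbitrary: f)
  case 0 then show ?case using bounded_linear.continuous_on[OF assms(2)] by auto
next
  case (Suc m)
  show ?case
    by (rule C_diff_on_SucI[OF assms(1), where f'="\<lambda>x h. L (partial h f x)"])
      (auto intro!: bounded_linear.has_derivative[OF assms(2)] has_derivative_partial[OF Suc.prems]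
        Suc.IH C_diff_on_partial[OF Suc.prems])
qed

lemma C_diff_on_add:
  assumes "open S" "C_diff_on m S f" "C_diff_on m S g"
  shows "C_diff_on m S (\<lambda>x. f x + g x)"
  using assms(2,3)
proof (induction m arbitrary: f g)
  case 0 then show ?case by (auto intro: continuous_intros)
next
  case (Suc m)
  show ?case
    by (rule C_diff_on_SucI[OF assms(1), where f'="\<lambda>x h. partial h f x + partial h g x"])
      (auto intro!: has_derivative_add has_derivative_partial[OF Suc.prems(1)] 
        has_derivative_partial[OF Suc.prems(2)]
        Suc.IH C_diff_on_partial[OF Suc.prems(1)] C_diff_on_partial[OF Suc.prems(2)])
qed

lemma C_diff_on_mult:
  fixes f g :: "'a::euclidean_space \<Rightarrow> real"
  assumes "open S" "C_diff_on m S f" "C_diff_on m S g"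
  shows "C_diff_on m S (\<lambda>x. f x * g x)"
  using assms(2,3)
proof (induction m arbitrary: f g)
  case 0 then show ?case by (auto intro: continuous_intros)
next
  case (Suc m)
  note d = has_derivative_partial[OF Suc.prems(1)] has_derivative_partial[OF Suc.prems(2)]
  show ?case
    by (rule C_diff_on_SucI[OF assms(1), where f'="\<lambda>x h. f x * partial h g x + partial h f x * g x"])
      (auto intro!: has_derivative_mult d C_diff_on_add[OF assms(1)] Suc.IH 
        C_diff_on_Suc[OF Suc.prems(1)] C_diff_on_Suc[OF Suc.prems(2)] 
        C_diff_on_partial[OF Suc.prems(1)] C_diff_on_partial[OF Suc.prems(2)])
qed

lemma C_diff_on_cmult:
  fixes f :: "'a::euclidean_space \<Rightarrow> real"
  shows "open S \<Longrightarrow> C_diff_on m S f \<Longrightarrow> C_diff_on m S (\<lambda>x. c * f x)"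
  by (intro C_diff_on_mult C_diff_on_const)

lemma C_diff_on_minus:
  fixes f :: "'a::euclidean_space \<Rightarrow> real"
  shows "open S \<Longrightarrow> C_diff_on m S f \<Longrightarrow> C_diff_on m S (\<lambda>x. - f x)"
  using C_diff_on_cmult[of S m f "-1"] by simp

lemma C_diff_on_sum:
  assumes "open S" "finite I" "\<And>i. i \<in> I \<Longrightarrow> C_diff_on m S (f i)"
  shows "C_diff_on m S (\<lambda>x. \<Sum>i\<in>I. f i x)"
  using assms(2,3) by (induction) (auto intro!: C_diff_on_const C_diff_on_add assms(1))

lemma C_diff_on_inner: "C_diff_on m UNIV (\<lambda>y::'a::euclidean_space. (y - x) \<bullet> b)"
proof (cases m)
  case (Suc j)
  have "C_diff_on (Suc j) UNIV (\<lambda>y. (y - x) \<bullet> b)"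
    by (rule C_diff_on_SucI[where f'="\<lambda>y h. h \<bullet> b"])
      (auto intro!: derivative_eq_intros C_diff_on_const)
  then show ?thesis using Suc by simp
qed (auto intro!: continuous_intros)

lemma has_derivative_norm_diff_power2:
  "((\<lambda>y::'a::euclidean_space. (norm (y - x))\<^sup>2) has_derivative (\<lambda>h. 2 * ((y - x) \<bullet> h))) (at y)"
  unfolding power2_norm_eq_inner by (auto intro!: derivative_eq_intros simp: inner_commute)

lemma C_diff_on_norm_power2: "C_diff_on m UNIV (\<lambda>y::'a::euclidean_space. (norm (y - x))\<^sup>2)"
proof (cases m)
  case (Suc j)
  have "C_diff_on (Suc j) UNIV (\<lambda>y. (norm (y - x))\<^sup>2)"
    by (rule C_diff_on_SucI[OF _ has_derivative_norm_diff_power2])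
      (auto intro!: C_diff_on_cmult C_diff_on_inner)
  then show ?thesis using Suc by simp
qed (auto intro!: continuous_intros)

text \<open>
  Test functions will be polynomials in a positive part \<open>max 0 e\<close>. Such a function is as smooth as
  the order to which the polynomial vanishes at \<open>0\<close> allows, so this order is tracked throughout.
\<close>

abbreviation vanishes :: "nat \<Rightarrow> real poly \<Rightarrow> bool" where
  "vanishes r q \<equiv> \<forall>j<r. coeff q j = 0"

lemma vanishes_pderiv: "vanishes (Suc r) q \<Longrightarrow> vanishes r (pderiv q)"
  by (simp add: coeff_pderiv)

lemma vanishes_factor:
  assumes "vanishes r q"
  obtains p where "q = monom 1 r * p"
proof -
  have "monom 1 r dvd q" using assms by (simp add: monom_1_dvd_iff')
  then show ?thesis using that by (auto simp: dvd_def)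
qed

lemma DERIV_poly_pos_part:
  assumes "vanishes 2 q"
  shows "((\<lambda>r. poly q (max 0 r)) has_real_derivative poly (pderiv q) (max 0 r)) (at r)"
proof -
  have q0: "poly q 0 = 0" "poly (pderiv q) 0 = 0"
    using assms by (auto simp: poly_0_coeff_0 coeff_pderiv)
  consider "r > 0" | "r < 0" | "r = 0" by linarith
  then show ?thesis
  proof cases
    case 1
    have "((\<lambda>r. poly q r) has_real_derivative poly (pderiv q) r) (at r)" by (rule poly_DERIV)
    from has_field_derivative_transform_within_open[OF this, of "{0<..}"] show ?thesis using 1
      by (auto simp: max_def)
  next
    case 2
    have "((\<lambda>r. 0) has_real_derivative 0) (at r)" by simp
    from has_field_derivative_transform_within_open[OF this, of "{..<0}" "\<lambda>r. poly q (max 0 r)"] 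
    show ?thesis using 2 q0 by (auto simp: max_def)
  next
    case 3
    have d: "((\<lambda>h. (poly q h) / h) \<longlongrightarrow> 0) (at 0)"
      using poly_DERIV[of q 0] q0 by (simp add: has_field_derivative_iff)
    have "((\<lambda>h. (poly q (max 0 h)) / h) \<longlongrightarrow> 0) (at 0)"
      by (rule Lim_null_comparison[OF _ tendsto_norm_zero[OF d]])
        (auto simp: max_def q0 simp del: abs_divide intro!: always_eventually)
    then show ?thesis using 3 q0 by (simp add: has_field_derivative_iff)
  qed
qed

text \<open>
  Each differentiation replaces \<open>q\<close> by \<open>pderiv q\<close>, times a derivative of \<open>e\<close>, and costs one order of
  vanishing.
\<close>

lemma C_diff_on_poly_pos_part:
  assumes "open S" "C_diff_on m S e" "vanishes (Suc m) q"
  shows "C_diff_on m S (\<lambda>y. poly q (max 0 (e y)))"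
  using assms(2,3)
proof (induction m arbitrary: q)
  case 0 then show ?case by (auto intro!: continuous_intros)
next
  case (Suc m)
  have v: "vanishes 2 q" using Suc.prems(2) by auto
  have d: "((\<lambda>y. poly q (max 0 (e y))) has_derivative 
      (\<lambda>h. poly (pderiv q) (max 0 (e x)) * partial h e x)) (at x)" if "x \<in> S" for x
    using has_derivative_compose[OF has_derivative_partial[OF Suc.prems(1) that] 
        DERIV_poly_pos_part[OF v, unfolded has_field_derivative_def]] by simp
  show ?case
    by (rule C_diff_on_SucI[OF assms(1) d])
      (auto intro!: C_diff_on_mult assms(1) Suc.IH C_diff_on_Suc[OF Suc.prems(1)]
        C_diff_on_partial[OF Suc.prems(1)] vanishes_pderiv Suc.prems simp del: C_diff_on.simps)
qed

section \<open>Powers of the Laplacian\<close>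

lemma C_diff_on_laplacian:
  assumes "open S" "C_diff_on (m + 2) S g"
  shows "C_diff_on m S (laplacian g)"
  unfolding laplacian_def using assms
  by (intro C_diff_on_sum) auto

lemma laplacian_cong:
  assumes "open S" "x \<in> S" "\<And>y. y \<in> S \<Longrightarrow> f y = g y" "C_diff_on 2 S f"
  shows "laplacian g x = laplacian f x"
proof -
  have f1: "f differentiable (at y)" if "y \<in> S" for y
    using assms(4) that by (simp add: numeral_2_eq_2)
  have f2: "partial b f differentiable (at y)" if "y \<in> S" "b \<in> Basis" for y b
    using assms(4) that by (simp add: numeral_2_eq_2)
  have *: "partial b f y = partial b g y" if "y \<in> S" for b y
    using differentiable_transform_open(2)[OF f1[OF that] assms(1) that assms(3)] by simp
  show ?thesis unfolding laplacian_def
    by (intro sum.cong refl differentiable_transform_open(2)[OF f2[OF assms(2)] assms(1,2) *]) auto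
qed

lemma neg_laplacian_power_0 [simp]: "neg_laplacian_power 0 g = g"
  by (simp add: neg_laplacian_power_def)

lemma neg_laplacian_power_Suc:
  "neg_laplacian_power (Suc k) g = neg_laplacian_power k (\<lambda>x. - laplacian g x)"
  by (simp add: neg_laplacian_power_def funpow_Suc_right del: funpow.simps)

lemma neg_laplacian_power_Suc':
  "neg_laplacian_power (Suc k) g = (\<lambda>x. - laplacian (neg_laplacian_power k g) x)"
  by (simp add: neg_laplacian_power_def)

lemma C_diff_on_neg_laplacian_power:
  assumes "open S" "C_diff_on (m + 2 * k) S g"
  shows "C_diff_on m S (neg_laplacian_power k g)"
  using assms(2)
proof (induction k arbitrary: g)
  case (Suc k)
  show ?case unfolding neg_laplacian_power_Suc
    by (intro Suc.IH C_diff_on_minus[OF assms(1)] C_diff_on_laplacian[OF assms(1)])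
      (use Suc.prems in \<open>simp add: algebra_simps\<close>)
qed simp

lemma neg_laplacian_power_cong:
  assumes "open S" "x \<in> S" "\<And>y. y \<in> S \<Longrightarrow> f y = g y" "C_diff_on (2 * k) S f"
  shows "neg_laplacian_power k g x = neg_laplacian_power k f x"
  using assms(2-4)
proof (induction k arbitrary: f g x)
  case (Suc k)
  have 2: "C_diff_on 2 S f" by (rule C_diff_on_le[OF _ Suc.prems(3)]) simp
  show ?case unfolding neg_laplacian_power_Suc
    by (rule Suc.IH[OF Suc.prems(1)])
      (use Suc.prems assms(1) laplacian_cong[OF assms(1) _ Suc.prems(2) 2] in 
        \<open>auto intro!: C_diff_on_minus C_diff_on_laplacian simp del: C_diff_on.simps\<close>)
qed simp

section \<open>Radial test functions\<close>

text \<open>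
  The basic radial bump: a parabolic cap over the ball of radius \<open>sqrt t\<close> around \<open>x\<close>.
\<close>

definition cap :: "'a::euclidean_space \<Rightarrow> real \<Rightarrow> 'a \<Rightarrow> real" where
  "cap x t y = max 0 (1 - (norm (y - x))\<^sup>2 / t)"

text \<open>
  With \<open>d\<close> half the dimension, this operator describes how the integral of
  \<open>t powr (- d) * u y * poly q (cap x t y)\<close> over \<open>y\<close> responds to the dilation \<open>t * d/dt\<close>:
  the derivative falls on the power of \<open>t\<close>, which gives \<open>- d * q\<close>, and on the cap, for which
  \<open>t * d/dt (cap x t y) = 1 - cap x t y\<close> inside the ball.
\<close>

definition scaling_op :: "real \<Rightarrow> real poly \<Rightarrow> real poly" where
  "scaling_op d q = [:1, -1:] * pderiv q - smult d q"

text \<open>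
  The negative Laplacian, up to the factor \<open>1 / t\<close>, on polynomials in the cap.
\<close>

definition neglap_op :: "real \<Rightarrow> real poly \<Rightarrow> real poly" where
  "neglap_op d q = smult (-4) (scaling_op d (pderiv q))"

lemma has_derivative_one_minus_norm:
  "((\<lambda>y::'a::euclidean_space. 1 - (norm (y - x))\<^sup>2 / t) has_derivative (\<lambda>h. - 2 * ((y - x) \<bullet> h) / t)) (at y)"
  using has_derivative_diff[OF has_derivative_const[of 1] 
      has_derivative_mult_right[OF has_derivative_norm_diff_power2, of "1/t"]] by simp

lemma C_diff_on_one_minus_norm:
  "C_diff_on m UNIV (\<lambda>y::'a::euclidean_space. 1 - (norm (y - x))\<^sup>2 / t)"
  using C_diff_on_add[OF open_UNIV C_diff_on_const[OF open_UNIV, of m 1] 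
      C_diff_on_cmult[OF open_UNIV C_diff_on_norm_power2[of m x], of "-1/t"]] by simp

lemma C_diff_on_cap:
  "vanishes (Suc m) q \<Longrightarrow> C_diff_on m UNIV (\<lambda>y::'a::euclidean_space. poly q (cap x t y))"
  unfolding cap_def by (intro C_diff_on_poly_pos_part C_diff_on_one_minus_norm) auto

lemma has_derivative_poly_cap:
  assumes "vanishes 2 q"
  shows "((\<lambda>y. poly q (cap x t y)) has_derivative 
      (\<lambda>h. poly (pderiv q) (cap x t y) * (- 2 * ((y - x) \<bullet> h) / t))) (at y)"
  unfolding cap_def
  using has_derivative_compose[OF has_derivative_one_minus_norm 
        DERIV_poly_pos_part[OF assms, unfolded has_field_derivative_def]] by simp

text \<open>
  A radial function \<open>F\<close> of \<open>s = |y - x|\<^sup>2\<close> has Laplacian \<open>4 * s * F'' + 2 * n * F'\<close>, and inside the ball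
  \<open>s / t\<close> is \<open>1 - cap x t y\<close>. Hence the polynomials in the cap are stable under the Laplacian.
\<close>

lemma laplacian_poly_cap:
  fixes x :: "'a::euclidean_space"
  assumes "vanishes 3 q" "t > 0"
  shows "- laplacian (\<lambda>y. poly q (cap x t y)) y = 
     poly (smult (1 / t) (neglap_op (DIM('a) / 2) q)) (cap x t y)"
proof -
  let ?\<tau> = "cap x t y"
  have v: "vanishes 2 q" "vanishes 2 (pderiv q)"
    using assms(1) vanishes_pderiv[of 2 q] by (auto simp: numeral_3_eq_3)
  have 1: "partial b (\<lambda>y. poly q (cap x t y)) = 
     (\<lambda>y. poly (pderiv q) (cap x t y) * (- 2 * ((y - x) \<bullet> b) / t))" for b
    by (rule ext, rule partial_eqI, rule has_derivative_poly_cap[OF v(1)])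
  have 2: "partial b (\<lambda>y. poly (pderiv q) (cap x t y) * (- 2 * ((y - x) \<bullet> b) / t)) y =
     poly (pderiv (pderiv q)) ?\<tau> * (4 * ((y - x) \<bullet> b)\<^sup>2 / t\<^sup>2) - poly (pderiv q) ?\<tau> * (2 / t)" 
    if "b \<in> Basis" for b
  proof -
    have "((\<lambda>y. poly (pderiv q) (cap x t y) * (- 2 * ((y - x) \<bullet> b) / t)) has_derivative
      (\<lambda>h. poly (pderiv q) ?\<tau> * (- 2 * (h \<bullet> b) / t) + 
        (poly (pderiv (pderiv q)) ?\<tau> * (- 2 * ((y - x) \<bullet> h) / t)) * (- 2 * ((y - x) \<bullet> b) / t))) (at y)"
      by (rule has_derivative_mult[OF has_derivative_poly_cap[OF v(2)]])
        (use assms(2) in \<open>auto intro!: derivative_eq_intros\<close>)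
    from partial_eqI[OF this, of b] show ?thesis using that
      by (simp add: power2_eq_square)
  qed
  have s: "(\<Sum>b\<in>Basis. ((y - x) \<bullet> b)\<^sup>2) = (norm (y - x))\<^sup>2"
    unfolding power2_norm_eq_inner by (subst euclidean_inner) (simp add: power2_eq_square)
  have "laplacian (\<lambda>y. poly q (cap x t y)) y = 
    (\<Sum>b\<in>Basis. poly (pderiv (pderiv q)) ?\<tau> * (4 * ((y - x) \<bullet> b)\<^sup>2 / t\<^sup>2) - poly (pderiv q) ?\<tau> * (2 / t))"
    unfolding laplacian_def 1 by (intro sum.cong refl 2)
  also have "\<dots> = poly (pderiv (pderiv q)) ?\<tau> * (4 * (norm (y - x))\<^sup>2 / t\<^sup>2) - DIM('a) * (poly (pderiv q) ?\<tau> * (2 / t))"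
    unfolding sum_subtractf by (simp add: s[symmetric] sum_distrib_left sum_divide_distrib)
  also have "poly (pderiv (pderiv q)) ?\<tau> * (4 * (norm (y - x))\<^sup>2 / t\<^sup>2) = 
     poly (pderiv (pderiv q)) ?\<tau> * (4 / t * (1 - ?\<tau>))"
  proof (cases "?\<tau> = 0")
    case True
    have "poly (pderiv (pderiv q)) 0 = 0" using v(2) by (simp add: poly_0_coeff_0 coeff_pderiv)
    then show ?thesis using True by simp
  next
    case False
    then have "?\<tau> = 1 - (norm (y - x))\<^sup>2 / t" unfolding cap_def by (auto simp: max_def split: if_splits)
    then have "(norm (y - x))\<^sup>2 = t * (1 - ?\<tau>)" using assms(2) by (simp add: field_simps)
    then show ?thesis using assms(2) by (simp add: power2_eq_square[of t])
  qed
  finally have L: "laplacian (\<lambda>y. poly q (cap x t y)) y = poly (pderiv (pderiv q)) ?\<tau> * (4 / t * (1 - ?\<tau>)) -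
      DIM('a) * (poly (pderiv q) ?\<tau> * (2 / t))" .
  show ?thesis unfolding L using assms(2) by (simp add: neglap_op_def scaling_op_def field_simps)
qed

lemma vanishes_scaling_op: "vanishes (Suc r) q \<Longrightarrow> vanishes r (scaling_op d q)"
  by (auto simp: scaling_op_def coeff_pderiv coeff_pCons split: nat.splits)

lemma vanishes_neglap_op: "vanishes (r + 2) q \<Longrightarrow> vanishes r (neglap_op d q)"
  using vanishes_scaling_op[of r "pderiv q"] vanishes_pderiv[of "Suc r" q] by (simp add: neglap_op_def)

lemma vanishes_neglap_op_power: "vanishes (r + 2 * k) q \<Longrightarrow> vanishes r ((neglap_op d ^^ k) q)"
proof (induction k arbitrary: q)
  case (Suc k)
  have "vanishes (r + 2 * k) (neglap_op d q)" using Suc.prems vanishes_neglap_op[of "r + 2 * k" q d] by simp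
  from Suc.IH[OF this] show ?case by (simp add: funpow_swap1)
qed simp

lemma neglap_op_smult: "neglap_op d (smult a q) = smult a (neglap_op d q)"
  by (subst poly_eq_poly_eq_iff[symmetric])
    (auto simp: fun_eq_iff neglap_op_def scaling_op_def pderiv_smult algebra_simps)

lemma neglap_op_power_smult: "(neglap_op d ^^ k) (smult a q) = smult a ((neglap_op d ^^ k) q)"
  by (induction k) (auto simp: neglap_op_smult)

lemma neg_laplacian_power_poly_cap:
  fixes x :: "'a::euclidean_space"
  assumes "vanishes (Suc (2 * k)) q" "t > 0"
  shows "neg_laplacian_power k (\<lambda>y. poly q (cap x t y)) = 
     (\<lambda>y. (1 / t) ^ k * poly ((neglap_op (DIM('a) / 2) ^^ k) q) (cap x t y))"
  using assms(1)
proof (induction k arbitrary: q)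
  case (Suc k)
  have "vanishes (Suc (2 * k)) (smult (1 / t) (neglap_op (DIM('a) / 2) q))"
    using vanishes_neglap_op[of "Suc (2 * k)" q "DIM('a)/2"] Suc.prems by simp
  note IH = Suc.IH[OF this]
  have v3: "vanishes 3 q" using Suc.prems by auto
  show ?case
    unfolding neg_laplacian_power_Suc laplacian_poly_cap[OF v3 assms(2)] IH
    by (simp add: neglap_op_power_smult funpow_swap1 field_simps)
qed simp

section \<open>Green's identity\<close>

lemma lborel_integral_translation:
  fixes f :: "'a::euclidean_space \<Rightarrow> real"
  assumes "f \<in> borel_measurable borel"
  shows "(LINT x|lborel. f (c + x)) = (LINT x|lborel. f x)"
proof -
  have "(LINT x|lborel. f x) = (LINT x|distr lborel borel ((+) c). f x)"
    by (simp add: lborel_distr_plus)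
  also have "\<dots> = (LINT x|lborel. f (c + x))"
    by (rule integral_distr) (use assms in auto)
  finally show ?thesis by simp
qed

lemma compact_support_integrable:
  fixes f :: "'a::euclidean_space \<Rightarrow> real"
  assumes "continuous_on UNIV f" "compact K" "\<And>x. x \<notin> K \<Longrightarrow> f x = 0"
  shows "integrable lborel f"
proof -
  have "set_integrable lborel K f" unfolding set_integrable_def
    by (rule borel_integrable_compact[OF assms(2)]) (rule continuous_on_subset[OF assms(1)], simp)
  moreover have "(\<lambda>x. indicat_real K x *\<^sub>R f x) = f"
    by (auto simp: fun_eq_iff indicator_def assms(3))
  ultimately show ?thesis by (simp add: set_integrable_def)
qed

lemma compact_support_bounded:
  fixes f :: "'a::euclidean_space \<Rightarrow> real"
  assumes "continuous_on UNIV f" "compact K" "\<And>x. x \<notin> K \<Longrightarrow> f x = 0"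
  obtains B where "B > 0" "\<And>x. \<bar>f x\<bar> \<le> B"
proof -
  have "compact (f ` K)" 
    by (rule compact_continuous_image[OF continuous_on_subset[OF assms(1)] assms(2)]) simp
  then obtain B where B: "\<And>y. y \<in> f ` K \<Longrightarrow> norm y \<le> B" 
    using compact_imp_bounded bounded_iff by metis
  have "\<bar>f x\<bar> \<le> max B 1" for x
    using B[of "f x"] assms(3)[of x] by (cases "x \<in> K") auto
  then show ?thesis using that[of "max B 1"] by auto
qed

text \<open>
  By translation invariance the integral of every difference quotient of \<open>g\<close> vanishes; the
  quotients are bounded by the supremum of the derivative on a fixed ball, so the limit can be
  taken under the integral.
\<close>

lemma integral_partial_eq_0:
  fixes g :: "'a::euclidean_space \<Rightarrow> real"
  assumes C1: "C_diff_on 1 UNIV g" and b: "b \<in> Basis"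
    and K: "compact K" "\<And>x. x \<notin> K \<Longrightarrow> g x = 0"
  shows "(LINT x|lborel. partial b g x) = 0"
proof -
  have d: "(g has_derivative (\<lambda>h. partial h g x)) (at x)" for x
    using has_derivative_partial[of 0 UNIV g x] C1 by simp
  have cg: "continuous_on UNIV g" by (rule C_diff_on_continuous[OF C1])
  have cp: "continuous_on UNIV (partial b g)" using C1 b by simp
  have K0: "partial b g x = 0" if "x \<notin> K" for x
  proof -
    have "open (- K)" using K(1) by (simp add: compact_imp_closed open_Compl)
    then have "partial b (\<lambda>_. 0) x = partial b g x"
      using differentiable_transform_open(2)[of g x "-K" "\<lambda>_. 0" b] d that K(2)
      by (auto simp: differentiable_def)
    then show ?thesis by simp
  qed
  obtain B where B: "B > 0" "\<And>x. \<bar>partial b g x\<bar> \<le> B" 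
    using compact_support_bounded[OF cp K(1) K0] by blast
  have line: "((\<lambda>s. g (x + s *\<^sub>R b)) has_real_derivative partial b g (x + s *\<^sub>R b)) (at s)" for x s
  proof -
    have l: "((\<lambda>s. x + s *\<^sub>R b) has_derivative (\<lambda>s. s *\<^sub>R b)) (at s)"
      by (auto intro!: derivative_eq_intros)
    have "((\<lambda>s. g (x + s *\<^sub>R b)) has_derivative (\<lambda>h. partial (h *\<^sub>R b) g (x + s *\<^sub>R b))) (at s)"
      using has_derivative_compose[OF l d] by simp
    moreover have "partial (h *\<^sub>R b) g (x + s *\<^sub>R b) = partial b g (x + s *\<^sub>R b) * h" for h
      using linear_cmul[OF has_derivative_linear[OF d]] by (metis mult.commute real_scaleR_def)
    ultimately show ?thesis by (simp add: has_field_derivative_def)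
  qed
  define t where "t i = 1 / real (Suc i)" for i
  have t: "0 < t i" "t i \<le> 1" for i by (auto simp: t_def)
  have t0: "t \<longlonglongrightarrow> 0" unfolding t_def by (use LIMSEQ_inverse_real_of_nat in \<open>simp add: inverse_eq_divide\<close>)
  define Q where "Q i x = (g (t i *\<^sub>R b + x) - g x) / t i" for i x
  have mg: "g \<in> borel_measurable borel" using cg by (rule borel_measurable_continuous_onI)
  have mt: "(\<lambda>x. g (c + x)) \<in> borel_measurable borel" for c
    by (intro borel_measurable_continuous_onI continuous_on_compose2[OF cg] continuous_intros) auto
  obtain R where R: "K \<subseteq> cball 0 R" 
    using compact_imp_bounded[OF K(1)] by (auto simp: bounded_iff subset_eq)
  have ig: "integrable lborel g" by (rule compact_support_integrable[OF cg K]) 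
  have it: "integrable lborel (\<lambda>x. g (c + x))" for c
  proof -
    have "continuous_on UNIV (\<lambda>x. g (c + x))"
      by (intro continuous_on_compose2[OF cg] continuous_intros) auto
    moreover have "compact (cball (-c) R)" by simp
    moreover have "g (c + x) = 0" if "x \<notin> cball (-c) R" for x
    proof (rule K(2))
      have "norm (c + x) = dist (- c) x"
        using norm_minus_commute[of "- c" x] by (simp add: dist_norm add.commute)
      then show "c + x \<notin> K" using that R by fastforce
    qed
    ultimately show ?thesis by (rule compact_support_integrable)
  qed
  have Q0: "(LINT x|lborel. Q i x) = 0" for i
    unfolding Q_def by (simp add: Bochner_Integration.integral_diff[OF it ig] lborel_integral_translation[OF mg])
  have "(\<lambda>i. LINT x|lborel. Q i x) \<longlonglongrightarrow> (LINT x|lborel. partial b g x)"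
  proof (rule integral_dominated_convergence[where w="\<lambda>x. B * indicator (cball 0 (R + 1)) x"])
    show "partial b g \<in> borel_measurable lborel" 
      using borel_measurable_continuous_onI[OF cp] by simp
    show "Q i \<in> borel_measurable lborel" for i unfolding Q_def using mg mt[of "t i *\<^sub>R b"] by measurable
    show "integrable lborel (\<lambda>x. B * indicator (cball 0 (R + 1)) x :: real)"
      by (intro integrable_mult_right integrable_real_indicator) (auto simp: emeasure_lborel_cball_finite[unfolded infinity_ennreal_def])
    show "AE x in lborel. (\<lambda>i. Q i x) \<longlonglongrightarrow> partial b g x"
    proof (rule AE_I2)
      fix x
      have "((\<lambda>h. (g (x + h *\<^sub>R b) - g x) / h) \<longlongrightarrow> partial b g x) (at 0)"
        using line[of x 0] by (simp add: has_field_derivative_iff)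
      moreover have "filterlim t (at 0) sequentially"
        using t0 t(1) by (auto simp: filterlim_at intro!: always_eventually less_imp_neq[symmetric])
      ultimately show "(\<lambda>i. Q i x) \<longlonglongrightarrow> partial b g x"
        unfolding Q_def by (subst add.commute) (rule filterlim_compose)
    qed
    show "AE x in lborel. norm (Q i x) \<le> B * indicator (cball 0 (R + 1)) x" for i
    proof (rule AE_I2)
      fix x
      show "norm (Q i x) \<le> B * indicator (cball 0 (R + 1)) x"
      proof (cases "x \<in> cball 0 (R + 1)")
        case True
        obtain s where s: "g (x + t i *\<^sub>R b) - g (x + 0 *\<^sub>R b) = (t i - 0) * partial b g (x + s *\<^sub>R b)"
          using MVT2[of 0 "t i" "\<lambda>s. g (x + s *\<^sub>R b)" "\<lambda>s. partial b g (x + s *\<^sub>R b)"] t(1) line by blast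
        then have "Q i x = partial b g (x + s *\<^sub>R b)" using t(1)[of i] 
          by (simp add: Q_def field_simps)
        then show ?thesis using True B(2) by simp
      next
        case False
        have "norm (t i *\<^sub>R b) \<le> 1" using t[of i] b by simp
        then have "norm (t i *\<^sub>R b + x) > R" using False norm_diff_ineq[of x "t i *\<^sub>R b"] 
          by (auto simp: add.commute)
        then have "t i *\<^sub>R b + x \<notin> K" "x \<notin> K" using False R by auto
        then show ?thesis using False K(2) by (simp add: Q_def)
      qed
    qed
  qed
  then show ?thesis unfolding Q0 by (simp add: LIMSEQ_const_iff)
qed

lemma C_diff_on_open_cover:
  assumes "open S" "open T" "S \<union> T = UNIV" "C_diff_on m S f" "C_diff_on m T f"
  shows "C_diff_on m UNIV f"
  using assms(4,5)
proof (induction m arbitrary: f)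
  case 0
  then show ?case using continuous_on_open_Un[OF assms(1,2)] assms(3) by auto
next
  case (Suc m)
  then show ?case using assms(3) by auto
qed

text \<open>
  Here \<open>f\<close> is regular only on \<open>S\<close>. The product with a function supported in a compact part of \<open>S\<close> is
  regular everywhere, since it vanishes on the open complement of the support.
\<close>

lemma C_diff_on_mult_support:
  fixes f g :: "'a::euclidean_space \<Rightarrow> real"
  assumes "open S" "compact K" "K \<subseteq> S" "C_diff_on m S f" "C_diff_on m S g" 
    "\<And>x. x \<notin> K \<Longrightarrow> g x = 0"
  shows "C_diff_on m UNIV (\<lambda>x. f x * g x)"
proof (rule C_diff_on_open_cover[OF assms(1)])
  show o: "open (-K)" using assms(2) by (simp add: compact_imp_closed open_Compl)
  show "S \<union> - K = UNIV" using assms(3) by auto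
  show "C_diff_on m S (\<lambda>x. f x * g x)" by (rule C_diff_on_mult[OF assms(1,4,5)])
  show "C_diff_on m (- K) (\<lambda>x. f x * g x)" 
    by (rule C_diff_on_cong[OF o _ C_diff_on_const[OF o, of m 0]]) (simp add: assms(6))
qed

lemma partial_support:
  assumes "compact K" "\<And>x. x \<notin> K \<Longrightarrow> g x = 0" "x \<notin> K"
  shows "partial b g x = 0"
proof -
  have o: "open (- K)" using assms(1) by (simp add: compact_imp_closed open_Compl)
  have "partial b g x = partial b (\<lambda>_. 0) x"
    by (rule differentiable_transform_open(2)[of "\<lambda>_. 0" x "-K" g b]) (use o assms(2,3) in auto)
  then show ?thesis by simp
qed

lemma laplacian_support:
  assumes "compact K" "\<And>x. x \<notin> K \<Longrightarrow> g x = 0" "x \<notin> K"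
  shows "laplacian g x = 0"
  unfolding laplacian_def
  by (intro sum.neutral ballI partial_support[OF assms(1) _ assms(3)] partial_support[OF assms(1,2)])

lemma neg_laplacian_power_support:
  assumes "compact K" "\<And>x. x \<notin> K \<Longrightarrow> g x = 0" "x \<notin> K"
  shows "neg_laplacian_power k g x = 0"
  using assms(2,3)
proof (induction k arbitrary: g x)
  case (Suc k)
  show ?case unfolding neg_laplacian_power_Suc
    by (rule Suc.IH[OF _ Suc.prems(2)]) (use laplacian_support[OF assms(1) Suc.prems(1)] in auto)
qed simp

text \<open>
  The integrand of the difference of both sides is the divergence of
  \<open>u * grad \<phi> - \<phi> * grad u\<close>, a \<open>C\<^sup>1\<close> field with compact support.
\<close>

lemma green_laplacian:
  fixes u \<phi> :: "'a::euclidean_space \<Rightarrow> real"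
  assumes S: "open S" "C_diff_on 2 S u" "C_diff_on 2 UNIV \<phi>" and K: "compact K" "K \<subseteq> S"
    and 0: "\<And>x. x \<notin> K \<Longrightarrow> \<phi> x = 0"
  shows "(LINT x|lborel. u x * laplacian \<phi> x) = (LINT x|lborel. laplacian u x * \<phi> x)"
proof -
  have \<phi>S: "C_diff_on 2 S \<phi>" using C_diff_on_subset[OF _ S(3)] by simp
  note two = numeral_2_eq_2
  have p: "C_diff_on 1 S (partial b u)" "C_diff_on 1 S (partial b \<phi>)" "C_diff_on 1 UNIV (partial b \<phi>)" if "b \<in> Basis" for b
    using S(2,3) \<phi>S that by (simp_all add: two)
  have 1: "C_diff_on 1 S u" "C_diff_on 1 S \<phi>" "C_diff_on 1 UNIV \<phi>"
    using C_diff_on_Suc[of 1 S u] C_diff_on_Suc[of 1 S \<phi>] C_diff_on_Suc[of 1 UNIV \<phi>] S \<phi>S by (simp_all only: two One_nat_def)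
  define F where "F b x = u x * partial b \<phi> x + (- 1) * (partial b u x * \<phi> x)" for b x
  have FC: "C_diff_on 1 UNIV (F b)" if "b \<in> Basis" for b
    unfolding F_def
    by (intro C_diff_on_add C_diff_on_cmult C_diff_on_mult_support[OF S(1) K] open_UNIV p that 1 0
        partial_support[OF K(1) 0])
  have F0: "F b x = 0" if "x \<notin> K" for b x
    using 0[OF that] partial_support[OF K(1) 0 that] by (simp add: F_def)
  have dF: "partial b (F b) x = u x * partial b (partial b \<phi>) x - partial b (partial b u) x * \<phi> x" 
    if b: "b \<in> Basis" for b x
  proof (cases "x \<in> S")
    case True
    have "(F b has_derivative (\<lambda>h. (u x * partial h (partial b \<phi>) x + partial h u x * partial b \<phi> x) + 
       (- 1) * (partial b u x * partial h \<phi> x + partial h (partial b u) x * \<phi> x))) (at x)"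
      unfolding F_def
      by (intro has_derivative_add has_derivative_mult_right has_derivative_mult 
         has_derivative_partial[OF p(1)[OF b, unfolded One_nat_def] True]
         has_derivative_partial[OF p(2)[OF b, unfolded One_nat_def] True]
         has_derivative_partial[OF 1(1)[unfolded One_nat_def] True] 
         has_derivative_partial[OF 1(2)[unfolded One_nat_def] True])
    from partial_eqI[OF this, of b] show ?thesis by simp
  next
    case False
    then have x: "x \<notin> K" using K by auto
    have "partial b (F b) x = 0" by (rule partial_support[OF K(1) F0 x])
    moreover have "partial b (partial b \<phi>) x = 0" 
      by (rule partial_support[OF K(1) partial_support[OF K(1) 0] x])
    ultimately show ?thesis using 0[OF x] by simp
  qed
  have cdF: "continuous_on UNIV (partial b (F b))" if "b \<in> Basis" for b
    using FC[OF that] that by simp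
  have idF: "integrable lborel (partial b (F b))" if "b \<in> Basis" for b
    by (rule compact_support_integrable[OF cdF[OF that] K(1)])
      (use partial_support[OF K(1) F0] in auto)
  have "(\<Sum>b\<in>Basis. LINT x|lborel. partial b (F b) x) = 0"
    by (intro sum.neutral ballI integral_partial_eq_0[OF FC _ K(1) F0]) auto
  then have "(LINT x|lborel. (\<Sum>b\<in>Basis. partial b (F b) x)) = 0"
    using Bochner_Integration.integral_sum[of Basis lborel "\<lambda>b. partial b (F b)"] idF by simp
  also have "(\<lambda>x. \<Sum>b\<in>Basis. partial b (F b) x) = (\<lambda>x. u x * laplacian \<phi> x - laplacian u x * \<phi> x)"
    by (auto simp: fun_eq_iff dF sum_subtractf laplacian_def sum_distrib_left sum_distrib_right)
  finally have *: "(LINT x|lborel. u x * laplacian \<phi> x - laplacian u x * \<phi> x) = 0" .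
  have i: "integrable lborel (\<lambda>x. u x * laplacian \<phi> x)" "integrable lborel (\<lambda>x. laplacian u x * \<phi> x)"
  proof -
    have c: "C_diff_on 0 S (laplacian u)" "C_diff_on 0 S (laplacian \<phi>)"
      using S \<phi>S by (auto intro!: C_diff_on_laplacian simp del: C_diff_on.simps simp: two)
    have "C_diff_on 0 UNIV (\<lambda>x. u x * laplacian \<phi> x)"
      by (rule C_diff_on_mult_support[OF S(1) K C_diff_on_le[OF _ S(2)] c(2) laplacian_support[OF K(1) 0]]) auto
    then show "integrable lborel (\<lambda>x. u x * laplacian \<phi> x)"
      using laplacian_support[OF K(1) 0] by (intro compact_support_integrable[OF _ K(1)]) auto
    have "C_diff_on 0 UNIV (\<lambda>x. laplacian u x * \<phi> x)"
      by (rule C_diff_on_mult_support[OF S(1) K c(1) C_diff_on_le[OF _ \<phi>S] 0]) auto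
    then show "integrable lborel (\<lambda>x. laplacian u x * \<phi> x)"
      using 0 by (intro compact_support_integrable[OF _ K(1)]) auto
  qed
  show ?thesis using * by (simp add: Bochner_Integration.integral_diff[OF i])
qed

lemma green_neg_laplacian_power:
  fixes u \<phi> :: "'a::euclidean_space \<Rightarrow> real"
  assumes S: "open S" "C_diff_on (2 * k) S u" "C_diff_on (2 * k) UNIV \<phi>" and K: "compact K" "K \<subseteq> S"
    and 0: "\<And>x. x \<notin> K \<Longrightarrow> \<phi> x = 0"
  shows "(LINT x|lborel. u x * neg_laplacian_power k \<phi> x) = (LINT x|lborel. neg_laplacian_power k u x * \<phi> x)"
  using S(2,3) 0
proof (induction k arbitrary: u \<phi>)
  case (Suc k)
  have 2: "C_diff_on 2 S u" by (rule C_diff_on_le[OF _ Suc.prems(1)]) simp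
  have p2: "C_diff_on (2 * k) UNIV \<phi>" by (rule C_diff_on_le[OF _ Suc.prems(2)]) simp
  have "(LINT x|lborel. u x * neg_laplacian_power (Suc k) \<phi> x) = 
     - (LINT x|lborel. u x * laplacian (neg_laplacian_power k \<phi>) x)"
    unfolding neg_laplacian_power_Suc' by simp
  also have "\<dots> = - (LINT x|lborel. laplacian u x * neg_laplacian_power k \<phi> x)"
    by (subst green_laplacian[OF S(1) _ _ K])
      (use Suc.prems 2 in \<open>auto intro!: C_diff_on_neg_laplacian_power neg_laplacian_power_support[OF K(1)] 
        simp del: C_diff_on.simps\<close>)
  also have "\<dots> = (LINT x|lborel. (- laplacian u x) * neg_laplacian_power k \<phi> x)" by simp
  also have "\<dots> = (LINT x|lborel. neg_laplacian_power k (\<lambda>x. - laplacian u x) x * \<phi> x)"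
    by (rule Suc.IH) (use Suc.prems S(1) p2 in \<open>auto intro!: C_diff_on_minus C_diff_on_laplacian simp del: C_diff_on.simps\<close>)
  finally show ?case by (simp add: neg_laplacian_power_Suc)
qed simp

section \<open>Removability of the origin\<close>

text \<open>
  All partial derivatives of order \<open>j \<le> m\<close> are bounded by \<open>A / r ^ j\<close>. This is the natural bound for
  a function that varies on the length scale \<open>r\<close>: it is preserved by products up to a constant that
  does not depend on \<open>r\<close>, and rescaling a function by \<open>e\<close> changes \<open>r\<close> into \<open>r * e\<close>.
\<close>

fun deriv_bound :: "nat \<Rightarrow> real \<Rightarrow> real \<Rightarrow> ('a::euclidean_space \<Rightarrow> real) \<Rightarrow> bool" where
  "deriv_bound 0 A r g \<longleftrightarrow> (\<forall>y. \<bar>g y\<bar> \<le> A)"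
| "deriv_bound (Suc m) A r g \<longleftrightarrow> (\<forall>y. \<bar>g y\<bar> \<le> A) \<and> (\<forall>y. g differentiable (at y)) \<and>
     (\<forall>b\<in>Basis. deriv_bound m (A / r) r (partial b g))"

lemma deriv_bound_mono: "deriv_bound m A r g \<Longrightarrow> A \<le> A' \<Longrightarrow> 0 < r \<Longrightarrow> deriv_bound m A' r g"
proof (induction m arbitrary: A A' g)
  case 0 then show ?case by (auto intro: order_trans)
next
  case (Suc m)
  have "A / r \<le> A' / r" using Suc.prems by (simp add: divide_right_mono)
  then have "deriv_bound m (A' / r) r (partial b g)" if "b \<in> Basis" for b
    using Suc.IH[of "A / r" "partial b g" "A' / r"] Suc.prems that by simp
  then show ?case using Suc.prems by (auto intro: order_trans)
qed

lemma deriv_bound_Suc: "deriv_bound (Suc m) A r g \<Longrightarrow> deriv_bound m A r g"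
  by (induction m arbitrary: A g) auto

lemma deriv_bound_SucI:
  assumes "\<And>y. \<bar>g y\<bar> \<le> A" "\<And>y. (g has_derivative g' y) (at y)"
    "\<And>b. b \<in> Basis \<Longrightarrow> deriv_bound m (A / r) r (\<lambda>y. g' y b)"
  shows "deriv_bound (Suc m) A r g"
proof -
  have "partial b g = (\<lambda>y. g' y b)" for b
    by (rule ext, rule partial_eqI[OF assms(2)])
  then show ?thesis using assms by (auto simp: differentiable_def)
qed

lemma deriv_bound_has_derivative:
  "deriv_bound (Suc m) A r g \<Longrightarrow> (g has_derivative (\<lambda>h. partial h g y)) (at y)"
  using frechet_derivative_works[of g "at y"] by simp

lemma deriv_bound_const: "0 < r \<Longrightarrow> \<bar>c\<bar> \<le> A \<Longrightarrow> deriv_bound m A r (\<lambda>_. c)"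
proof (induction m arbitrary: A c)
  case (Suc m)
  show ?case
    by (rule deriv_bound_SucI[where g'="\<lambda>_ _. 0"]) (use Suc in \<open>auto intro!: Suc.IH\<close>)
qed simp

lemma deriv_bound_cmult: "deriv_bound m A r g \<Longrightarrow> deriv_bound m (\<bar>c\<bar> * A) r (\<lambda>y. c * g y)"
proof (induction m arbitrary: A g)
  case 0 then show ?case by (auto simp: abs_mult intro!: mult_left_mono)
next
  case (Suc m)
  show ?case
  proof (rule deriv_bound_SucI[where g'="\<lambda>y h. c * partial h g y"])
    show "\<bar>c * g y\<bar> \<le> \<bar>c\<bar> * A" for y
      using Suc.prems by (auto simp: abs_mult intro!: mult_left_mono)
    show "((\<lambda>y. c * g y) has_derivative (\<lambda>h. c * partial h g y)) (at y)" for y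
      by (rule has_derivative_mult_right[OF deriv_bound_has_derivative[OF Suc.prems]])
    show "deriv_bound m (\<bar>c\<bar> * A / r) r (\<lambda>y. c * partial b g y)" if "b \<in> Basis" for b
      using Suc.IH[of "A / r" "partial b g"] Suc.prems that by simp
  qed
qed

lemma deriv_bound_add:
  "deriv_bound m A r f \<Longrightarrow> deriv_bound m B r g \<Longrightarrow> deriv_bound m (A + B) r (\<lambda>y. f y + g y)"
proof (induction m arbitrary: A B f g)
  case 0 then show ?case by (auto intro: order_trans[OF abs_triangle_ineq] add_mono)
next
  case (Suc m)
  show ?case
  proof (rule deriv_bound_SucI[where g'="\<lambda>y h. partial h f y + partial h g y"])
    show "\<bar>f y + g y\<bar> \<le> A + B" for y
      using Suc.prems by (auto intro: order_trans[OF abs_triangle_ineq] add_mono)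
    show "((\<lambda>y. f y + g y) has_derivative (\<lambda>h. partial h f y + partial h g y)) (at y)" for y
      by (intro has_derivative_add deriv_bound_has_derivative[OF Suc.prems(1)] deriv_bound_has_derivative[OF Suc.prems(2)])
    show "deriv_bound m ((A + B) / r) r (\<lambda>y. partial b f y + partial b g y)" if "b \<in> Basis" for b
      using Suc.IH[of "A / r" "partial b f" "B / r" "partial b g"] Suc.prems that by (simp add: add_divide_distrib)
  qed
qed

lemma deriv_bound_sum:
  assumes "0 < r" "finite I" "\<And>i. i \<in> I \<Longrightarrow> deriv_bound m A r (f i)"
  shows "deriv_bound m (real (card I) * A) r (\<lambda>y. \<Sum>i\<in>I. f i y)"
  using assms(2,3)
proof (induction)
  case empty then show ?case by (simp add: deriv_bound_const assms(1))
next
  case (insert i I)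
  then show ?case using deriv_bound_add[of m A r "f i" "real (card I) * A" "\<lambda>y. \<Sum>i\<in>I. f i y"]
    by (simp add: algebra_simps)
qed

text \<open>
  The factor \<open>2 ^ m\<close> counts the terms of the Leibniz rule.
\<close>

lemma deriv_bound_mult:
  assumes "0 < r" 
  shows "deriv_bound m A r f \<Longrightarrow> deriv_bound m B r g \<Longrightarrow> deriv_bound m (2 ^ m * A * B) r (\<lambda>y. f y * g y)"
proof (induction m arbitrary: A B f g)
  case 0 then show ?case 
    by (auto simp: abs_mult intro!: mult_mono intro: order_trans[OF abs_ge_zero])
next
  case (Suc m)
  have b: "\<bar>f y\<bar> \<le> A" "\<bar>g y\<bar> \<le> B" for y using Suc.prems by auto
  have AB: "0 \<le> A" "0 \<le> B" using b[of undefined] by (auto intro: order_trans[OF abs_ge_zero])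
  show ?case
  proof (rule deriv_bound_SucI[where g'="\<lambda>y h. f y * partial h g y + partial h f y * g y"])
    fix y
    have "\<bar>f y * g y\<bar> \<le> A * B" using b AB by (auto simp: abs_mult intro!: mult_mono)
    also have "\<dots> \<le> 2 ^ Suc m * (A * B)" 
      using mult_right_mono[OF one_le_power[of "2::real" "Suc m"], of "A * B"] AB by simp
    finally show "\<bar>f y * g y\<bar> \<le> 2 ^ Suc m * A * B" by (simp add: mult.assoc)
    show "((\<lambda>y. f y * g y) has_derivative (\<lambda>h. f y * partial h g y + partial h f y * g y)) (at y)"
      by (intro has_derivative_mult deriv_bound_has_derivative[OF Suc.prems(1)] deriv_bound_has_derivative[OF Suc.prems(2)])
  next
    fix b :: 'a assume b: "b \<in> Basis"
    have "deriv_bound m (2 ^ m * A * (B / r) + 2 ^ m * (A / r) * B) r (\<lambda>y. f y * partial b g y + partial b f y * g y)"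
      by (intro deriv_bound_add Suc.IH deriv_bound_Suc[OF Suc.prems(1)] deriv_bound_Suc[OF Suc.prems(2)])
        (use Suc.prems b in auto)
    then show "deriv_bound m (2 ^ Suc m * A * B / r) r (\<lambda>y. f y * partial b g y + partial b f y * g y)"
      by (simp add: algebra_simps)
  qed
qed

lemma deriv_bound_laplacian:
  fixes g :: "'a::euclidean_space \<Rightarrow> real"
  assumes "0 < r" "deriv_bound (m + 2) A r g"
  shows "deriv_bound m (DIM('a) / r\<^sup>2 * A) r (\<lambda>x. - laplacian g x)"
proof -
  have "deriv_bound m (A / r / r) r (partial b (partial b g))" if "b \<in> Basis" for b
    using assms(2) that by simp
  from deriv_bound_sum[OF assms(1) finite_Basis this]
  have "deriv_bound m (DIM('a) * (A / r / r)) r (laplacian g)"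
    unfolding laplacian_def by simp
  from deriv_bound_cmult[OF this, of "-1"] show ?thesis by (simp add: power2_eq_square)
qed

lemma neg_laplacian_power_bound:
  fixes g :: "'a::euclidean_space \<Rightarrow> real"
  assumes "0 < r" "deriv_bound (2 * k) A r g"
  shows "\<bar>neg_laplacian_power k g y\<bar> \<le> (DIM('a) / r\<^sup>2) ^ k * A"
  using assms(2)
proof (induction k arbitrary: A g)
  case (Suc k)
  have "deriv_bound (2 * k) (DIM('a) / r\<^sup>2 * A) r (\<lambda>x. - laplacian g x)"
    by (rule deriv_bound_laplacian[OF assms(1)]) (use Suc.prems in simp)
  from Suc.IH[OF this] show ?case by (simp add: neg_laplacian_power_Suc algebra_simps)
qed simp

lemma deriv_bound_compact_support:
  fixes g :: "'a::euclidean_space \<Rightarrow> real"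
  assumes "C_diff_on m UNIV g" "compact K" "\<And>x. x \<notin> K \<Longrightarrow> g x = 0"
  shows "\<exists>A>0. deriv_bound m A 1 g"
  using assms(1,3)
proof (induction m arbitrary: g)
  case 0 
  obtain B where "B > 0" "\<And>x. \<bar>g x\<bar> \<le> B"
    by (rule compact_support_bounded[OF C_diff_on_continuous[OF 0(1)] assms(2) 0(2)]) auto
  then show ?case by auto
next
  case (Suc m)
  obtain B where B: "B > 0" "\<And>x. \<bar>g x\<bar> \<le> B"
    by (rule compact_support_bounded[OF C_diff_on_continuous[OF Suc.prems(1)] assms(2) Suc.prems(2)]) auto
  have "\<exists>A>0. deriv_bound m A 1 (partial b g)" if "b \<in> Basis" for b
    by (rule Suc.IH) (use Suc.prems(1) that partial_support[OF assms(2) Suc.prems(2)] in auto)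
  then obtain A where A: "\<And>b. b \<in> Basis \<Longrightarrow> A b > 0 \<and> deriv_bound m (A b) 1 (partial b g)" by metis
  define M where "M = B + (\<Sum>b\<in>Basis. A b)"
  have s0: "0 \<le> (\<Sum>b\<in>Basis. A b)" by (intro sum_nonneg) (use A in \<open>auto intro: less_imp_le\<close>)
  have M: "A b \<le> M" if "b \<in> Basis" for b
    using member_le_sum[of b Basis A] A B(1) that by (force simp: M_def)
  have "deriv_bound m M 1 (partial b g)" if "b \<in> Basis" for b
    by (rule deriv_bound_mono[OF _ M[OF that]]) (use A[OF that] in auto)
  moreover have "\<bar>g y\<bar> \<le> M" for y using B(2)[of y] s0 by (simp add: M_def)
  ultimately have "deriv_bound (Suc m) M 1 g"
    using Suc.prems(1) by simp
  then show ?case using B(1) s0 by (auto simp: M_def intro!: exI[of _ M])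
qed

lemma deriv_bound_smaller_scale:
  assumes "0 < r'" "r' \<le> r"
  shows "deriv_bound m A r g \<Longrightarrow> deriv_bound m A r' g"
proof (induction m arbitrary: A g)
  case (Suc m)
  have "0 \<le> A" using Suc.prems by (auto intro: order_trans[OF abs_ge_zero])
  then have "A / r \<le> A / r'" using assms by (simp add: frac_le)
  then have "deriv_bound m (A / r') r' (partial b g)" if "b \<in> Basis" for b
    using Suc.IH[of "A / r" "partial b g"] Suc.prems that assms(1) deriv_bound_mono by auto
  then show ?case using Suc.prems by simp
qed simp

lemma deriv_bound_rescale:
  fixes g :: "'a::euclidean_space \<Rightarrow> real"
  assumes "0 < e"
  shows "deriv_bound m A s g \<Longrightarrow> deriv_bound m A (s * e) (\<lambda>y. g ((1 / e) *\<^sub>R y))"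
proof (induction m arbitrary: A g)
  case (Suc m)
  show ?case
  proof (rule deriv_bound_SucI[where g'="\<lambda>y h. (1 / e) * partial h g ((1 / e) *\<^sub>R y)"])
    show "\<bar>g ((1 / e) *\<^sub>R y)\<bar> \<le> A" for y using Suc.prems by auto
    fix y :: 'a
    note d = deriv_bound_has_derivative[OF Suc.prems]
    have l: "((\<lambda>y. (1 / e) *\<^sub>R y) has_derivative (\<lambda>h. (1 / e) *\<^sub>R h)) (at y)"
      by (auto intro!: derivative_eq_intros)
    have "((\<lambda>y. g ((1 / e) *\<^sub>R y)) has_derivative (\<lambda>h. partial ((1 / e) *\<^sub>R h) g ((1 / e) *\<^sub>R y))) (at y)"
      using has_derivative_compose[OF l d] by simp
    moreover have "partial ((1 / e) *\<^sub>R h) g z = (1 / e) * partial h g z" for h z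
      using linear_cmul[OF has_derivative_linear[OF d]] by simp
    ultimately show "((\<lambda>y. g ((1 / e) *\<^sub>R y)) has_derivative (\<lambda>h. (1 / e) * partial h g ((1 / e) *\<^sub>R y))) (at y)"
      by simp
  next
    fix b :: 'a assume "b \<in> Basis"
    then have "deriv_bound m (A / s) (s * e) (\<lambda>y. partial b g ((1 / e) *\<^sub>R y))"
      using Suc.prems by (intro Suc.IH) auto
    from deriv_bound_cmult[OF this, of "1/e"] 
    show "deriv_bound m (A / (s * e)) (s * e) (\<lambda>y. (1 / e) * partial b g ((1 / e) *\<^sub>R y))"
      using assms by (simp add: mult.commute)
  qed
qed simp

lemma C_diff_on_rescale:
  fixes g :: "'a::euclidean_space \<Rightarrow> real"
  shows "C_diff_on m UNIV g \<Longrightarrow> C_diff_on m UNIV (\<lambda>y. g (c *\<^sub>R y))"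
proof (induction m arbitrary: g)
  case 0 then show ?case by (auto intro!: continuous_on_compose2[of UNIV g] continuous_intros)
next
  case (Suc m)
  show ?case
  proof (rule C_diff_on_SucI[where f'="\<lambda>y h. c * partial h g (c *\<^sub>R y)"])
    fix y :: 'a
    note d = has_derivative_partial[OF Suc.prems UNIV_I]
    have l: "((\<lambda>y. c *\<^sub>R y) has_derivative (\<lambda>h. c *\<^sub>R h)) (at y)"
      by (auto intro!: derivative_eq_intros)
    have "((\<lambda>y. g (c *\<^sub>R y)) has_derivative (\<lambda>h. partial (c *\<^sub>R h) g (c *\<^sub>R y))) (at y)"
      using has_derivative_compose[OF l d] by simp
    moreover have "partial (c *\<^sub>R h) g z = c * partial h g z" for h z
      using linear_cmul[OF has_derivative_linear[OF d]] by simp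
    ultimately show "((\<lambda>y. g (c *\<^sub>R y)) has_derivative (\<lambda>h. c * partial h g (c *\<^sub>R y))) (at y)"
      by simp
  qed (use Suc in \<open>auto intro!: C_diff_on_cmult\<close>)
qed

text \<open>
  A radially decreasing function of class \<open>C\<^sup>m\<close> that is \<open>1\<close> on the unit ball and \<open>0\<close> outside the ball
  of radius \<open>2\<close>. The exponent \<open>m + 1\<close> makes both positive parts \<open>C\<^sup>m\<close>.
\<close>

definition cutoff :: "nat \<Rightarrow> 'a::euclidean_space \<Rightarrow> real" where
  "cutoff m y = (max 0 (1 - (max 0 ((norm y)\<^sup>2 - 1)) ^ Suc m)) ^ Suc m"

lemma C_diff_on_cutoff: "C_diff_on m UNIV (cutoff m :: 'a::euclidean_space \<Rightarrow> real)"
proof -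
  have v: "vanishes (Suc m) (monom 1 (Suc m))" by simp
  have 1: "C_diff_on m UNIV (\<lambda>y::'a. (norm (y - 0))\<^sup>2 + (- 1))"
    by (intro C_diff_on_add C_diff_on_const C_diff_on_norm_power2 open_UNIV)
  have "C_diff_on m UNIV (\<lambda>y::'a. 1 + (- 1) * poly (monom 1 (Suc m)) (max 0 ((norm (y - 0))\<^sup>2 + (- 1))))"
    by (intro C_diff_on_add C_diff_on_cmult C_diff_on_const C_diff_on_poly_pos_part[OF open_UNIV 1 v] open_UNIV)
  from C_diff_on_poly_pos_part[OF open_UNIV this v] show ?thesis
    by (simp add: cutoff_def[abs_def] poly_monom del: power_Suc)
qed

lemma cutoff_inside: "norm y \<le> 1 \<Longrightarrow> cutoff m y = 1"
  using power_mono[of "norm y" 1 2] by (simp add: cutoff_def max_absorb1)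

lemma cutoff_outside: 
  assumes "2 \<le> norm y" shows "cutoff m y = 0"
proof -
  have "1 \<le> (norm y)\<^sup>2 - 1" using power_mono[of 2 "norm y" 2] assms by simp
  then have "1 \<le> ((norm y)\<^sup>2 - 1) ^ Suc m" by (rule one_le_power)
  then show ?thesis using \<open>1 \<le> (norm y)\<^sup>2 - 1\<close> by (simp add: cutoff_def max_absorb1 max_absorb2 del: power_Suc)
qed

lemma cutoff_antimono: "norm y \<le> norm z \<Longrightarrow> cutoff m z \<le> cutoff m y"
  unfolding cutoff_def
  by (intro power_mono max.mono diff_mono order_refl) auto

text \<open>
  A solution that is continuous at the origin solves the equation weakly across the origin. To see
  this, \<open>\<phi>\<close> is multiplied by a function that vanishes near \<open>0\<close> and equals \<open>1\<close> outside a ball of radius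
  \<open>2 * e\<close>. The error is an integral over this ball of the bounded function \<open>u\<close> against a
  function of size \<open>e powr (- 2 * k)\<close>; it is of order \<open>e ^ (n - 2 * k)\<close> and tends to \<open>0\<close> because \<open>2 * k < n\<close>. On
  the side of \<open>h\<close> the cut-off functions increase to \<open>1\<close>, and monotone convergence gives the
  integrability of \<open>h * \<phi>\<close> at the origin together with the identity.
\<close>

lemma origin_removable:
  fixes u \<phi> h :: "'a::euclidean_space \<Rightarrow> real"
  assumes k: "2 * k < DIM('a)"
    and u: "continuous_on UNIV u" "C_diff_on (2 * k) (- {0}) u"
    and h: "\<And>x. x \<noteq> 0 \<Longrightarrow> neg_laplacian_power k u x = h x" "\<And>x. 0 \<le> h x" "h \<in> borel_measurable borel"
    and \<phi>: "C_diff_on (2 * k) UNIV \<phi>" "\<And>x. 0 \<le> \<phi> x" "compact K" "\<And>x. x \<notin> K \<Longrightarrow> \<phi> x = 0"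
  shows "integrable lborel (\<lambda>x. h x * \<phi> x)"
    and "(LINT x|lborel. h x * \<phi> x) = (LINT x|lborel. u x * neg_laplacian_power k \<phi> x)"
proof -
  obtain A where A: "A > 0" "deriv_bound (2 * k) A 1 \<phi>"
    using deriv_bound_compact_support[OF \<phi>(1,3,4)] by blast
  have "\<exists>E>0. deriv_bound (2 * k) E 1 (cutoff (2 * k) :: 'a \<Rightarrow> real)"
    by (rule deriv_bound_compact_support[OF C_diff_on_cutoff, of "cball 0 2"]) (auto intro: cutoff_outside)
  then obtain E where E: "E > 0" "deriv_bound (2 * k) E 1 (cutoff (2 * k) :: 'a \<Rightarrow> real)" by blast
  define \<eta> :: "real \<Rightarrow> 'a \<Rightarrow> real" where "\<eta> e y = 1 + (- 1) * cutoff (2 * k) ((1 / e) *\<^sub>R y)" for e y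
  define \<psi> where "\<psi> e y = \<phi> y * \<eta> e y" for e y
  \<comment> \<open>Bounds, up to the factor \<open>1 / e ^ (2 * k)\<close>, the change of \<open>(-\<Delta>) ^ k \<phi>\<close> caused by the cut-off.\<close>
  define C where "C = real DIM('a) ^ k * (2 ^ (2 * k) * A * (1 + E)) + real DIM('a) ^ k * A"
  have \<psi>b: "deriv_bound (2 * k) (2 ^ (2 * k) * A * (1 + E)) e (\<psi> e)" if e: "0 < e" "e \<le> 1" for e
  proof -
    have "deriv_bound (2 * k) E e (\<lambda>y::'a. cutoff (2 * k) ((1 / e) *\<^sub>R y))"
      using deriv_bound_rescale[OF e(1) E(2)] by simp
    from deriv_bound_cmult[OF this, of "-1"]
    have "deriv_bound (2 * k) E e (\<lambda>y::'a. (- 1) * cutoff (2 * k) ((1 / e) *\<^sub>R y))" by simp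
    from deriv_bound_add[OF deriv_bound_const this, of 1 1]
    have "deriv_bound (2 * k) (1 + E) e (\<eta> e)" using e by (simp add: \<eta>_def[abs_def])
    from deriv_bound_mult[OF e(1) deriv_bound_smaller_scale[OF e A(2)] this]
    show ?thesis by (simp add: \<psi>_def[abs_def])
  qed
  have far: "neg_laplacian_power k (\<psi> e) y = neg_laplacian_power k \<phi> y" if "0 < e" "2 * e < norm y" for e y
  proof (rule neg_laplacian_power_cong[of "- cball 0 (2 * e)"])
    show "open (- cball 0 (2 * e) :: 'a set)" by (simp add: open_Compl)
    show "y \<in> - cball 0 (2 * e)" using that by simp
    show "\<phi> z = \<psi> e z" if "z \<in> - cball 0 (2 * e)" for z
      using that \<open>0 < e\<close> cutoff_outside[of "(1 / e) *\<^sub>R z" "2 * k"] 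
      by (simp add: \<psi>_def \<eta>_def field_simps)
    show "C_diff_on (2 * k) (- cball 0 (2 * e)) \<phi>" by (rule C_diff_on_subset[OF _ \<phi>(1)]) simp
  qed
  have near: "\<bar>neg_laplacian_power k (\<psi> e) y - neg_laplacian_power k \<phi> y\<bar> \<le> C / e ^ (2 * k)" 
    if e: "0 < e" "e \<le> 1" for e y
  proof -
    have 1: "(real DIM('a) / e\<^sup>2) ^ k = real DIM('a) ^ k / e ^ (2 * k)"
      by (simp add: power_divide power_mult)
    show ?thesis
      using neg_laplacian_power_bound[OF e(1) \<psi>b[OF e], of y] 
        neg_laplacian_power_bound[OF e(1) deriv_bound_smaller_scale[OF e A(2)], of y]
      unfolding 1 C_def by (simp add: add_divide_distrib)
  qed
  define e where "e i = 1 / real (Suc i)" for i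
  have e: "0 < e i" "e i \<le> 1" for i by (auto simp: e_def)
  have e0: "e \<longlonglongrightarrow> 0" unfolding e_def using LIMSEQ_inverse_real_of_nat by (simp add: inverse_eq_divide)
  have \<psi>C: "C_diff_on (2 * k) UNIV (\<psi> (e i))" for i
  proof -
    have "C_diff_on (2 * k) UNIV (\<lambda>y::'a. cutoff (2 * k) ((1 / e i) *\<^sub>R y))" 
      by (rule C_diff_on_rescale[OF C_diff_on_cutoff])
    then show ?thesis unfolding \<psi>_def \<eta>_def
      by (intro C_diff_on_mult C_diff_on_add C_diff_on_const C_diff_on_cmult \<phi>(1) open_UNIV)
  qed
  have \<psi>0: "\<psi> (e i) x = 0" if "x \<notin> K - ball 0 (e i)" for i x
    using that \<phi>(4)[of x] cutoff_inside[of "(1 / e i) *\<^sub>R x" "2 * k"] e[of i]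
    by (auto simp: \<psi>_def \<eta>_def field_simps)
  have Ke: "compact (K - ball 0 (e i))" "K - ball 0 (e i) \<subseteq> - {0}" for i
    using \<phi>(3) e[of i] by (auto intro: compact_diff)
  have nlC: "C_diff_on 0 (- {0}) (neg_laplacian_power k u)"
    by (rule C_diff_on_neg_laplacian_power) (use u in auto)
  have green: "(LINT x|lborel. h x * \<psi> (e i) x) = (LINT x|lborel. u x * neg_laplacian_power k (\<psi> (e i)) x)" for i
  proof -
    have "(LINT x|lborel. u x * neg_laplacian_power k (\<psi> (e i)) x) = 
        (LINT x|lborel. neg_laplacian_power k u x * \<psi> (e i) x)"
      by (rule green_neg_laplacian_power[OF _ u(2) \<psi>C Ke \<psi>0]) auto
    also have "(\<lambda>x. neg_laplacian_power k u x * \<psi> (e i) x) = (\<lambda>x. h x * \<psi> (e i) x)"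
    proof
      show "neg_laplacian_power k u x * \<psi> (e i) x = h x * \<psi> (e i) x" for x
        using h(1)[of x] \<psi>0[of 0 i] e[of i] by (cases "x = 0") auto
    qed
    finally show ?thesis by simp
  qed
  have hi: "integrable lborel (\<lambda>x. h x * \<psi> (e i) x)" for i
  proof -
    have "C_diff_on 0 UNIV (\<lambda>x. neg_laplacian_power k u x * \<psi> (e i) x)"
      by (rule C_diff_on_mult_support[OF _ Ke nlC C_diff_on_le[OF _ C_diff_on_subset[OF _ \<psi>C]] \<psi>0]) auto
    then have "integrable lborel (\<lambda>x. neg_laplacian_power k u x * \<psi> (e i) x)"
      using \<psi>0 by (intro compact_support_integrable[OF _ Ke(1)[of i]]) auto
    also have "(\<lambda>x. neg_laplacian_power k u x * \<psi> (e i) x) = (\<lambda>x. h x * \<psi> (e i) x)"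
    proof
      show "neg_laplacian_power k u x * \<psi> (e i) x = h x * \<psi> (e i) x" for x
        using h(1)[of x] \<psi>0[of 0 i] e[of i] by (cases "x = 0") auto
    qed
    finally show ?thesis .
  qed
  obtain U where U: "U > 0" "\<And>x. norm x \<le> 2 \<Longrightarrow> \<bar>u x\<bar> \<le> U"
  proof -
    have "compact (u ` cball 0 2)" 
      by (rule compact_continuous_image[OF continuous_on_subset[OF u(1)]]) auto
    then obtain B where "\<And>y. y \<in> u ` cball 0 2 \<Longrightarrow> norm y \<le> B" 
      using compact_imp_bounded bounded_iff by metis
    then show thesis by (intro that[of "max B 1"]) (auto simp: le_max_iff_disj)
  qed
  have ui: "integrable lborel (\<lambda>x. u x * neg_laplacian_power k f x)" 
    if "C_diff_on (2 * k) UNIV f" "compact L" "\<And>x. x \<notin> L \<Longrightarrow> f x = 0" for f L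
  proof (rule compact_support_integrable[OF _ that(2)])
    have "continuous_on UNIV (neg_laplacian_power k f)"
      using C_diff_on_neg_laplacian_power[of UNIV 0 k f] that(1) by simp
    then show "continuous_on UNIV (\<lambda>x. u x * neg_laplacian_power k f x)"
      by (intro continuous_intros u)
    show "u x * neg_laplacian_power k f x = 0" if "x \<notin> L" for x
      using neg_laplacian_power_support[OF \<open>compact L\<close> _ that] \<open>\<And>x. x \<notin> L \<Longrightarrow> f x = 0\<close> by simp
  qed
  have ui1: "integrable lborel (\<lambda>x. u x * neg_laplacian_power k (\<psi> (e i)) x)" for i
    by (rule ui[OF \<psi>C Ke(1) \<psi>0])
  have ui2: "integrable lborel (\<lambda>x. u x * neg_laplacian_power k \<phi> x)"
    by (rule ui[OF \<phi>(1,3,4)])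
  let ?v = "unit_ball_vol (real DIM('a))"
  have diff: "\<bar>(LINT x|lborel. u x * neg_laplacian_power k (\<psi> (e i)) x) - (LINT x|lborel. u x * neg_laplacian_power k \<phi> x)\<bar>
     \<le> U * C * ?v * 2 ^ DIM('a) * e i ^ (DIM('a) - 2 * k)" for i
  proof -
    have "\<bar>(LINT x|lborel. u x * neg_laplacian_power k (\<psi> (e i)) x) - (LINT x|lborel. u x * neg_laplacian_power k \<phi> x)\<bar> = 
       norm (LINT x|lborel. u x * neg_laplacian_power k (\<psi> (e i)) x - u x * neg_laplacian_power k \<phi> x)"
      unfolding Bochner_Integration.integral_diff[OF ui1 ui2] by (rule real_norm_def[symmetric])
    also have "\<dots> \<le> (LINT x|lborel. U * (C / e i ^ (2 * k)) * indicator (cball 0 (2 * e i)) (x::'a))"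
    proof (rule Bochner_Integration.integral_norm_bound_integral)
      show "integrable lborel (\<lambda>x. u x * neg_laplacian_power k (\<psi> (e i)) x - u x * neg_laplacian_power k \<phi> x)"
        using ui1 ui2 by (intro Bochner_Integration.integrable_diff)
      show "integrable lborel (\<lambda>x. U * (C / e i ^ (2 * k)) * indicator (cball 0 (2 * e i)) (x::'a))"
        by (intro integrable_mult_right integrable_real_indicator) (auto simp: emeasure_lborel_cball_finite[unfolded infinity_ennreal_def])
      fix x :: 'a
      show "norm (u x * neg_laplacian_power k (\<psi> (e i)) x - u x * neg_laplacian_power k \<phi> x)
         \<le> U * (C / e i ^ (2 * k)) * indicator (cball 0 (2 * e i)) x"
      proof (cases "norm x \<le> 2 * e i")
        case True
        then have "\<bar>u x\<bar> \<le> U" using U(2)[of x] e[of i] by linarith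
        then have "\<bar>u x\<bar> * \<bar>neg_laplacian_power k (\<psi> (e i)) x - neg_laplacian_power k \<phi> x\<bar> \<le> U * (C / e i ^ (2 * k))"
          using near[OF e] by (intro mult_mono) (use U in auto)
        then show ?thesis using True by (simp add: right_diff_distrib[symmetric] abs_mult)
      next
        case False
        then show ?thesis using far[OF e(1), of i x] by simp
      qed
    qed
    also have "\<dots> = U * (C / e i ^ (2 * k)) * (?v * (2 * e i) ^ DIM('a))"
      using content_cball[of "2 * e i" "0::'a"] e[of i] by (simp add: measure_completion)
    also have "\<dots> = U * C * ?v * 2 ^ DIM('a) * e i ^ (DIM('a) - 2 * k)"
      using k e[of i] by (simp add: power_mult_distrib power_diff)
    finally show ?thesis .
  qed
  have "(\<lambda>i. U * C * ?v * 2 ^ DIM('a) * e i ^ (DIM('a) - 2 * k)) \<longlonglongrightarrow> U * C * ?v * 2 ^ DIM('a) * 0 ^ (DIM('a) - 2 * k)"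
    by (intro tendsto_intros e0)
  then have "(\<lambda>i. U * C * ?v * 2 ^ DIM('a) * e i ^ (DIM('a) - 2 * k)) \<longlonglongrightarrow> 0"
    using k by (simp add: power_0_left)
  then have "(\<lambda>i. (LINT x|lborel. u x * neg_laplacian_power k (\<psi> (e i)) x) - (LINT x|lborel. u x * neg_laplacian_power k \<phi> x)) \<longlonglongrightarrow> 0"
    by (rule Lim_null_comparison[rotated]) (use diff in \<open>auto intro!: always_eventually\<close>)
  then have lim: "(\<lambda>i. LINT x|lborel. h x * \<psi> (e i) x) \<longlonglongrightarrow> (LINT x|lborel. u x * neg_laplacian_power k \<phi> x)"
    unfolding green by (simp add: LIM_zero_iff)
  have mono: "AE x in lborel. mono (\<lambda>i. h x * \<psi> (e i) x)"
  proof (rule AE_I2, rule monoI)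
    fix x :: 'a and i j :: nat assume ij: "i \<le> j"
    have "1 / e i \<le> 1 / e j" using ij by (simp add: e_def)
    then have "norm ((1 / e i) *\<^sub>R x) \<le> norm ((1 / e j) *\<^sub>R x)" using e[of i] e[of j]
      using mult_right_mono[of "1 / e i" "1 / e j" "norm x"] by simp
    then have "\<eta> (e i) x \<le> \<eta> (e j) x" using cutoff_antimono[of "(1 / e i) *\<^sub>R x" "(1 / e j) *\<^sub>R x" "2 * k"]
      unfolding \<eta>_def by linarith
    then show "h x * \<psi> (e i) x \<le> h x * \<psi> (e j) x"
      unfolding \<psi>_def by (intro mult_left_mono h(2) \<phi>(2))
  qed
  have conv: "AE x in lborel. (\<lambda>i. h x * \<psi> (e i) x) \<longlonglongrightarrow> h x * \<phi> x"
    using AE_lborel_singleton[of "0::'a"]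
  proof eventually_elim
    case (elim x)
    have "eventually (\<lambda>i. e i < norm x / 2) sequentially"
      using order_tendstoD(2)[OF e0, of "norm x / 2"] elim by simp
    then have "eventually (\<lambda>i. h x * \<psi> (e i) x = h x * \<phi> x) sequentially"
    proof eventually_elim
      case (elim i)
      then show ?case using e[of i] cutoff_outside[of "(1 / e i) *\<^sub>R x" "2 * k"] 
        by (simp add: \<psi>_def \<eta>_def field_simps)
    qed
    then show ?case by (rule tendsto_eventually)
  qed
  have meas: "(\<lambda>x. h x * \<phi> x) \<in> borel_measurable lborel"
    using h(3) borel_measurable_continuous_onI[OF C_diff_on_continuous[OF \<phi>(1)]] by simp
  show "integrable lborel (\<lambda>x. h x * \<phi> x)"
    by (rule integrable_monotone_convergence[OF hi mono conv lim meas])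
  show "(LINT x|lborel. h x * \<phi> x) = (LINT x|lborel. u x * neg_laplacian_power k \<phi> x)"
    by (rule integral_monotone_convergence[OF hi mono conv lim meas])
qed

section \<open>Powers of the Laplacian as dilation derivatives\<close>

text \<open>
  With \<open>\<Theta> = scaling_op d\<close> this is the product \<open>(\<Theta> - a) (\<Theta> - a - 1) \<dots> (\<Theta> - a - j + 1)\<close> applied to
  \<open>q\<close>. For \<open>a = 0\<close> it is the analogue of \<open>t ^ j * (d/dt) ^ j\<close> expressed by \<open>t * d/dt\<close>.
\<close>

fun scaling_falling :: "real \<Rightarrow> real \<Rightarrow> nat \<Rightarrow> real poly \<Rightarrow> real poly" where
  "scaling_falling d a 0 q = q"
| "scaling_falling d a (Suc j) q = scaling_op d (scaling_falling d (a + 1) j q) - smult a (scaling_falling d (a + 1) j q)"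

text \<open>
  In operator form \<open>D \<Theta> = (\<Theta> - 1) D\<close>. Moving all derivatives to the right therefore turns
  \<open>(\<Theta> D) ^ j\<close> into a falling product of \<open>\<Theta>\<close> times \<open>D ^ j\<close>.
\<close>

lemma pderiv_scaling_op: "pderiv (scaling_op d q) = scaling_op d (pderiv q) - pderiv q"
  by (subst poly_eq_poly_eq_iff[symmetric])
    (auto simp: fun_eq_iff scaling_op_def pderiv_diff pderiv_smult pderiv_mult pderiv_pCons algebra_simps
      simp del: mult_pCons_left mult_pCons_right)

lemma scaling_op_smult: "scaling_op d (smult a q) = smult a (scaling_op d q)"
  by (subst poly_eq_poly_eq_iff[symmetric])
    (auto simp: fun_eq_iff scaling_op_def pderiv_diff pderiv_smult algebra_simps)

lemma pderiv_scaling_falling: "pderiv (scaling_falling d a j q) = scaling_falling d (a + 1) j (pderiv q)"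
proof (induction j arbitrary: a)
  case (Suc j)
  have "pderiv (scaling_falling d a (Suc j) q) = scaling_op d (scaling_falling d (a + 1 + 1) j (pderiv q)) 
      - scaling_falling d (a + 1 + 1) j (pderiv q) - smult a (scaling_falling d (a + 1 + 1) j (pderiv q))"
    by (simp add: pderiv_diff pderiv_smult pderiv_scaling_op Suc.IH)
  then show ?case
    by (simp add: poly_eq_poly_eq_iff[symmetric] fun_eq_iff algebra_simps)
qed simp

lemma scaling_op_pderiv_power:
  "((\<lambda>q. scaling_op d (pderiv q)) ^^ j) q = scaling_falling d 0 j ((pderiv ^^ j) q)"
proof (induction j)
  case (Suc j)
  show ?case by (simp add: Suc.IH pderiv_scaling_falling)
qed simp

text \<open>
  The power of the Laplacian contains the factor \<open>\<Theta> = t * d/dt\<close> on the left. This is why integrating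
  the polyharmonic equation against a cap yields an exact derivative in \<open>t\<close>.
\<close>

lemma neglap_op_power_eq:
  "(neglap_op d ^^ j) q = smult ((-4) ^ j) (scaling_falling d 0 j ((pderiv ^^ j) q))"
proof -
  have "(neglap_op d ^^ j) q = smult ((-4) ^ j) (((\<lambda>q. scaling_op d (pderiv q)) ^^ j) q)"
    by (induction j) (auto simp: neglap_op_def pderiv_smult scaling_op_smult)
  then show ?thesis by (simp add: scaling_op_pderiv_power)
qed

lemma vanishes_scaling_falling: "vanishes (r + j) q \<Longrightarrow> vanishes r (scaling_falling d a j q)"
proof (induction j arbitrary: r a)
  case (Suc j)
  have 1: "vanishes (Suc r) (scaling_falling d (a + 1) j q)" using Suc.IH[of "Suc r"] Suc.prems by simp
  show ?case using vanishes_scaling_op[OF 1, of d] 1 by simp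
qed simp

lemma pderiv_power_monom:
  assumes "j \<le> m"
  obtains a where "a > 0" "(pderiv ^^ j) (monom (1::real) m) = monom a (m - j)"
proof -
  have "\<exists>a>0. (pderiv ^^ j) (monom (1::real) m) = monom a (m - j)" using assms
  proof (induction j)
    case 0 then show ?case by auto
  next
    case (Suc j)
    then obtain a where a: "a > 0" "(pderiv ^^ j) (monom (1::real) m) = monom a (m - j)" by auto
    show ?case using a Suc.prems 
      by (intro exI[of _ "of_nat (m - j) * a"]) (auto simp: pderiv_monom)
  qed
  then show thesis using that by auto
qed

section \<open>Weighted ball means\<close>

text \<open>
  Up to a factor, a weighted mean of \<open>u\<close> over the ball of radius \<open>sqrt t\<close> around \<open>x\<close>.
\<close>

definition wmean :: "('a::euclidean_space \<Rightarrow> real) \<Rightarrow> 'a \<Rightarrow> real poly \<Rightarrow> real \<Rightarrow> real" where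
  "wmean u x q t = t powr (- (DIM('a) / 2)) * (LINT y|lborel. u y * poly q (cap x t y))"

lemma cap_nonneg: "0 \<le> cap x t y" by (simp add: cap_def)

lemma cap_le_1: "0 < t \<Longrightarrow> cap x t y \<le> 1" by (simp add: cap_def)

lemma cap_outside: 
  assumes "0 < t" "y \<notin> cball x (sqrt t)" shows "cap x t y = 0"
proof -
  have "sqrt t < norm (y - x)" using assms(2) by (simp add: dist_norm norm_minus_commute)
  then have "(sqrt t)\<^sup>2 < (norm (y - x))\<^sup>2" using assms(1) by (intro power_strict_mono) auto
  then show ?thesis using assms(1) by (simp add: cap_def)
qed

lemma poly_cap_outside:
  "0 < t \<Longrightarrow> vanishes 1 q \<Longrightarrow> y \<notin> cball x (sqrt t) \<Longrightarrow> poly q (cap x t y) = 0"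
  by (simp add: cap_outside poly_0_coeff_0)

lemma continuous_cap: "continuous_on UNIV (cap x t)"
  unfolding cap_def divide_inverse by (intro continuous_intros)

lemma integrable_poly_cap:
  fixes u :: "'a::euclidean_space \<Rightarrow> real"
  assumes "continuous_on UNIV u" "0 < t" "vanishes 1 q"
  shows "integrable lborel (\<lambda>y. u y * poly q (cap x t y))"
  by (rule compact_support_integrable[of _ "cball x (sqrt t)"])
    (use assms poly_cap_outside in \<open>auto intro!: continuous_intros continuous_on_compose2[OF _ continuous_cap]\<close>)

lemma wmean_smult: "wmean u x (smult a q) t = a * wmean u x q t"
proof -
  have "(\<lambda>y. u y * poly (smult a q) (cap x t y)) = (\<lambda>y. a * (u y * poly q (cap x t y)))"
    by (auto simp: fun_eq_iff)
  then show ?thesis by (simp add: wmean_def)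
qed

lemma wmean_diff:
  fixes u :: "'a::euclidean_space \<Rightarrow> real"
  assumes "continuous_on UNIV u" "0 < t" "vanishes 1 p" "vanishes 1 q"
  shows "wmean u x (p - q) t = wmean u x p t - wmean u x q t"
  by (simp add: wmean_def right_diff_distrib Bochner_Integration.integral_diff[OF 
        integrable_poly_cap[OF assms(1-3)] integrable_poly_cap[OF assms(1,2,4)]])

lemma DERIV_poly_cap:
  fixes x y :: "'a::euclidean_space"
  assumes "0 < s" "vanishes 2 q"
  shows "((\<lambda>s. poly q (cap x s y)) has_real_derivative poly ([:1, -1:] * pderiv q) (cap x s y) / s) (at s)"
proof -
  have "((\<lambda>s. 1 - (norm (y - x))\<^sup>2 / s) has_real_derivative (norm (y - x))\<^sup>2 / s\<^sup>2) (at s)"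
    using assms(1) by (auto intro!: derivative_eq_intros simp: power2_eq_square)
  from DERIV_chain2[OF DERIV_poly_pos_part[OF assms(2)] this]
  have "((\<lambda>s. poly q (cap x s y)) has_real_derivative poly (pderiv q) (cap x s y) * ((norm (y - x))\<^sup>2 / s\<^sup>2)) (at s)"
    by (simp add: cap_def)
  also have "poly (pderiv q) (cap x s y) * ((norm (y - x))\<^sup>2 / s\<^sup>2) = poly ([:1, -1:] * pderiv q) (cap x s y) / s"
  proof (cases "cap x s y = 0")
    case True
    have "poly (pderiv q) 0 = 0" using assms(2) by (simp add: poly_0_coeff_0 coeff_pderiv)
    then show ?thesis using True by simp
  next
    case False
    then have "cap x s y = 1 - (norm (y - x))\<^sup>2 / s" unfolding cap_def by (auto simp: max_def split: if_splits)
    then have "(norm (y - x))\<^sup>2 = s * (1 - cap x s y)" using assms(1) by (simp add: field_simps)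
    then show ?thesis by (subst \<open>(norm (y - x))\<^sup>2 = s * (1 - cap x s y)\<close>)
      (use assms(1) in \<open>simp add: power2_eq_square field_simps\<close>)
  qed
  finally show ?thesis .
qed

lemma LINT_eq_integral_cbox:
  fixes f :: "'a::euclidean_space \<Rightarrow> real"
  assumes "integrable lborel f" "\<And>y. y \<notin> cbox a b \<Longrightarrow> f y = 0"
  shows "(LINT y|lborel. f y) = integral (cbox a b) f"
proof -
  have "(LINT y|lborel. f y) = integral UNIV f" using integral_lborel[OF assms(1)] by simp
  also have "\<dots> = integral UNIV (\<lambda>y. if y \<in> cbox a b then f y else 0)" 
    by (rule arg_cong[where f="integral UNIV"]) (use assms(2) in auto)
  finally show ?thesis by (simp add: integral_restrict_UNIV)
qed

text \<open>
  All functions involved vanish outside one fixed box as long as \<open>s < 2 * t\<close>, so differentiation under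
  the integral sign is the Leibniz rule on that box.
\<close>

lemma DERIV_wmean:
  fixes u :: "'a::euclidean_space \<Rightarrow> real"
  assumes u: "continuous_on UNIV u" and t: "0 < t" and q: "vanishes 2 q"
  shows "(wmean u x q has_real_derivative wmean u x (scaling_op (DIM('a) / 2) q) t / t) (at t)"
proof -
  let ?U = "{0<..<2 * t}" and ?d = "real DIM('a) / 2"
  let ?r = "[:1, -1:] * pderiv q"
  have v: "vanishes 1 q" "vanishes 1 (pderiv q)" 
    using q vanishes_pderiv[of 1 q] by (auto simp: numeral_2_eq_2)
  have vr: "vanishes 1 ?r" using v(2) by (simp add: coeff_pCons)
  have vT: "vanishes 1 (scaling_op ?d q)" using vanishes_scaling_op[of 1 q ?d] q by (auto simp: numeral_2_eq_2)
  obtain a b where ab: "cball x (sqrt (2 * t)) \<subseteq> cbox a b"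
    using bounded_subset_cbox_symmetric[OF bounded_cball] by metis
  have out: "cap x s y = 0" if "s \<in> ?U" "y \<notin> cbox a b" for s y
  proof -
    have "cball x (sqrt s) \<subseteq> cball x (sqrt (2 * t))" using that(1) by (intro subset_cball) auto
    then show ?thesis using that ab by (intro cap_outside) auto
  qed
  have eq: "(LINT y|lborel. u y * poly p (cap x s y)) = integral (cbox a b) (\<lambda>y. u y * poly p (cap x s y))" 
    if "s \<in> ?U" "vanishes 1 p" for s p
    by (rule LINT_eq_integral_cbox) 
      (use that u out in \<open>auto intro!: integrable_poly_cap simp: poly_0_coeff_0\<close>)
  have cap2: "continuous_on (?U \<times> cbox a b) (\<lambda>(s, y). cap x s y)"
    unfolding cap_def split_beta by (intro continuous_intros) auto
  have "((\<lambda>s. integral (cbox a b) (\<lambda>y. u y * poly q (cap x s y))) has_real_derivative 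
     integral (cbox a b) (\<lambda>y. u y * (poly ?r (cap x t y) / t))) (at t within ?U)"
  proof (rule leibniz_rule_field_derivative[where fx="\<lambda>s y. u y * (poly ?r (cap x s y) / s)"])
    fix s y assume s: "s \<in> ?U"
    show "((\<lambda>s. u y * poly q (cap x s y)) has_real_derivative u y * (poly ?r (cap x s y) / s)) (at s within ?U)"
      by (rule DERIV_cmult[OF has_field_derivative_at_within[OF DERIV_poly_cap]]) (use s q in auto)
    show "(\<lambda>y. u y * poly q (cap x s y)) integrable_on cbox a b"
      by (rule integrable_continuous) (auto intro!: continuous_intros continuous_on_subset[OF u] 
         continuous_on_subset[OF continuous_cap])
  next
    have "continuous_on (?U \<times> cbox a b) (\<lambda>p. u (snd p) * (poly ?r (cap x (fst p) (snd p)) / fst p))"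
      using cap2 by (auto intro!: continuous_intros continuous_on_compose2[OF u] simp: split_beta 
          simp del: mult_pCons_left)
    then show "continuous_on (?U \<times> cbox a b) (\<lambda>(s, y). u y * (poly ?r (cap x s y) / s))"
      by (simp add: split_beta)
  qed (use t in auto)
  then have D0: "((\<lambda>s. integral (cbox a b) (\<lambda>y. u y * poly q (cap x s y))) has_real_derivative 
     integral (cbox a b) (\<lambda>y. u y * poly ?r (cap x t y)) / t) (at t)"
    using t at_within_open[of t ?U] by (simp add: times_divide_eq_right[symmetric] del: times_divide_eq_right mult_pCons_left)
       (simp del: mult_pCons_left)
  have D: "((\<lambda>s. LINT y|lborel. u y * poly q (cap x s y)) has_real_derivative 
     (LINT y|lborel. u y * poly ?r (cap x t y)) / t) (at t)"
    (is "(_ has_real_derivative ?D) _")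
  proof (rule has_field_derivative_transform_within_open[where S="?U"])
    have "?D = integral (cbox a b) (\<lambda>y. u y * poly ?r (cap x t y)) / t"
      by (subst eq[OF _ vr]) (use t in auto)
    then show "((\<lambda>s. integral (cbox a b) (\<lambda>y. u y * poly q (cap x s y))) has_real_derivative ?D) (at t)"
      using D0 by (rule ssubst)
    show "integral (cbox a b) (\<lambda>y. u y * poly q (cap x s y)) = (LINT y|lborel. u y * poly q (cap x s y))" 
      if "s \<in> ?U" for s by (rule eq[OF that v(1), symmetric])
  qed (use t in auto)
  have P: "((\<lambda>s. s powr (- ?d)) has_real_derivative - ?d * t powr (- ?d) / t) (at t)"
    using t by (auto intro!: derivative_eq_intros simp: powr_diff)
  have "(wmean u x q has_real_derivative 
      t powr (- ?d) * ((LINT y|lborel. u y * poly ?r (cap x t y)) / t) + 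
      (- ?d * t powr (- ?d) / t) * (LINT y|lborel. u y * poly q (cap x t y))) (at t)"
    unfolding wmean_def[abs_def] by (rule DERIV_mult'[OF P D])
  also have "t powr (- ?d) * ((LINT y|lborel. u y * poly ?r (cap x t y)) / t) + 
      (- ?d * t powr (- ?d) / t) * (LINT y|lborel. u y * poly q (cap x t y)) =
      (wmean u x ?r t - wmean u x (smult ?d q) t) / t"
  proof -
    have "a * (b / t) + (- d * a / t) * c = (a * b - d * (a * c)) / t" for a b c d :: real
      by (simp add: diff_divide_distrib algebra_simps)
    then show ?thesis unfolding wmean_smult unfolding wmean_def .
  qed
  also have "\<dots> = wmean u x (scaling_op ?d q) t / t"
    unfolding scaling_op_def by (subst wmean_diff[OF u t vr]) (use v in auto)
  finally show ?thesis .
qed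

text \<open>
  The total weight of the mean, that is, its value for \<open>u = 1\<close>; by scaling it depends neither on the
  centre nor on the radius (\<open>wmean_const\<close>).
\<close>

definition cap_mass :: "'a::euclidean_space itself \<Rightarrow> real poly \<Rightarrow> real" where
  "cap_mass _ q = wmean (\<lambda>_::'a. 1) 0 q 1"

lemma lborel_integral_affine:
  fixes f :: "'a::euclidean_space \<Rightarrow> real"
  assumes "f \<in> borel_measurable borel" "0 < c"
  shows "(LINT y|lborel. f y) = c ^ DIM('a) * (LINT z|lborel. f (x + c *\<^sub>R z))"
proof -
  have "(LINT y|lborel. f y) = (LINT y|density (distr lborel borel (\<lambda>z. x + c *\<^sub>R z)) (\<lambda>_. \<bar>c\<bar> ^ DIM('a)). f y)"
    using lborel_affine[of c x] assms(2) by simp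
  also have "\<dots> = (LINT y|distr lborel borel (\<lambda>z. x + c *\<^sub>R z). \<bar>c\<bar> ^ DIM('a) *\<^sub>R f y)"
    by (rule integral_density) (use assms in auto)
  also have "\<dots> = (LINT z|lborel. \<bar>c\<bar> ^ DIM('a) *\<^sub>R f (x + c *\<^sub>R z))"
    by (rule integral_distr) (use assms in auto)
  finally show ?thesis using assms(2) by simp
qed

lemma wmean_const:
  fixes x :: "'a::euclidean_space"
  assumes "0 < t"
  shows "wmean (\<lambda>_. 1) x q t = cap_mass TYPE('a) q"
proof -
  have m: "(\<lambda>y. 1 * poly q (cap x t y)) \<in> borel_measurable borel"
    by (intro borel_measurable_continuous_onI) (auto intro!: continuous_intros continuous_cap)
  have c: "cap x t (x + sqrt t *\<^sub>R z) = cap 0 1 z" for z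
    using assms by (simp add: cap_def power_mult_distrib)
  have "(LINT y|lborel. 1 * poly q (cap x t y)) = (sqrt t) ^ DIM('a) * (LINT z|lborel. poly q (cap (0::'a) 1 z))"
    using lborel_integral_affine[OF m, of "sqrt t" x] assms by (simp add: c)
  also have "(sqrt t) ^ DIM('a) = t powr (DIM('a) / 2)"
    using assms by (simp add: powr_half_sqrt[symmetric] powr_realpow[symmetric] powr_powr)
  finally show ?thesis using assms by (simp add: wmean_def cap_mass_def powr_minus field_simps)
qed

text \<open>
  The means of a constant function do not depend on \<open>t\<close>, so their derivative vanishes.
\<close>

lemma cap_mass_scaling_op:
  assumes "vanishes 2 q"
  shows "cap_mass TYPE('a::euclidean_space) (scaling_op (DIM('a) / 2) q) = 0"
proof -
  have "(wmean (\<lambda>_::'a. 1) 0 q has_real_derivative cap_mass TYPE('a) (scaling_op (DIM('a) / 2) q)) (at 1)"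
    using DERIV_wmean[of "\<lambda>_::'a. 1" 1 q 0] assms wmean_const[of 1 "0::'a"] by simp
  moreover have "(wmean (\<lambda>_::'a. 1) 0 q has_real_derivative 0) (at 1)"
    by (rule has_field_derivative_transform_within_open[of "\<lambda>_. cap_mass TYPE('a) q" _ _ "{0<..}"]) 
      (auto simp: wmean_const)
  ultimately show ?thesis by (rule DERIV_unique)
qed

lemma cap_mass_scaling_falling:
  assumes "vanishes (Suc j) q"
  shows "cap_mass TYPE('a::euclidean_space) (scaling_falling (DIM('a) / 2) a j q) = (\<Prod>i<j. - (a + real i)) * cap_mass TYPE('a) q"
  using assms
proof (induction j arbitrary: a)
  case (Suc j)
  let ?p = "scaling_falling (real DIM('a) / 2) (a + 1) j q"
  have v2: "vanishes 2 ?p" by (rule vanishes_scaling_falling) (use Suc.prems in simp)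
  have vT: "vanishes 1 (scaling_op (DIM('a) / 2) ?p)" "vanishes 1 (smult a ?p)"
    using vanishes_scaling_op[of 1 ?p] v2 by (auto simp: numeral_2_eq_2)
  have "cap_mass TYPE('a) (scaling_falling (DIM('a) / 2) a (Suc j) q) = - a * cap_mass TYPE('a) ?p"
    using cap_mass_scaling_op[where 'a='a, OF v2] wmean_diff[of "\<lambda>_::'a. 1" 1 "scaling_op (DIM('a) / 2) ?p" "smult a ?p" 0] vT
    by (simp add: cap_mass_def wmean_smult)
  also have "\<dots> = (\<Prod>i<Suc j. - (a + real i)) * cap_mass TYPE('a) q"
  proof -
    have "cap_mass TYPE('a) ?p = (\<Prod>i<j. - (a + 1 + real i)) * cap_mass TYPE('a) q"
      by (rule Suc.IH) (use Suc.prems in simp)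
    moreover have "(\<Prod>i<j. - (a + 1 + real i)) = (\<Prod>i<j. - (a + real (Suc i)))"
      by (intro prod.cong) auto
    moreover have "(\<Prod>i<Suc j. - (a + real i)) = - a * (\<Prod>i<j. - (a + real (Suc i)))"
      by (simp add: prod.lessThan_Suc_shift del: prod.lessThan_Suc of_nat_Suc)
    ultimately show ?thesis by (simp only: mult.assoc)
  qed
  finally show ?case .
qed simp

lemma LINT_pos_open:
  fixes f :: "'a::euclidean_space \<Rightarrow> real"
  assumes "integrable lborel f" "\<And>y. 0 \<le> f y" "open S" "S \<noteq> {}" "\<And>y. y \<in> S \<Longrightarrow> 0 < f y"
  shows "0 < (LINT y|lborel. f y)"
proof (rule ccontr)
  assume "\<not> ?thesis"
  then have "(LINT y|lborel. f y) = 0" 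
    using Bochner_Integration.integral_nonneg[of lborel f] assms(2) by (auto simp: not_less intro: antisym)
  then have "AE y in lborel. f y = 0"
    using integral_nonneg_eq_0_iff_AE[OF assms(1)] assms(2) by auto
  then have "AE y in lborel. y \<notin> S" by eventually_elim (use assms(5) in force)
  then have "S \<in> null_sets lborel" using assms(3) AE_iff_null_sets[of S lborel] by auto
  then have "negligible S" by (simp add: negligible_iff_null_sets null_sets_completionI)
  then show False using open_not_negligible[OF assms(3,4)] by simp
qed

lemma cap_mass_pos:
  assumes "vanishes 1 q" "\<And>r. 0 < r \<Longrightarrow> 0 < poly q r"
  shows "0 < cap_mass TYPE('a::euclidean_space) q"
proof -
  have p0: "poly q 0 = 0" using assms(1) by (simp add: poly_0_coeff_0)
  have "0 < (LINT y|lborel. 1 * poly q (cap (0::'a) 1 y))"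
  proof (rule LINT_pos_open[of _ "ball 0 1"])
    show "integrable lborel (\<lambda>y. 1 * poly q (cap (0::'a) 1 y))"
      by (rule integrable_poly_cap) (use assms in auto)
    show "0 \<le> 1 * poly q (cap (0::'a) 1 y)" for y
      using assms(2)[of "cap 0 1 y"] p0 cap_nonneg[of 0 1 y] by (cases "cap 0 1 y = 0") auto
    show "0 < 1 * poly q (cap (0::'a) 1 y)" if "y \<in> ball 0 1" for y
      using that power_strict_mono[of "norm y" 1 2] by (auto intro!: assms(2) simp: cap_def)
  qed auto
  then show ?thesis by (simp add: cap_mass_def wmean_def)
qed

lemma poly_cap_bound:
  assumes "vanishes 1 q"
  obtains C where "C > 0" "\<And>x t (y::'a::euclidean_space). 0 < t \<Longrightarrow> \<bar>poly q (cap x t y)\<bar> \<le> C * indicator (cball x (sqrt t)) y"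
proof -
  have "compact (poly q ` {0..1})" by (intro compact_continuous_image continuous_intros) auto
  then obtain B where B: "\<And>y. y \<in> poly q ` {0..1} \<Longrightarrow> norm y \<le> B" 
    using compact_imp_bounded bounded_iff by metis
  show thesis
  proof (rule that[of "max B 1"])
    fix t :: real and x y :: 'a assume t: "0 < t"
    show "\<bar>poly q (cap x t y)\<bar> \<le> max B 1 * indicator (cball x (sqrt t)) y"
      using B[of "poly q (cap x t y)"] cap_nonneg[of x t y] cap_le_1[OF t, of x y] poly_cap_outside[OF t assms, of y x]
      by (cases "y \<in> cball x (sqrt t)") (auto simp: le_max_iff_disj)
  qed auto
qed

lemma wmean_at_0:
  fixes u :: "'a::euclidean_space \<Rightarrow> real"
  assumes u: "continuous_on UNIV u" and q: "vanishes 1 q"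
  shows "(wmean u x q \<longlongrightarrow> u x * cap_mass TYPE('a) q) (at_right 0)"
proof -
  obtain C where C: "C > 0" "\<And>t (y::'a). 0 < t \<Longrightarrow> \<bar>poly q (cap x t y)\<bar> \<le> C * indicator (cball x (sqrt t)) y"
    using poly_cap_bound[OF q] by metis
  let ?v = "unit_ball_vol (real DIM('a))"
  have v: "0 < ?v" by (simp add: unit_ball_vol_pos)
  show ?thesis
  proof (rule tendstoI)
    fix \<epsilon> :: real assume \<epsilon>: "0 < \<epsilon>"
    \<comment> \<open>On a small ball \<open>u\<close> varies by at most \<open>\<delta>\<close>; the weight contributes at most \<open>C\<close> times the volume.\<close>
    define \<delta> where "\<delta> = \<epsilon> / (2 * C * ?v)"
    have \<delta>: "0 < \<delta>" using \<epsilon> C(1) v by (simp add: \<delta>_def)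
    obtain r where r: "0 < r" "\<And>y. dist y x < r \<Longrightarrow> dist (u y) (u x) < \<delta>"
      using u \<delta> unfolding continuous_on_iff by (metis UNIV_I)
    have "dist (wmean u x q t) (u x * cap_mass TYPE('a) q) < \<epsilon>" if t: "0 < t" "t < r\<^sup>2" for t
    proof -
      have st: "sqrt t < r" using t r(1) real_sqrt_less_mono[of t "r\<^sup>2"] by simp
      have "wmean u x q t - u x * cap_mass TYPE('a) q = wmean (\<lambda>y. u y - u x) x q t"
      proof -
        have E: "(LINT y|lborel. (u y - u x) * poly q (cap x t y)) = 
          (LINT y|lborel. u y * poly q (cap x t y)) - (LINT y|lborel. u x * poly q (cap x t y))"
          unfolding left_diff_distrib
          by (intro Bochner_Integration.integral_diff integrable_poly_cap continuous_on_const u q t)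
        show ?thesis unfolding wmean_const[OF t(1), of x q, symmetric] wmean_def E
          by (simp add: right_diff_distrib mult.left_commute)
      qed
      also have "\<bar>\<dots>\<bar> \<le> t powr (- (DIM('a) / 2)) * (LINT y|lborel. \<delta> * C * indicator (cball x (sqrt t)) (y::'a))"
      proof -
        have "norm (LINT y|lborel. (u y - u x) * poly q (cap x t y)) \<le> (LINT y|lborel. \<delta> * C * indicator (cball x (sqrt t)) (y::'a))"
        proof (rule Bochner_Integration.integral_norm_bound_integral)
          show "integrable lborel (\<lambda>y. (u y - u x) * poly q (cap x t y))"
            by (intro integrable_poly_cap continuous_intros u t q)
          show "integrable lborel (\<lambda>y::'a. \<delta> * C * indicator (cball x (sqrt t)) y)"
            by (intro integrable_mult_right integrable_real_indicator) 
              (auto simp: emeasure_lborel_cball_finite[unfolded infinity_ennreal_def])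
          show "norm ((u y - u x) * poly q (cap x t y)) \<le> \<delta> * C * indicator (cball x (sqrt t)) y" for y
          proof (cases "y \<in> cball x (sqrt t)")
            case True
            then have "\<bar>u y - u x\<bar> \<le> \<delta>" using r(2)[of y] st by (simp add: dist_commute dist_real_def)
            then show ?thesis using C(2)[OF t(1), of y] True \<delta> C(1) by (auto simp: abs_mult intro!: mult_mono)
          next
            case False
            then show ?thesis using C(2)[OF t(1), of y] by simp
          qed
        qed
        then show ?thesis by (simp add: wmean_def abs_mult mult_left_mono)
      qed
      also have "\<dots> = \<delta> * C * ?v"
      proof -
        have "measure lborel (cball x (sqrt t)) = ?v * t powr (DIM('a) / 2)"
          using content_cball[of "sqrt t" x] t 
          by (simp add: powr_half_sqrt[symmetric] powr_realpow[symmetric] powr_powr)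
        then show ?thesis using t by (simp add: powr_minus field_simps)
      qed
      also have "\<dots> = \<epsilon> / 2" using C(1) less_imp_neq[OF v, symmetric] by (simp add: \<delta>_def)
      also have "\<dots> < \<epsilon>" using \<epsilon> by simp
      finally show ?thesis by (simp add: dist_real_def)
    qed
    then show "eventually (\<lambda>t. dist (wmean u x q t) (u x * cap_mass TYPE('a) q) < \<epsilon>) (at_right 0)"
      unfolding eventually_at_right_field using r(1) by (intro exI[of _ "r\<^sup>2"]) auto
  qed
qed

text \<open>
  The factor is that of \<^const>\<open>wmean\<close>, so this is the mean of \<open>|u|\<close> over the ball up to the volume of the
  unit ball.
\<close>

definition ball_mean :: "('a::euclidean_space \<Rightarrow> real) \<Rightarrow> 'a \<Rightarrow> real \<Rightarrow> real" where
  "ball_mean u x t = t powr (- (DIM('a) / 2)) * (LINT y|lborel. \<bar>u y\<bar> * indicator (cball x (sqrt t)) y)"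

lemma integrable_continuous_cball:
  fixes u :: "'a::euclidean_space \<Rightarrow> real"
  assumes "continuous_on UNIV u"
  shows "integrable lborel (\<lambda>y. u y * indicator (cball x r) y)"
  using borel_integrable_compact[OF compact_cball continuous_on_subset[OF assms subset_UNIV], of x r]
  by (simp add: mult.commute)

lemma wmean_at_top:
  fixes u :: "'a::euclidean_space \<Rightarrow> real"
  assumes u: "continuous_on UNIV u" and q: "vanishes 1 q" and d: "(ball_mean u x \<longlongrightarrow> 0) at_top"
  shows "(wmean u x q \<longlongrightarrow> 0) at_top"
proof -
  obtain C where C: "C > 0" "\<And>t (y::'a). 0 < t \<Longrightarrow> \<bar>poly q (cap x t y)\<bar> \<le> C * indicator (cball x (sqrt t)) y"
    using poly_cap_bound[OF q] by metis
  have "norm (wmean u x q t) \<le> C * ball_mean u x t" if t: "0 < t" for t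
  proof -
    have "norm (LINT y|lborel. u y * poly q (cap x t y)) \<le> (LINT y|lborel. C * (\<bar>u y\<bar> * indicator (cball x (sqrt t)) y))"
    proof (rule Bochner_Integration.integral_norm_bound_integral)
      show "integrable lborel (\<lambda>y. u y * poly q (cap x t y))"
        by (intro integrable_poly_cap u t q)
      show "integrable lborel (\<lambda>y. C * (\<bar>u y\<bar> * indicator (cball x (sqrt t)) y))"
        by (intro integrable_mult_right integrable_continuous_cball continuous_intros u)
      show "norm (u y * poly q (cap x t y)) \<le> C * (\<bar>u y\<bar> * indicator (cball x (sqrt t)) y)" for y
        using mult_left_mono[OF C(2)[OF t, of y], of "\<bar>u y\<bar>"] by (simp add: abs_mult mult_ac)
    qed
    then have "norm (wmean u x q t) \<le> t powr (- (DIM('a) / 2)) * (LINT y|lborel. C * (\<bar>u y\<bar> * indicator (cball x (sqrt t)) y))"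
      by (simp add: wmean_def abs_mult mult_left_mono)
    then show ?thesis by (simp add: ball_mean_def mult_ac)
  qed
  moreover have "((\<lambda>t. C * ball_mean u x t) \<longlongrightarrow> 0) at_top"
    using tendsto_mult_right_zero[OF d] by simp
  ultimately show ?thesis
    by (intro Lim_null_comparison[of "wmean u x q"]) (auto intro: eventually_mono[OF eventually_gt_at_top[of 0]])
qed

section \<open>Representation by the Riesz kernel\<close>

text \<open>
  For fixed \<open>s = |y - x|\<^sup>2\<close> this is the weight with which the point \<open>y\<close> enters the derivative of the
  radial mean at radius \<open>sqrt t\<close>. Its integral over \<open>t\<close> is homogeneous in \<open>s\<close> and therefore a
  multiple of the Riesz kernel.
\<close>

definition radial_profile :: "nat \<Rightarrow> real \<Rightarrow> real \<Rightarrow> real \<Rightarrow> real" where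
  "radial_profile k d s t = indicator {0<..} t * (t powr (real k - 1 - d) * (max 0 (1 - s / t)) ^ (2 * k + 2))"

definition profile_mass :: "nat \<Rightarrow> real \<Rightarrow> real" where
  "profile_mass k d = enn2real (\<integral>\<^sup>+t. ennreal (radial_profile k d 1 t) \<partial>lborel)"

lemma radial_profile_nonneg: "0 \<le> radial_profile k d s t"
  by (simp add: radial_profile_def)

lemma radial_profile_measurable [measurable]: "radial_profile k d s \<in> borel_measurable borel"
  unfolding radial_profile_def by measurable

lemma nn_integral_profile_finite:
  assumes "real k < d"
  shows "(\<integral>\<^sup>+t. ennreal (radial_profile k d 1 t) \<partial>lborel) < \<infinity>"
proof -
  have "(\<integral>\<^sup>+t. ennreal (radial_profile k d 1 t) \<partial>lborel) \<le> 
      (\<integral>\<^sup>+t. ennreal (t powr (real k - 1 - d)) * indicator {1..} t \<partial>lborel)"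
  proof (rule nn_integral_mono)
    fix t :: real
    show "ennreal (radial_profile k d 1 t) \<le> ennreal (t powr (real k - 1 - d)) * indicator {1..} t"
    proof (cases "1 \<le> t")
      case True
      have "(max 0 (1 - 1 / t)) ^ (2 * k + 2) \<le> 1" using True by (intro power_le_one) auto
      then have "t powr (real k - 1 - d) * (max 0 (1 - 1 / t)) ^ (2 * k + 2) \<le> t powr (real k - 1 - d) * 1"
        by (intro mult_left_mono) auto
      then show ?thesis using True by (simp add: radial_profile_def ennreal_leI)
    next
      case False
      then have "max 0 (1 - 1 / t) = 0 \<or> t \<le> 0" by (auto simp: field_simps)
      then show ?thesis using False by (auto simp: radial_profile_def)
    qed
  qed
  also have "\<dots> = ennreal (0 - 1 powr (real k - d) / (real k - d))"
  proof (rule nn_integral_FTC_atLeast)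
    show "((\<lambda>t. t powr (real k - d) / (real k - d)) has_real_derivative t powr (real k - 1 - d)) (at t)" if "1 \<le> t" for t
    proof -
      have "((\<lambda>t. t powr (real k - d) / (real k - d)) has_real_derivative 
          (real k - d) * t powr (real k - d - 1) / (real k - d)) (at t)"
        using that by (intro DERIV_cdivide has_real_derivative_powr) auto
      moreover have "(real k - d) * t powr (real k - d - 1) / (real k - d) = t powr (real k - 1 - d)"
        using assms by (simp add: diff_diff_eq add.commute)
      ultimately show ?thesis by simp
    qed
    have "((\<lambda>t. t powr (real k - d)) \<longlongrightarrow> 0) at_top"
      using assms by (intro tendsto_neg_powr filterlim_ident) auto
    from tendsto_divide[OF this tendsto_const[of "real k - d"]] assms
    show "((\<lambda>t. t powr (real k - d) / (real k - d)) \<longlongrightarrow> 0) at_top" by simp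
  qed auto
  also have "\<dots> < \<infinity>" by simp
  finally show ?thesis .
qed

lemma nn_integral_profile_1:
  assumes "real k < d"
  shows "(\<integral>\<^sup>+t. ennreal (radial_profile k d 1 t) \<partial>lborel) = ennreal (profile_mass k d)"
  using nn_integral_profile_finite[OF assms] by (simp add: profile_mass_def)

lemma profile_mass_pos:
  assumes "real k < d"
  shows "0 < profile_mass k d"
proof -
  have i: "integrable lborel (radial_profile k d 1)"
    using nn_integral_profile_finite[OF assms] 
    by (intro integrableI_nonneg) (auto simp: radial_profile_nonneg)
  have "0 < (LINT t|lborel. radial_profile k d 1 t)"
  proof (rule LINT_pos_open[OF i radial_profile_nonneg, of "{1<..<2}"])
    fix t :: real assume "t \<in> {1<..<2}"
    then have "0 < max 0 (1 - 1 / t)" "0 < t" by auto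
    then show "0 < radial_profile k d 1 t" by (simp add: radial_profile_def)
  qed auto
  also have "(LINT t|lborel. radial_profile k d 1 t) = profile_mass k d"
    unfolding profile_mass_def by (subst integral_eq_nn_integral) (auto simp: radial_profile_nonneg)
  finally show ?thesis .
qed

lemma nn_integral_profile:
  assumes "real k < d" "0 < s"
  shows "(\<integral>\<^sup>+t. ennreal (radial_profile k d s t) \<partial>lborel) = ennreal (profile_mass k d * s powr (real k - d))"
proof -
  have "(\<integral>\<^sup>+t. ennreal (radial_profile k d s t) \<partial>lborel) = \<bar>s\<bar> * (\<integral>\<^sup>+t. ennreal (radial_profile k d s (0 + s * t)) \<partial>lborel)"
    by (rule nn_integral_real_affine) (use assms in auto)
  also have "(\<lambda>t. ennreal (radial_profile k d s (0 + s * t))) = 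
     (\<lambda>t. ennreal (s powr (real k - 1 - d)) * ennreal (radial_profile k d 1 t))"
  proof
    fix t
    have "s / (s * t) = 1 / t" using assms by simp
    then have "radial_profile k d s (0 + s * t) = s powr (real k - 1 - d) * radial_profile k d 1 t"
      using assms by (cases "0 < t") (auto simp: radial_profile_def powr_mult zero_less_mult_iff)
    then show "ennreal (radial_profile k d s (0 + s * t)) = ennreal (s powr (real k - 1 - d)) * ennreal (radial_profile k d 1 t)"
      by (simp add: ennreal_mult')
  qed
  also have "\<bar>s\<bar> * (\<integral>\<^sup>+t. ennreal (s powr (real k - 1 - d)) * ennreal (radial_profile k d 1 t) \<partial>lborel) = 
     ennreal (s * s powr (real k - 1 - d) * profile_mass k d)"
    using assms by (subst nn_integral_cmult)
      (auto simp: nn_integral_profile_1 ennreal_mult' [symmetric] mult.assoc)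
  also have "s * s powr (real k - 1 - d) = s powr (real k - d)"
    using assms(2) powr_add[of s 1 "real k - 1 - d"] by simp
  finally show ?thesis by (simp add: mult.commute)
qed

definition riesz :: "nat \<Rightarrow> 'a::euclidean_space \<Rightarrow> 'a \<Rightarrow> real" where
  "riesz k x y = 1 / norm (x - y) ^ (DIM('a) - 2 * k)"

lemma riesz_nonneg: "0 \<le> riesz k x y" by (simp add: riesz_def)

lemma riesz_commute: "riesz k x y = riesz k y x" by (simp add: riesz_def norm_minus_commute)

lemma riesz_measurable [measurable]: "riesz k (x::'a::euclidean_space) \<in> borel_measurable borel"
  unfolding riesz_def by measurable

lemma riesz_powr:
  fixes x y :: "'a::euclidean_space"
  assumes "2 * k < DIM('a)" "y \<noteq> x"
  shows "((norm (y - x))\<^sup>2) powr (real k - DIM('a) / 2) = riesz k x y"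
proof -
  have p: "0 < norm (y - x)" using assms by simp
  have "((norm (y - x))\<^sup>2) powr (real k - DIM('a) / 2) = norm (y - x) powr (2 * (real k - DIM('a) / 2))"
  proof -
    have "(norm (y - x))\<^sup>2 = norm (y - x) powr 2" using p by simp
    then show ?thesis by (simp only: powr_powr)
  qed
  also have "2 * (real k - DIM('a) / 2) = - real (DIM('a) - 2 * k)" using assms by (simp add: of_nat_diff)
  also have "norm (y - x) powr - real (DIM('a) - 2 * k) = riesz k x y"
    using p by (simp add: powr_minus powr_realpow riesz_def norm_minus_commute divide_inverse)
  finally show ?thesis .
qed

text \<open>
  The numerator comes from integrating the cap over all radii, the denominator from the value of the
  radial mean at radius \<open>0\<close>.
\<close>

definition riesz_const :: "'a::euclidean_space itself \<Rightarrow> nat \<Rightarrow> real" where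
  "riesz_const _ k = profile_mass k (DIM('a) / 2) / 
     (4 ^ k * fact (k - 1) * cap_mass TYPE('a) ((pderiv ^^ k) (monom 1 (2 * k + 2))))"

lemma cap_mass_pderiv_monom_pos: "0 < cap_mass TYPE('a::euclidean_space) ((pderiv ^^ k) (monom 1 (2 * k + 2)))"
proof -
  obtain a where a: "a > 0" "(pderiv ^^ k) (monom (1::real) (2 * k + 2)) = monom a (2 * k + 2 - k)"
    using pderiv_power_monom[of k "2 * k + 2"] by auto
  then show ?thesis by (intro cap_mass_pos) (auto simp: poly_monom)
qed

lemma riesz_const_pos: "2 * k < DIM('a::euclidean_space) \<Longrightarrow> 0 < riesz_const TYPE('a) k"
  unfolding riesz_const_def by (intro divide_pos_pos profile_mass_pos mult_pos_pos cap_mass_pderiv_monom_pos) auto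

lemma radial_profile_cap:
  "0 < t \<Longrightarrow> radial_profile k d ((norm (y - x))\<^sup>2) t = t powr (real k - 1 - d) * cap x t y ^ (2 * k + 2)"
  by (simp add: radial_profile_def cap_def)

text \<open>
  The primitive is a multiple of the mean with weight \<open>(\<Theta> - 1) \<dots> (\<Theta> - k + 1) D ^ k X ^ (2 k + 2)\<close>.
  Applying \<open>\<Theta> = t * d/dt\<close> to it completes the falling product that represents \<open>(-\<Delta>) ^ k\<close> of the cap
  power. In the limit at radius \<open>0\<close> only the total weight counts; it vanishes for every \<open>\<Theta> q\<close>, so that
  each factor \<open>\<Theta> - i\<close> contributes \<open>- i\<close>. The exponent \<open>2 * k + 2\<close> leaves two orders of vanishing after
  \<open>2 * k\<close> derivatives, which makes the derivative continuous.
\<close>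

lemma radial_mean_derivative:
  fixes u h :: "'a::euclidean_space \<Rightarrow> real"
  assumes k: "1 \<le> k" and u: "continuous_on UNIV u"
    and weak: "\<And>t. 0 < t \<Longrightarrow> (LINT y|lborel. h y * cap x t y ^ (2 * k + 2)) = 
       (LINT y|lborel. u y * neg_laplacian_power k (\<lambda>y. cap x t y ^ (2 * k + 2)) y)"
    and decay: "(ball_mean u x \<longlongrightarrow> 0) at_top"
  defines "N \<equiv> \<lambda>t. t powr (real k - 1 - DIM('a) / 2) * (LINT y|lborel. h y * cap x t y ^ (2 * k + 2))"
  shows "\<exists>B. (\<forall>t>0. (B has_real_derivative N t) (at t)) \<and> (\<forall>t>0. isCont N t) \<and>
    (B \<longlongrightarrow> - (4 ^ k * fact (k - 1) * cap_mass TYPE('a) ((pderiv ^^ k) (monom 1 (2 * k + 2)))) * u x) (at_right 0) \<and>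
    (B \<longlongrightarrow> 0) at_top"
proof -
  let ?d = "real DIM('a) / 2" and ?M = "monom (1::real) (2 * k + 2)"
  define P where "P = (pderiv ^^ k) ?M"
  define Q where "Q = scaling_falling ?d 1 (k - 1) P"
  define L where "L = (neglap_op ?d ^^ k) ?M"
  have TQ: "scaling_op ?d Q = scaling_falling ?d 0 k P" using k by (cases k) (auto simp: Q_def)
  have L: "L = smult ((-4) ^ k) (scaling_op ?d Q)" unfolding L_def neglap_op_power_eq TQ P_def ..
  obtain a where a: "a > 0" "P = monom a (2 * k + 2 - k)"
    unfolding P_def using pderiv_power_monom[of k "2 * k + 2"] by auto
  have vP: "vanishes (k + 2) P" using a(2) by auto
  have vQ: "vanishes 3 Q" unfolding Q_def by (rule vanishes_scaling_falling) (use vP k in auto)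
  have vQ2: "vanishes 2 Q" "vanishes 1 Q" using vQ by auto
  have vL: "vanishes 2 L" unfolding L_def by (rule vanishes_neglap_op_power) auto
  define B where "B t = (-4) ^ k * wmean u x Q t" for t
  have N: "N t = wmean u x L t / t" if t: "0 < t" for t
  proof -
    have "(LINT y|lborel. u y * neg_laplacian_power k (\<lambda>y. cap x t y ^ (2 * k + 2)) y) = 
        (LINT y|lborel. (1 / t) ^ k * (u y * poly L (cap x t y)))"
    proof -
      have "neg_laplacian_power k (\<lambda>y. cap x t y ^ (2 * k + 2)) = (\<lambda>y. (1 / t) ^ k * poly L (cap x t y))"
        using neg_laplacian_power_poly_cap[of k ?M t x] t by (simp add: poly_monom L_def)
      then show ?thesis by (simp add: mult.left_commute)
    qed
    then have "N t = t powr (real k - 1 - ?d) * ((1 / t) ^ k * (LINT y|lborel. u y * poly L (cap x t y)))"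
      unfolding N_def weak[OF t] by simp
    also have "t powr (real k - 1 - ?d) = t powr (- ?d) * t ^ k / t"
      using t powr_add[of t "- ?d" "real k - 1"] by (simp add: powr_diff powr_realpow)
    finally show ?thesis using t by (simp add: wmean_def power_divide)
  qed
  show ?thesis
  proof (intro exI[of _ B] conjI allI impI)
    fix t :: real assume t: "0 < t"
    have "(B has_real_derivative (-4) ^ k * (wmean u x (scaling_op ?d Q) t / t)) (at t)"
      unfolding B_def[abs_def] by (rule DERIV_cmult[OF DERIV_wmean[OF u t vQ2(1)]])
    then show "(B has_real_derivative N t) (at t)"
      unfolding N[OF t] L wmean_smult by simp
  next
    fix t :: real assume t: "0 < t"
    have "isCont (\<lambda>t. wmean u x L t / t) t"
      using DERIV_isCont[OF DERIV_wmean[OF u t vL]] t by (intro continuous_intros) auto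
    moreover have "eventually (\<lambda>t. N t = wmean u x L t / t) (nhds t)"
      using t N by (auto simp: eventually_nhds intro!: exI[of _ "{0<..}"])
    ultimately show "isCont N t" using isCont_cong[of N "\<lambda>t. wmean u x L t / t" t] by simp
  next
    have "cap_mass TYPE('a) Q = (\<Prod>i<k - 1. - (1 + real i)) * cap_mass TYPE('a) P"
      unfolding Q_def by (rule cap_mass_scaling_falling) (use vP in auto)
    also have "(\<Prod>i<k - 1. - (1 + real i)) = (-1) ^ (k - 1) * fact (k - 1)"
    proof -
      have "(\<Prod>i<j. - (1 + real i)) = (-1) ^ j * fact j" for j
        by (induction j) (auto simp: algebra_simps)
      then show ?thesis .
    qed
    finally have m: "(-4) ^ k * cap_mass TYPE('a) Q = - (4 ^ k * fact (k - 1) * cap_mass TYPE('a) P)"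
      using k by (cases k) (auto simp: power_mult_distrib[symmetric])
    have "(B \<longlongrightarrow> (-4) ^ k * (u x * cap_mass TYPE('a) Q)) (at_right 0)"
      unfolding B_def[abs_def] by (intro tendsto_intros wmean_at_0 u vQ2)
    then show "(B \<longlongrightarrow> - (4 ^ k * fact (k - 1) * cap_mass TYPE('a) ((pderiv ^^ k) ?M)) * u x) (at_right 0)"
    proof -
      have "(-4) ^ k * (u x * cap_mass TYPE('a) Q) = ((-4) ^ k * cap_mass TYPE('a) Q) * u x" by simp
      then show ?thesis using \<open>(B \<longlongrightarrow> _) (at_right 0)\<close> unfolding m P_def by simp
    qed
    show "(B \<longlongrightarrow> 0) at_top"
      unfolding B_def[abs_def] by (intro tendsto_mult_right_zero wmean_at_top u vQ2 decay)
  qed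
qed

lemma AE_neq: "AE y in lborel. y \<noteq> (x::'a::euclidean_space)"
  by (rule AE_lborel_singleton)

lemma einterval_0_inf: "einterval 0 \<infinity> = {0::real<..}"
  by (auto simp: einterval_def zero_ereal_def)

lemma nn_integral_radial_profile_riesz:
  fixes h :: "'a::euclidean_space \<Rightarrow> real"
  assumes "2 * k < DIM('a)"
  shows "(\<integral>\<^sup>+y. \<integral>\<^sup>+t. ennreal (\<bar>h y\<bar> * radial_profile k (DIM('a) / 2) ((norm (y - x))\<^sup>2) t) \<partial>lborel \<partial>lborel) =
    (\<integral>\<^sup>+y. ennreal (profile_mass k (DIM('a) / 2) * (riesz k x y * \<bar>h y\<bar>)) \<partial>lborel)"
proof (rule nn_integral_cong_AE, use AE_neq[of x] in eventually_elim)
  fix y assume y: "y \<noteq> x"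
  have "(\<integral>\<^sup>+t. ennreal (\<bar>h y\<bar> * radial_profile k (DIM('a) / 2) ((norm (y - x))\<^sup>2) t) \<partial>lborel) = 
     ennreal \<bar>h y\<bar> * ennreal (profile_mass k (DIM('a) / 2) * riesz k x y)"
    using y assms by (simp add: ennreal_mult radial_profile_nonneg nn_integral_cmult nn_integral_profile riesz_powr)
  also have "\<dots> = ennreal (profile_mass k (DIM('a) / 2) * (riesz k x y * \<bar>h y\<bar>))"
    by (simp add: ennreal_mult' [symmetric] mult_ac)
  finally show "(\<integral>\<^sup>+t. ennreal (\<bar>h y\<bar> * radial_profile k (DIM('a) / 2) ((norm (y - x))\<^sup>2) t) \<partial>lborel) = 
     ennreal (profile_mass k (DIM('a) / 2) * (riesz k x y * \<bar>h y\<bar>))" .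
qed

lemma radial_profile_measurable2:
  fixes x :: "'a::euclidean_space"
  shows "(\<lambda>p. radial_profile k d ((norm (snd p - x))\<^sup>2) (fst p)) \<in> borel_measurable (borel \<Otimes>\<^sub>M borel)"
  unfolding radial_profile_def by measurable

text \<open>
  For nonnegative \<open>h\<close> the primitive of \<open>radial_mean_derivative\<close> is monotone with finite limits, so its
  derivative is integrable over all radii. By Tonelli this is the integrability of \<open>h\<close> against the
  Riesz kernel.
\<close>

lemma riesz_integrable:
  fixes u h :: "'a::euclidean_space \<Rightarrow> real"
  assumes k: "1 \<le> k" "2 * k < DIM('a)" and u: "continuous_on UNIV u"
    and h[measurable]: "h \<in> borel_measurable borel" and h0: "\<And>y. 0 \<le> h y"
    and int: "\<And>t. 0 < t \<Longrightarrow> integrable lborel (\<lambda>y. h y * cap x t y ^ (2 * k + 2))"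
    and weak: "\<And>t. 0 < t \<Longrightarrow> (LINT y|lborel. h y * cap x t y ^ (2 * k + 2)) = 
       (LINT y|lborel. u y * neg_laplacian_power k (\<lambda>y. cap x t y ^ (2 * k + 2)) y)"
    and decay: "(ball_mean u x \<longlongrightarrow> 0) at_top"
  shows "integrable lborel (\<lambda>y. riesz k x y * h y)"
proof -
  let ?d = "real DIM('a) / 2"
  let ?f = "\<lambda>t y. h y * radial_profile k ?d ((norm (y - x))\<^sup>2) t"
  define N where "N = (\<lambda>t. t powr (real k - 1 - ?d) * (LINT y|lborel. h y * cap x t y ^ (2 * k + 2)))"
  define b0 where "b0 = - (4 ^ k * fact (k - 1) * cap_mass TYPE('a) ((pderiv ^^ k) (monom 1 (2 * k + 2)))) * u x"
  have "\<exists>B. (\<forall>t>0. (B has_real_derivative N t) (at t)) \<and> (\<forall>t>0. isCont N t) \<and>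
      (B \<longlongrightarrow> b0) (at_right 0) \<and> (B \<longlongrightarrow> 0) at_top"
    unfolding N_def b0_def by (rule radial_mean_derivative[OF k(1) u weak decay])
  then obtain B where B: "\<And>t. 0 < t \<Longrightarrow> (B has_real_derivative N t) (at t)" "\<And>t. 0 < t \<Longrightarrow> isCont N t"
    "(B \<longlongrightarrow> b0) (at_right 0)" "(B \<longlongrightarrow> 0) at_top" by blast
  have N0: "0 \<le> N t" for t 
    unfolding N_def by (intro mult_nonneg_nonneg Bochner_Integration.integral_nonneg) (auto simp: h0 cap_nonneg)
  have "set_integrable lborel (einterval 0 \<infinity>) N"
    by (rule interval_integral_FTC_nonneg(1)[where F=B and A=b0 and B=0])
      (use B N0 in \<open>auto simp: zero_ereal_def ereal_tendsto_simps ereal_tendsto_simps1\<close>)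
  then have Ni: "integrable lborel (\<lambda>t. indicator {0<..} t * N t)"
    by (simp add: set_integrable_def einterval_0_inf)
  have inner: "(\<integral>\<^sup>+y. ennreal (?f t y) \<partial>lborel) = ennreal (indicator {0<..} t * N t)" for t
  proof (cases "0 < t")
    case True
    have "(\<integral>\<^sup>+y. ennreal (?f t y) \<partial>lborel) = (\<integral>\<^sup>+y. ennreal (t powr (real k - 1 - ?d)) * ennreal (h y * cap x t y ^ (2 * k + 2)) \<partial>lborel)"
      by (intro nn_integral_cong) (simp add: radial_profile_cap[OF True] ennreal_mult' [symmetric] mult_ac)
    also have "\<dots> = ennreal (t powr (real k - 1 - ?d)) * ennreal (LINT y|lborel. h y * cap x t y ^ (2 * k + 2))"
      using int[OF True] by (subst nn_integral_cmult) (auto simp: nn_integral_eq_integral h0 cap_nonneg)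
    finally show ?thesis using True by (simp add: N_def ennreal_mult'[symmetric])
  next
    case False then show ?thesis by (simp add: radial_profile_def)
  qed
  have m: "(\<lambda>(t, y). ennreal (?f t y)) \<in> borel_measurable (lborel \<Otimes>\<^sub>M lborel)"
    using radial_profile_measurable2[of k ?d x] by (simp add: split_beta)
  have "(\<integral>\<^sup>+y. ennreal (profile_mass k ?d * (riesz k x y * \<bar>h y\<bar>)) \<partial>lborel) = (\<integral>\<^sup>+y. \<integral>\<^sup>+t. ennreal (?f t y) \<partial>lborel \<partial>lborel)"
    using nn_integral_radial_profile_riesz[OF k(2), of h x] h0 by simp
  also have "\<dots> = (\<integral>\<^sup>+t. \<integral>\<^sup>+y. ennreal (?f t y) \<partial>lborel \<partial>lborel)"
    by (rule lborel_pair.Fubini'[OF m])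
  also have "\<dots> = (\<integral>\<^sup>+t. ennreal (indicator {0<..} t * N t) \<partial>lborel)" by (simp only: inner)
  also have "\<dots> < \<infinity>" using Ni N0 by (subst nn_integral_eq_integral) auto
  finally have "(\<integral>\<^sup>+y. ennreal (profile_mass k ?d * (riesz k x y * h y)) \<partial>lborel) < \<infinity>" using h0 by simp
  then have "integrable lborel (\<lambda>y. profile_mass k ?d * (riesz k x y * h y))"
    using profile_mass_pos[of k ?d] k 
    by (intro integrableI_nonneg) (auto simp: h0 riesz_nonneg)
  then show ?thesis using profile_mass_pos[of k ?d] k by simp
qed

text \<open>
  The fundamental theorem of calculus for the radial mean between radius \<open>0\<close> and infinity, combined
  with Fubini. The function \<open>h\<close> may change sign, as is needed for the cap powers themselves.
\<close>

lemma riesz_representation: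
  fixes u h :: "'a::euclidean_space \<Rightarrow> real"
  assumes k: "1 \<le> k" "2 * k < DIM('a)" and u: "continuous_on UNIV u"
    and h[measurable]: "h \<in> borel_measurable borel" 
    and int: "integrable lborel (\<lambda>y. riesz k x y * h y)"
    and weak: "\<And>t. 0 < t \<Longrightarrow> (LINT y|lborel. h y * cap x t y ^ (2 * k + 2)) = 
       (LINT y|lborel. u y * neg_laplacian_power k (\<lambda>y. cap x t y ^ (2 * k + 2)) y)"
    and decay: "(ball_mean u x \<longlongrightarrow> 0) at_top"
  shows "u x = riesz_const TYPE('a) k * (LINT y|lborel. riesz k x y * h y)"
proof -
  let ?d = "real DIM('a) / 2"
  let ?f = "\<lambda>t y. h y * radial_profile k ?d ((norm (y - x))\<^sup>2) t"
  define \<gamma> where "\<gamma> = 4 ^ k * fact (k - 1) * cap_mass TYPE('a) ((pderiv ^^ k) (monom 1 (2 * k + 2)))"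
  have \<gamma>: "0 < \<gamma>" unfolding \<gamma>_def by (intro mult_pos_pos cap_mass_pderiv_monom_pos) auto
  define N where "N = (\<lambda>t. t powr (real k - 1 - ?d) * (LINT y|lborel. h y * cap x t y ^ (2 * k + 2)))"
  have "\<exists>B. (\<forall>t>0. (B has_real_derivative N t) (at t)) \<and> (\<forall>t>0. isCont N t) \<and>
      (B \<longlongrightarrow> - \<gamma> * u x) (at_right 0) \<and> (B \<longlongrightarrow> 0) at_top"
    unfolding N_def \<gamma>_def by (rule radial_mean_derivative[OF k(1) u weak decay])
  then obtain B where B: "\<And>t. 0 < t \<Longrightarrow> (B has_real_derivative N t) (at t)" "\<And>t. 0 < t \<Longrightarrow> isCont N t"
    "(B \<longlongrightarrow> - \<gamma> * u x) (at_right 0)" "(B \<longlongrightarrow> 0) at_top" by blast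
  have inner: "(LINT y|lborel. ?f t y) = indicator {0<..} t * N t" for t
  proof (cases "0 < t")
    case True
    have "(LINT y|lborel. ?f t y) = (LINT y|lborel. t powr (real k - 1 - ?d) * (h y * cap x t y ^ (2 * k + 2)))"
      by (intro Bochner_Integration.integral_cong) (auto simp: radial_profile_cap[OF True])
    then show ?thesis using True by (simp add: N_def)
  next
    case False then show ?thesis by (simp add: radial_profile_def)
  qed
  have inner2: "(LINT t|lborel. ?f t y) = profile_mass k ?d * (riesz k x y * h y)" if "y \<noteq> x" for y
  proof -
    have "(LINT t|lborel. radial_profile k ?d ((norm (y - x))\<^sup>2) t) = profile_mass k ?d * riesz k x y"
      by (subst integral_eq_nn_integral) 
        (use that k in \<open>auto simp: radial_profile_nonneg nn_integral_profile riesz_powr riesz_nonneg 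
          less_imp_le[OF profile_mass_pos]\<close>)
    then show ?thesis by simp
  qed
  have m: "(\<lambda>(t, y). ?f t y) \<in> borel_measurable (lborel \<Otimes>\<^sub>M lborel)"
    using radial_profile_measurable2[of k ?d x] by (simp add: split_beta)
  have fi: "integrable (lborel \<Otimes>\<^sub>M lborel) (\<lambda>(t, y). ?f t y)"
  proof (rule integrableI_bounded[OF m])
    have "(\<integral>\<^sup>+p. ennreal (norm (case p of (t, y) \<Rightarrow> ?f t y)) \<partial>(lborel \<Otimes>\<^sub>M lborel)) = 
       (\<integral>\<^sup>+y. \<integral>\<^sup>+t. ennreal (norm (?f t y)) \<partial>lborel \<partial>lborel)"
      using m by (subst lborel_pair.nn_integral_snd[symmetric]) auto
    also have "\<dots> = (\<integral>\<^sup>+y. ennreal (profile_mass k ?d * (riesz k x y * \<bar>h y\<bar>)) \<partial>lborel)"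
      unfolding nn_integral_radial_profile_riesz[OF k(2), of h x, symmetric]
      by (simp add: abs_mult radial_profile_nonneg)
    also have "\<dots> < \<infinity>"
    proof -
      have "integrable lborel (\<lambda>y. profile_mass k ?d * norm (riesz k x y * h y))"
        by (intro integrable_mult_right integrable_norm int)
      then have "integrable lborel (\<lambda>y. profile_mass k ?d * (riesz k x y * \<bar>h y\<bar>))"
        by (simp add: abs_mult riesz_nonneg)
      then show ?thesis using k by (subst nn_integral_eq_integral) 
        (auto simp: riesz_nonneg intro!: mult_nonneg_nonneg less_imp_le[OF profile_mass_pos])
    qed
    finally show "(\<integral>\<^sup>+p. ennreal (norm (case p of (t, y) \<Rightarrow> ?f t y)) \<partial>(lborel \<Otimes>\<^sub>M lborel)) < \<infinity>" .
  qed
  have Ni: "integrable lborel (\<lambda>t. indicator {0<..} t * N t)"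
    using lborel_pair.integrable_fst'[OF fi] by (simp add: inner)
  have "(LBINT t=0..\<infinity>. N t) = 0 - (- \<gamma> * u x)"
    by (rule interval_integral_FTC_integrable[where F=B])
      (use B Ni in \<open>auto simp: zero_ereal_def ereal_tendsto_simps ereal_tendsto_simps1 
         has_real_derivative_iff_has_vector_derivative[symmetric] set_integrable_def einterval_0_inf[unfolded zero_ereal_def]\<close>)
  then have "\<gamma> * u x = (LINT t|lborel. indicator {0<..} t * N t)"
    by (simp add: interval_lebesgue_integral_def einterval_0_inf set_lebesgue_integral_def)
  also have "\<dots> = (LINT t|lborel. LINT y|lborel. ?f t y)" by (simp only: inner)
  also have "\<dots> = (LINT y|lborel. LINT t|lborel. ?f t y)"
    by (rule lborel_pair.Fubini_integral[OF fi, symmetric])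
  also have "\<dots> = (LINT y|lborel. profile_mass k ?d * (riesz k x y * h y))"
  proof (rule integral_cong_AE)
    show "(\<lambda>y. LINT t|lborel. ?f t y) \<in> borel_measurable lborel"
      using lborel_pair.integrable_snd[OF fi] by (simp add: borel_measurable_integrable)
    show "AE y in lborel. (LINT t|lborel. ?f t y) = profile_mass k ?d * (riesz k x y * h y)"
      using AE_neq[of x] by eventually_elim (rule inner2)
  qed auto
  finally have "\<gamma> * u x = profile_mass k ?d * (LINT y|lborel. riesz k x y * h y)" by simp
  moreover have "riesz_const TYPE('a) k = profile_mass k ?d / \<gamma>" by (simp only: riesz_const_def \<gamma>_def)
  ultimately have "riesz_const TYPE('a) k * (LINT y|lborel. riesz k x y * h y) = \<gamma> * u x / \<gamma>" by simp
  then show ?thesis using \<gamma> by simp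
qed

section \<open>Decay of the ball means\<close>

lemma tendsto_powr_neg_at_top: "0 < d \<Longrightarrow> ((\<lambda>t::real. t powr (- d)) \<longlongrightarrow> 0) at_top"
  by (intro tendsto_neg_powr filterlim_ident) auto

lemma ball_mean_nonneg: "0 \<le> ball_mean u x t"
  unfolding ball_mean_def by (intro mult_nonneg_nonneg Bochner_Integration.integral_nonneg) auto

lemma integrable_abs_cball:
  fixes u :: "'a::euclidean_space \<Rightarrow> real"
  assumes "continuous_on UNIV u"
  shows "integrable lborel (\<lambda>y. \<bar>u y\<bar> * indicator (cball x r) y)"
  by (intro integrable_continuous_cball continuous_intros assms)

lemma ball_mean_compact_support:
  fixes u :: "'a::euclidean_space \<Rightarrow> real"
  assumes "continuous_on UNIV u" "compact K" "\<And>y. y \<notin> K \<Longrightarrow> u y = 0"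
  shows "(ball_mean u x \<longlongrightarrow> 0) at_top"
proof -
  have i: "integrable lborel (\<lambda>y. \<bar>u y\<bar>)"
    by (rule compact_support_integrable[OF _ assms(2)]) (use assms in \<open>auto intro!: continuous_intros\<close>)
  have "norm (ball_mean u x t) \<le> t powr (- (DIM('a) / 2)) * (LINT y|lborel. \<bar>u y\<bar>)" for t
  proof -
    have "(LINT y|lborel. \<bar>u y\<bar> * indicator (cball x (sqrt t)) y) \<le> (LINT y|lborel. \<bar>u y\<bar>)"
      by (rule integral_mono[OF integrable_abs_cball[OF assms(1)] i]) (auto simp: indicator_def)
    then show ?thesis using ball_mean_nonneg[of u x t] by (simp add: ball_mean_def mult_left_mono)
  qed
  moreover have "((\<lambda>t. t powr (- (DIM('a) / 2)) * (LINT y|lborel. \<bar>u y\<bar>)) \<longlongrightarrow> 0) at_top"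
    by (intro tendsto_mult_left_zero tendsto_powr_neg_at_top) simp
  ultimately show ?thesis
    by (intro Lim_null_comparison[of "ball_mean u x"]) auto
qed

lemma ball_mean_shift:
  fixes u :: "'a::euclidean_space \<Rightarrow> real"
  assumes u: "continuous_on UNIV u" and 0: "(ball_mean u 0 \<longlongrightarrow> 0) at_top"
  shows "(ball_mean u x \<longlongrightarrow> 0) at_top"
proof -
  let ?d = "real DIM('a) / 2"
  have le: "norm (ball_mean u x t) \<le> 4 powr ?d * ball_mean u 0 (4 * t)" if t: "0 < t" "norm x \<le> sqrt t" for t
  proof -
    have s: "sqrt (4 * t) = 2 * sqrt t" by (simp add: real_sqrt_mult)
    have sub: "cball x (sqrt t) \<subseteq> cball 0 (sqrt (4 * t))"
    proof
      fix y assume "y \<in> cball x (sqrt t)"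
      then have "norm (x - y) \<le> sqrt t" by (simp add: dist_norm)
      then have "norm y \<le> sqrt t + sqrt t" using norm_triangle_sub[of y x] t(2) by (simp add: norm_minus_commute)
      then show "y \<in> cball 0 (sqrt (4 * t))" by (simp add: s)
    qed
    have "(LINT y|lborel. \<bar>u y\<bar> * indicator (cball x (sqrt t)) y) \<le> (LINT y|lborel. \<bar>u y\<bar> * indicator (cball 0 (sqrt (4 * t))) y)"
      by (rule integral_mono[OF integrable_abs_cball[OF u] integrable_abs_cball[OF u]])
        (use sub in \<open>auto simp: indicator_def\<close>)
    then have "ball_mean u x t \<le> t powr (- ?d) * (LINT y|lborel. \<bar>u y\<bar> * indicator (cball 0 (sqrt (4 * t))) y)"
      by (simp add: ball_mean_def mult_left_mono)
    also have "t powr (- ?d) = 4 powr ?d * (4 * t) powr (- ?d)"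
      using t by (simp add: powr_mult powr_minus field_simps)
    finally show ?thesis using ball_mean_nonneg[of u x t] by (simp add: ball_mean_def mult.assoc)
  qed
  have "((\<lambda>t. ball_mean u 0 (4 * t)) \<longlongrightarrow> 0) at_top"
    by (rule filterlim_compose[OF 0]) (intro filterlim_tendsto_pos_mult_at_top[OF tendsto_const _ filterlim_ident], simp)
  then have "((\<lambda>t. 4 powr ?d * ball_mean u 0 (4 * t)) \<longlongrightarrow> 0) at_top"
    by (rule tendsto_mult_right_zero)
  moreover have "eventually (\<lambda>t. norm (ball_mean u x t) \<le> 4 powr ?d * ball_mean u 0 (4 * t)) at_top"
    using eventually_ge_at_top[of "(norm x)\<^sup>2 + 1"]
  proof eventually_elim
    case (elim t)
    have "0 < t" using elim zero_le_power2[of "norm x"] by linarith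
    moreover have "norm x \<le> sqrt t" using elim by (intro real_le_rsqrt) simp
    ultimately show ?case by (rule le)
  qed
  ultimately show ?thesis by (rule Lim_null_comparison[rotated])
qed

lemma vanishes_bound:
  assumes "vanishes j q"
  obtains C where "C > 0" "\<And>r. 0 \<le> r \<Longrightarrow> r \<le> 1 \<Longrightarrow> \<bar>poly q r\<bar> \<le> C * r ^ j"
proof -
  obtain p where p: "q = monom 1 j * p" using vanishes_factor[OF assms] by blast
  have "compact (poly p ` {0..1})" by (intro compact_continuous_image continuous_intros) auto
  then obtain B where B: "\<And>y. y \<in> poly p ` {0..1} \<Longrightarrow> norm y \<le> B" 
    using compact_imp_bounded bounded_iff by metis
  show thesis
  proof (rule that[of "max B 1"])
    fix r :: real assume r: "0 \<le> r" "r \<le> 1"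
    then have "\<bar>poly p r\<bar> \<le> max B 1" using B[of "poly p r"] by (auto simp: le_max_iff_disj)
    then show "\<bar>poly q r\<bar> \<le> max B 1 * r ^ j"
      using r mult_right_mono[of "\<bar>poly p r\<bar>" "max B 1" "r ^ j"] 
      by (simp add: p poly_monom abs_mult mult.commute)
  qed auto
qed

text \<open>
  Either the left side is at most \<open>\<kappa>\<close>, or it exceeds \<open>\<kappa>\<close> and then the superlinear power dominates it.
  The condition on \<open>M\<close> ensures that the \<open>p\<close>-th power of \<open>\<tau> ^ j\<close> is at most \<open>\<tau> ^ M\<close>.
\<close>

lemma threshold_bound:
  fixes u \<tau> \<kappa> p :: real
  assumes "0 < u" "0 \<le> \<tau>" "\<tau> \<le> 1" "0 < \<kappa>" "1 < p" "0 < j" "real M \<le> p * real j"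
  shows "u * \<tau> ^ j \<le> \<kappa> + \<kappa> powr (1 - p) * (u powr p * \<tau> ^ M)"
proof (cases "u * \<tau> ^ j \<le> \<kappa>")
  case True
  moreover have "0 \<le> \<kappa> powr (1 - p) * (u powr p * \<tau> ^ M)" using assms by simp
  ultimately show ?thesis by linarith
next
  case False
  let ?a = "u * \<tau> ^ j"
  have a: "\<kappa> < ?a" using False by simp
  have \<tau>: "0 < \<tau>" using a assms by (cases "\<tau> = 0") (auto simp: power_0_left)
  have "?a = ?a powr (1 - p) * ?a powr p"
    using a assms(4) by (simp add: powr_add[symmetric])
  also have "?a powr (1 - p) \<le> \<kappa> powr (1 - p)"
    using a assms by (intro powr_mono2') auto
  also have "?a powr p = u powr p * \<tau> powr (p * real j)"
    using \<tau> assms(1) by (simp add: powr_mult powr_realpow[symmetric] powr_powr mult.commute)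
  also have "\<tau> powr (p * real j) \<le> \<tau> powr (real M)"
    using \<tau> assms by (intro powr_mono') auto
  also have "\<tau> powr (real M) = \<tau> ^ M" using \<tau> by (simp add: powr_realpow)
  finally have "?a \<le> \<kappa> powr (1 - p) * (u powr p * \<tau> ^ M)" by (simp add: mult_left_mono mult_right_mono)
  then show ?thesis using assms(4) by linarith
qed

lemma exists_cap_exponent:
  fixes p :: "'l::finite \<Rightarrow> real"
  assumes "\<And>i. 1 < p i"
  shows "\<exists>M. 2 * k < M \<and> (\<forall>i. real M \<le> p i * real (M - 2 * k))"
proof -
  define q where "q = Min (range p)"
  have q: "1 < q" "\<And>i. q \<le> p i" unfolding q_def using assms by auto
  \<comment> \<open>Solves \<open>M \<le> q * (M - 2 * k)\<close> for \<open>M\<close>.\<close>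
  obtain M :: nat where M: "max (2 * real k) (q * (2 * k) / (q - 1)) < real M" using reals_Archimedean2 by blast
  have k: "2 * k < M" using M by simp
  have "real M \<le> p i * real (M - 2 * k)" for i
  proof -
    have "q * (2 * k) < real M * (q - 1)" using M q(1) by (simp add: field_simps)
    then have "real M \<le> q * real (M - 2 * k)" using k by (simp add: of_nat_diff algebra_simps)
    also have "\<dots> \<le> p i * real (M - 2 * k)" using q(2) by (intro mult_right_mono) auto
    finally show ?thesis .
  qed
  then show ?thesis using k by blast
qed

text \<open>
  This is the only place where the growth of the nonlinearity matters. For a test function
  \<open>\<phi> = cap 0 t y ^ M\<close> with large \<open>M\<close>, the function \<open>(-\<Delta>) ^ k \<phi>\<close> is bounded by
  a constant multiple of \<open>t powr (- k)\<close> times a smaller power of the cap. Testing the sum of the equations gives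
  \<open>t powr (- s / 2) * X \<le> C * t powr (- k) * Y\<close>, where \<open>X\<close> is the integral of the powers \<open>u powr p\<close>
  against \<open>\<phi>\<close> and \<open>Y\<close> is the integral of the \<open>u\<close> against the smaller power. Conversely, by
  \<open>threshold_bound\<close>, \<open>Y\<close> is at most \<open>\<kappa>\<close> times the volume of the ball plus a multiple of \<open>X\<close>. Since
  \<open>s / 2 < k\<close>, for large \<open>t\<close> the multiple of \<open>X\<close> is absorbed by \<open>Y / 2\<close>. Hence the mean of \<open>u\<close> is
  eventually at most a constant times \<open>\<kappa>\<close>, for every \<open>\<kappa> > 0\<close>.
\<close>

lemma averages_vanish:
  fixes u h :: "'l::finite \<Rightarrow> 'a::euclidean_space \<Rightarrow> real" and p :: "'l \<Rightarrow> real"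
  assumes u: "\<And>i. continuous_on UNIV (u i)" "\<And>i y. 0 < u i y"
    and p: "\<And>i. 1 < p i" and s: "0 \<le> s" "s < 2 * real k" and C0: "0 < C0"
    and lower: "\<And>y. y \<noteq> 0 \<Longrightarrow> C0 * norm y powr (- s) * (\<Sum>i\<in>UNIV. u i y powr p i) \<le> (\<Sum>i\<in>UNIV. h i y)"
    and int: "\<And>i M t. 2 * k < M \<Longrightarrow> 0 < t \<Longrightarrow> integrable lborel (\<lambda>y. h i y * cap 0 t y ^ M)"
    and weak: "\<And>i M t. 2 * k < M \<Longrightarrow> 0 < t \<Longrightarrow> (LINT y|lborel. h i y * cap 0 t y ^ M) = 
       (LINT y|lborel. u i y * neg_laplacian_power k (\<lambda>y. cap 0 t y ^ M) y)"
  shows "(ball_mean (u i) 0 \<longlongrightarrow> 0) at_top"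
proof -
  let ?d = "real DIM('a) / 2" and ?v = "unit_ball_vol (real DIM('a))"
  let ?card = "real (card (UNIV :: 'l set))"
  \<comment> \<open>The exponent is so large that \<open>M \<le> p i * (M - 2 * k)\<close> for every \<open>i\<close>, as \<open>threshold_bound\<close> requires.\<close>
  obtain M where M: "2 * k < M" "\<And>i. real M \<le> p i * real (M - 2 * k)" 
    using exists_cap_exponent[of p k] p by blast
  define L where "L = (neglap_op ?d ^^ k) (monom 1 M)"
  have vL: "vanishes (M - 2 * k) L" unfolding L_def by (rule vanishes_neglap_op_power) (use M(1) in auto)
  obtain C1 where C1: "C1 > 0" "\<And>r. 0 \<le> r \<Longrightarrow> r \<le> 1 \<Longrightarrow> \<bar>poly L r\<bar> \<le> C1 * r ^ (M - 2 * k)"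
    using vanishes_bound[OF vL] by metis
  define a where "a t i y = u i y * cap 0 t y ^ (M - 2 * k)" for t i y
  define b where "b t i y = u i y powr p i * cap 0 t y ^ M" for t i y
  have ai: "integrable lborel (a t i)" if "0 < t" for t i
    using integrable_poly_cap[OF u(1) that, of "monom 1 (M - 2 * k)" i 0] M(1) 
    by (simp add: poly_monom a_def[abs_def])
  have bi: "integrable lborel (b t i)" if "0 < t" for t i
  proof -
    have "continuous_on UNIV (\<lambda>y. u i y powr p i)"
      using u by (intro continuous_intros) (auto simp: less_imp_neq[OF u(2), symmetric])
    from integrable_poly_cap[OF this that, of "monom 1 M" 0] M(1)
    show ?thesis by (simp add: poly_monom b_def[abs_def])
  qed
  have a0: "0 \<le> a t i y" for t i y unfolding a_def using u(2) by (simp add: cap_nonneg less_imp_le)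
  define Y where "Y t = (\<Sum>i\<in>UNIV. LINT y|lborel. a t i y)" for t
  \<comment> \<open>Testing the sum of the equations.\<close>
  have upper: "C0 * t powr (- s / 2) * (\<Sum>i\<in>UNIV. LINT y|lborel. b t i y) \<le> C1 * (1 / t) ^ k * Y t" if t: "0 < t" for t
  proof -
    have nl: "neg_laplacian_power k (\<lambda>y. cap (0::'a) t y ^ M) = (\<lambda>y. (1 / t) ^ k * poly L (cap 0 t y))"
      using neg_laplacian_power_poly_cap[of k "monom 1 M" t "0::'a"] t M(1) by (simp add: poly_monom L_def)
    have "C0 * t powr (- s / 2) * (\<Sum>i\<in>UNIV. LINT y|lborel. b t i y) = 
       (LINT y|lborel. C0 * t powr (- s / 2) * (\<Sum>i\<in>UNIV. b t i y))"
      using bi[OF t] by simp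
    also have "\<dots> \<le> (LINT y|lborel. (\<Sum>i\<in>UNIV. h i y * cap 0 t y ^ M))"
    proof (rule integral_mono_AE)
      show "integrable lborel (\<lambda>y. C0 * t powr (- s / 2) * (\<Sum>i\<in>UNIV. b t i y))"
        using bi[OF t] by auto
      show "integrable lborel (\<lambda>y. (\<Sum>i\<in>UNIV. h i y * cap 0 t y ^ M))"
        using int[OF M(1) t] by auto
      show "AE y in lborel. C0 * t powr (- s / 2) * (\<Sum>i\<in>UNIV. b t i y) \<le> (\<Sum>i\<in>UNIV. h i y * cap 0 t y ^ M)"
        using AE_neq[of "0::'a"]
      proof eventually_elim
        case (elim y)
        have b: "(\<Sum>i\<in>UNIV. b t i y) = (\<Sum>i\<in>UNIV. u i y powr p i) * cap 0 t y ^ M"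
          by (simp add: b_def sum_distrib_right)
        have h: "(\<Sum>i\<in>UNIV. h i y * cap 0 t y ^ M) = (\<Sum>i\<in>UNIV. h i y) * cap 0 t y ^ M"
          by (simp add: sum_distrib_right)
        show ?case
        proof (cases "y \<in> cball 0 (sqrt t)")
          case True
          have "t powr (- s / 2) = sqrt t powr (- s)" using t by (simp add: powr_half_sqrt[symmetric] powr_powr)
          also have "\<dots> \<le> norm y powr (- s)" using True elim s by (intro powr_mono2') auto
          finally have "C0 * t powr (- s / 2) * (\<Sum>i\<in>UNIV. u i y powr p i) \<le> C0 * norm y powr (- s) * (\<Sum>i\<in>UNIV. u i y powr p i)"
            using C0 by (intro mult_right_mono mult_left_mono sum_nonneg) auto
          also have "\<dots> \<le> (\<Sum>i\<in>UNIV. h i y)" by (rule lower[OF elim])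
          finally show ?thesis unfolding b h mult.assoc[symmetric] 
            by (intro mult_right_mono) (auto simp: cap_nonneg)
        next
          case False
          then show ?thesis unfolding b h using cap_outside[OF t False] M(1) by (simp add: zero_power)
        qed
      qed
    qed
    also have "\<dots> = (\<Sum>i\<in>UNIV. LINT y|lborel. h i y * cap 0 t y ^ M)"
      using int[OF M(1) t] by simp
    also have "\<dots> = (\<Sum>i\<in>UNIV. LINT y|lborel. u i y * ((1 / t) ^ k * poly L (cap 0 t y)))"
      by (simp add: weak[OF M(1) t] nl)
    also have "\<dots> \<le> (\<Sum>i\<in>UNIV. LINT y|lborel. C1 * (1 / t) ^ k * a t i y)"
    proof (intro sum_mono integral_mono)
      fix i
      have "vanishes 1 L" using vL M(1) by auto
      from integrable_poly_cap[OF u(1)[of i] t this, of 0]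
      have "integrable lborel (\<lambda>y. (1 / t) ^ k * (u i y * poly L (cap 0 t y)))" by (rule integrable_mult_right)
      then show "integrable lborel (\<lambda>y. u i y * ((1 / t) ^ k * poly L (cap 0 t y)))" by (simp add: mult.left_commute)
      show "integrable lborel (\<lambda>y. C1 * (1 / t) ^ k * a t i y)" using ai[OF t] by (rule integrable_mult_right)
      fix y :: 'a
      have "poly L (cap 0 t y) \<le> C1 * cap 0 t y ^ (M - 2 * k)"
        using C1(2)[OF cap_nonneg cap_le_1[OF t], of 0 y] by linarith
      then have "(u i y * (1 / t) ^ k) * poly L (cap 0 t y) \<le> (u i y * (1 / t) ^ k) * (C1 * cap 0 t y ^ (M - 2 * k))"
        using u(2)[of i y] t by (intro mult_left_mono) auto
      then show "u i y * ((1 / t) ^ k * poly L (cap 0 t y)) \<le> C1 * (1 / t) ^ k * a t i y"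
        by (simp add: a_def mult_ac)
    qed
    also have "\<dots> = C1 * (1 / t) ^ k * Y t" by (simp add: Y_def sum_distrib_left)
    finally show ?thesis .
  qed
  have Ybound: "eventually (\<lambda>t. Y t \<le> 2 * ?card * \<kappa> * ?v * t powr ?d) at_top" if \<kappa>: "0 < \<kappa>" for \<kappa>
  proof -
    have grow: "filterlim (\<lambda>t. t powr (real k - s / 2)) at_top at_top"
      unfolding filterlim_at_top
    proof
      fix Z :: real
      define e where "e = real k - s / 2"
      have e: "0 < e" using s by (simp add: e_def)
      show "eventually (\<lambda>t. Z \<le> t powr (real k - s / 2)) at_top"
        using eventually_ge_at_top[of "(max 1 Z) powr (1 / e)"]
      proof eventually_elim
        case (elim t)
        have "Z \<le> ((max 1 Z) powr (1 / e)) powr e" using e by (simp add: powr_powr)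
        also have "\<dots> \<le> t powr e" using elim e by (intro powr_mono2) auto
        finally show ?case by (simp add: e_def)
      qed
    qed
    have "eventually (\<lambda>t. \<forall>i. \<kappa> powr (1 - p i) * (2 * C1 / C0) \<le> t powr (real k - s / 2)) at_top"
      by (rule eventually_all_finite) (use grow in \<open>unfold filterlim_at_top, blast\<close>)
    then show ?thesis using eventually_gt_at_top[of 0]
    proof eventually_elim
      case (elim t)
      then have t: "0 < t" by simp
      have vol: "measure lborel (cball (0::'a) (sqrt t)) = ?v * t powr ?d"
        using content_cball[of "sqrt t" "0::'a"] t 
        by (simp add: powr_half_sqrt[symmetric] powr_realpow[symmetric] powr_powr)
      have ci: "integrable lborel (\<lambda>y::'a. \<kappa> * indicator (cball 0 (sqrt t)) y)"
        by (intro integrable_mult_right integrable_real_indicator) 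
              (auto simp: emeasure_lborel_cball_finite[unfolded infinity_ennreal_def])
      have "(LINT y|lborel. a t i y) \<le> \<kappa> * (?v * t powr ?d) + \<kappa> powr (1 - p i) * (LINT y|lborel. b t i y)" for i
      proof -
        have "(LINT y|lborel. a t i y) \<le> (LINT y|lborel. \<kappa> * indicator (cball 0 (sqrt t)) y + \<kappa> powr (1 - p i) * b t i y)"
        proof (rule integral_mono[OF ai[OF t]])
          show "integrable lborel (\<lambda>y. \<kappa> * indicator (cball 0 (sqrt t)) y + \<kappa> powr (1 - p i) * b t i y)"
            by (intro Bochner_Integration.integrable_add ci integrable_mult_right bi[OF t])
          fix y :: 'a
          show "a t i y \<le> \<kappa> * indicator (cball 0 (sqrt t)) y + \<kappa> powr (1 - p i) * b t i y"
          proof (cases "y \<in> cball 0 (sqrt t)")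
            case True
            then show ?thesis using threshold_bound[OF u(2) cap_nonneg cap_le_1[OF t] \<kappa> p _ M(2)] M(1)
              by (simp add: a_def b_def)
          next
            case False
            then show ?thesis using cap_outside[OF t False] M(1) by (simp add: a_def b_def zero_power)
          qed
        qed
        also have "\<dots> = \<kappa> * (?v * t powr ?d) + \<kappa> powr (1 - p i) * (LINT y|lborel. b t i y)"
          by (subst Bochner_Integration.integral_add[OF ci integrable_mult_right[OF bi[OF t]]]) (simp add: vol)
        finally show ?thesis .
      qed
      then have "Y t \<le> (\<Sum>i\<in>UNIV. \<kappa> * (?v * t powr ?d) + \<kappa> powr (1 - p i) * (LINT y|lborel. b t i y))"
        unfolding Y_def by (intro sum_mono)
      also have "\<dots> = ?card * (\<kappa> * (?v * t powr ?d)) + (\<Sum>i\<in>UNIV. \<kappa> powr (1 - p i) * (LINT y|lborel. b t i y))"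
        by (simp add: sum.distrib)
      also have "(\<Sum>i\<in>UNIV. \<kappa> powr (1 - p i) * (LINT y|lborel. b t i y)) \<le> 
          (\<Sum>i\<in>UNIV. C0 / (2 * C1) * t powr (real k - s / 2) * (LINT y|lborel. b t i y))"
      proof (intro sum_mono mult_right_mono)
        fix i
        have "\<kappa> powr (1 - p i) * (2 * C1 / C0) \<le> t powr (real k - s / 2)" using elim by simp
        then show "\<kappa> powr (1 - p i) \<le> C0 / (2 * C1) * t powr (real k - s / 2)"
          using C0 C1(1) by (simp add: field_simps)
        show "0 \<le> (LINT y|lborel. b t i y)" 
          by (intro Bochner_Integration.integral_nonneg) (auto simp: b_def cap_nonneg)
      qed
      also have "\<dots> = t ^ k / (2 * C1) * (C0 * t powr (- s / 2) * (\<Sum>i\<in>UNIV. LINT y|lborel. b t i y))"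
      proof -
        have "t powr (real k - s / 2) = t ^ k * t powr (- s / 2)"
          using t powr_add[of t "real k" "- s / 2"] by (simp add: powr_realpow)
        then show ?thesis unfolding sum_distrib_left[symmetric] by (simp add: mult_ac)
      qed
      also have "\<dots> \<le> t ^ k / (2 * C1) * (C1 * (1 / t) ^ k * Y t)"
        using upper[OF t] t C1(1) by (intro mult_left_mono) auto
      also have "\<dots> = Y t / 2" using t C1(1) by (simp add: power_divide)
      finally show ?case by simp
    qed
  qed
  define E where "E = (4 / 3) ^ (M - 2 * k) * 4 powr ?d * (2 * ?card * ?v)"
  have E: "0 < E" unfolding E_def by (intro mult_pos_pos) (auto simp: card_gt_0_iff)
  \<comment> \<open>On the ball of half the radius the cap is at least \<open>3 / 4\<close>.\<close>
  have mean: "ball_mean (u i) 0 t \<le> (4 / 3) ^ (M - 2 * k) * 4 powr ?d * ((4 * t) powr (- ?d) * Y (4 * t))" if t: "0 < t" for t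
  proof -
    have t4: "0 < 4 * t" using t by simp
    have "(LINT y|lborel. \<bar>u i y\<bar> * indicator (cball 0 (sqrt t)) y) \<le> (LINT y|lborel. (4 / 3) ^ (M - 2 * k) * a (4 * t) i y)"
    proof (rule integral_mono)
      show "integrable lborel (\<lambda>y. \<bar>u i y\<bar> * indicator (cball 0 (sqrt t)) y)"
        by (intro integrable_continuous_cball continuous_intros u)
      show "integrable lborel (\<lambda>y. (4 / 3) ^ (M - 2 * k) * a (4 * t) i y)"
        using ai[OF t4] by (rule integrable_mult_right)
      fix y :: 'a
      show "\<bar>u i y\<bar> * indicator (cball 0 (sqrt t)) y \<le> (4 / 3) ^ (M - 2 * k) * a (4 * t) i y"
      proof (cases "y \<in> cball 0 (sqrt t)")
        case True
        then have "(norm y)\<^sup>2 \<le> (sqrt t)\<^sup>2" by (intro power_mono) auto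
        then have "3 / 4 \<le> cap 0 (4 * t) y" using t by (simp add: cap_def le_max_iff_disj field_simps)
        then have "1 \<le> (4 / 3 * cap 0 (4 * t) y) ^ (M - 2 * k)" by (intro one_le_power) simp
        then have "u i y * 1 \<le> u i y * (4 / 3 * cap 0 (4 * t) y) ^ (M - 2 * k)"
          using u(2)[of i y] by (intro mult_left_mono) auto
        then have "u i y \<le> (4 / 3) ^ (M - 2 * k) * a (4 * t) i y"
          unfolding a_def power_mult_distrib by (simp only: mult_ac mult_1)
        then show ?thesis using True u(2)[of i y] by simp
      next
        case False then show ?thesis by (simp add: a0)
      qed
    qed
    also have "\<dots> = (4 / 3) ^ (M - 2 * k) * (LINT y|lborel. a (4 * t) i y)" by simp
    also have "(LINT y|lborel. a (4 * t) i y) \<le> Y (4 * t)"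
      unfolding Y_def by (rule member_le_sum) (auto intro!: Bochner_Integration.integral_nonneg a0)
    finally have "(LINT y|lborel. \<bar>u i y\<bar> * indicator (cball 0 (sqrt t)) y) \<le> (4 / 3) ^ (M - 2 * k) * Y (4 * t)"
      by simp
    then have "ball_mean (u i) 0 t \<le> t powr (- ?d) * ((4 / 3) ^ (M - 2 * k) * Y (4 * t))"
      unfolding ball_mean_def by (intro mult_left_mono) auto
    also have "t powr (- ?d) = 4 powr ?d * (4 * t) powr (- ?d)"
      using t by (simp add: powr_mult powr_minus field_simps)
    finally show ?thesis by (simp add: mult_ac)
  qed
  show ?thesis
  proof (rule tendstoI)
    fix \<epsilon> :: real assume \<epsilon>: "0 < \<epsilon>"
    define \<kappa> where "\<kappa> = \<epsilon> / (2 * E)"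
    have \<kappa>: "0 < \<kappa>" using \<epsilon> E by (simp add: \<kappa>_def)
    have lim4: "filterlim (\<lambda>t::real. 4 * t) at_top at_top"
      by (intro filterlim_tendsto_pos_mult_at_top[OF tendsto_const _ filterlim_ident]) simp
    have "eventually (\<lambda>t. Y (4 * t) \<le> 2 * ?card * \<kappa> * ?v * (4 * t) powr ?d) at_top"
      using eventually_compose_filterlim[OF Ybound[OF \<kappa>] lim4] .
    then show "eventually (\<lambda>t. dist (ball_mean (u i) 0 t) 0 < \<epsilon>) at_top"
      using eventually_gt_at_top[of 0]
    proof eventually_elim
      case (elim t)
      have "ball_mean (u i) 0 t \<le> (4 / 3) ^ (M - 2 * k) * 4 powr ?d * ((4 * t) powr (- ?d) * (2 * ?card * \<kappa> * ?v * (4 * t) powr ?d))"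
        by (rule order_trans[OF mean[OF elim(2)]]) (intro mult_left_mono elim, auto)
      also have "\<dots> = E * \<kappa> * ((4 * t) powr (- ?d) * (4 * t) powr ?d)" by (simp add: E_def mult_ac)
      also have "(4 * t) powr (- ?d) * (4 * t) powr ?d = 1" using elim by (simp add: powr_add[symmetric])
      also have "E * \<kappa> * 1 = \<epsilon> / 2" using E by (simp add: \<kappa>_def)
      also have "\<dots> < \<epsilon>" using \<epsilon> by simp
      finally show ?case using ball_mean_nonneg[of "u i" 0 t] by (simp add: dist_real_def)
    qed
  qed
qed

section \<open>Potentials solve the differential equation\<close>

lemma C_diff_on_cap_power:
  "m < M \<Longrightarrow> C_diff_on m UNIV (\<lambda>y::'a::euclidean_space. cap x t y ^ M)"
  using C_diff_on_cap[of m "monom 1 M" x t] by (simp add: poly_monom)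

lemma cap_power_outside: "0 < t \<Longrightarrow> 0 < M \<Longrightarrow> y \<notin> cball x (sqrt t) \<Longrightarrow> cap x t y ^ M = 0"
  by (simp add: cap_outside)

text \<open>
  The representation formula applied to the bump itself: its ball means vanish at infinity trivially,
  and the weak equation is Green's identity for two cap powers.
\<close>

lemma cap_power_representation:
  fixes x z :: "'a::euclidean_space"
  assumes k: "1 \<le> k" "2 * k < DIM('a)" and t: "0 < t"
  defines "\<phi> \<equiv> \<lambda>y. cap x t y ^ (2 * k + 2)"
  assumes int: "integrable lborel (\<lambda>y. riesz k z y * neg_laplacian_power k \<phi> y)"
  shows "\<phi> z = riesz_const TYPE('a) k * (LINT y|lborel. riesz k z y * neg_laplacian_power k \<phi> y)"
proof -
  have C: "C_diff_on (2 * k) UNIV \<phi>" unfolding \<phi>_def by (rule C_diff_on_cap_power) simp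
  have cont: "continuous_on UNIV (neg_laplacian_power k \<phi>)"
    using C_diff_on_neg_laplacian_power[of UNIV 0 k \<phi>] C by simp
  show ?thesis
  proof (rule riesz_representation[OF k _ _ int])
    show "continuous_on UNIV \<phi>" by (rule C_diff_on_continuous[OF C])
    show "neg_laplacian_power k \<phi> \<in> borel_measurable borel" by (rule borel_measurable_continuous_onI[OF cont])
    show "(LINT y|lborel. neg_laplacian_power k \<phi> y * cap z s y ^ (2 * k + 2)) = 
        (LINT y|lborel. \<phi> y * neg_laplacian_power k (\<lambda>y. cap z s y ^ (2 * k + 2)) y)" if "0 < s" for s
    proof (rule green_neg_laplacian_power[symmetric])
      show "C_diff_on (2 * k) UNIV (\<lambda>y. cap z s y ^ (2 * k + 2))" by (rule C_diff_on_cap_power) simp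
      show "cap z s y ^ (2 * k + 2) = 0" if "y \<notin> cball z (sqrt s)" for y
        by (rule cap_power_outside[OF \<open>0 < s\<close> _ that]) simp
    qed (use C in auto)
    show "(ball_mean \<phi> z \<longlongrightarrow> 0) at_top"
      by (rule ball_mean_compact_support[OF C_diff_on_continuous[OF C] compact_cball[of x "sqrt t"]])
        (use t in \<open>auto simp: \<phi>_def cap_outside\<close>)
  qed
qed

text \<open>
  Fubini's theorem reduces the claim to \<open>cap_power_representation\<close> at the points \<open>z\<close> of the source.
  The kernel is integrable against the oscillating function \<open>(-\<Delta>) ^ k \<phi>\<close> for almost every \<open>z\<close>: the
  double integral converges absolutely because the potential \<open>v\<close> is finite, and \<open>h\<close> is positive.
\<close>

lemma potential_weak:
  fixes v h :: "'a::euclidean_space \<Rightarrow> real" and x :: 'a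
  assumes k: "1 \<le> k" "2 * k < DIM('a)" and v: "continuous_on UNIV v"
    and h: "h \<in> borel_measurable borel" "\<And>y. 0 \<le> h y" "\<And>y. y \<noteq> 0 \<Longrightarrow> 0 < h y"
    and rep: "\<And>x. x \<noteq> 0 \<Longrightarrow> integrable lborel (\<lambda>y. riesz k x y * h y)"
      "\<And>x. x \<noteq> 0 \<Longrightarrow> v x = riesz_const TYPE('a) k * (LINT y|lborel. riesz k x y * h y)"
    and t: "0 < t"
  defines "\<phi> \<equiv> \<lambda>y. cap x t y ^ (2 * k + 2)"
  shows "(LINT y|lborel. v y * neg_laplacian_power k \<phi> y) = (LINT y|lborel. h y * \<phi> y)"
proof -
  let ?c = "riesz_const TYPE('a) k"
  have c: "0 < ?c" by (rule riesz_const_pos[OF k(2)])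
  define H where "H = neg_laplacian_power k \<phi>"
  have C: "C_diff_on (2 * k) UNIV \<phi>" unfolding \<phi>_def by (rule C_diff_on_cap_power) simp
  have \<phi>0: "\<phi> y = 0" if "y \<notin> cball x (sqrt t)" for y
    unfolding \<phi>_def by (rule cap_power_outside[OF t _ that]) simp
  have cH: "continuous_on UNIV H"
    using C_diff_on_neg_laplacian_power[of UNIV 0 k \<phi>] C by (simp add: H_def)
  have H0: "H y = 0" if "y \<notin> cball x (sqrt t)" for y
    unfolding H_def by (rule neg_laplacian_power_support[OF compact_cball \<phi>0 that])
  note [measurable] = borel_measurable_continuous_onI[OF cH] h(1) borel_measurable_continuous_onI[OF v]
    borel_measurable_continuous_onI[OF C_diff_on_continuous[OF C]]
  have vH: "integrable lborel (\<lambda>y. v y * H y)"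
    by (rule compact_support_integrable[OF _ compact_cball[of x "sqrt t"]]) (use H0 in \<open>auto intro!: continuous_intros v cH\<close>)
  let ?F = "\<lambda>y z. H y * (riesz k y z * h z)"
  have m: "(\<lambda>(y, z). ?F y z) \<in> borel_measurable (lborel \<Otimes>\<^sub>M lborel)"
    unfolding riesz_def by measurable
  have Fi: "integrable (lborel \<Otimes>\<^sub>M lborel) (\<lambda>(y, z). ?F y z)"
  proof (rule integrableI_bounded[OF m])
    have "(\<integral>\<^sup>+p. ennreal (norm (case p of (y, z) \<Rightarrow> ?F y z)) \<partial>(lborel \<Otimes>\<^sub>M lborel)) = 
       (\<integral>\<^sup>+y. \<integral>\<^sup>+z. ennreal (norm (?F y z)) \<partial>lborel \<partial>lborel)"
      using m by (subst lborel.nn_integral_fst[symmetric]) auto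
    also have "\<dots> = (\<integral>\<^sup>+y. ennreal (norm (v y * H y) / ?c) \<partial>lborel)"
    proof (rule nn_integral_cong_AE, use AE_neq[of "0::'a"] in eventually_elim)
      fix y :: 'a assume y: "y \<noteq> 0"
      have i0: "0 \<le> (LINT z|lborel. riesz k y z * h z)"
        by (intro Bochner_Integration.integral_nonneg) (auto simp: riesz_nonneg h(2))
      have "(\<integral>\<^sup>+z. ennreal (norm (?F y z)) \<partial>lborel) = (\<integral>\<^sup>+z. ennreal \<bar>H y\<bar> * ennreal (riesz k y z * h z) \<partial>lborel)"
        by (simp add: abs_mult riesz_nonneg h(2) ennreal_mult')
      also have "\<dots> = ennreal \<bar>H y\<bar> * ennreal (LINT z|lborel. riesz k y z * h z)"
        using rep(1)[OF y] by (subst nn_integral_cmult) (auto simp: nn_integral_eq_integral riesz_nonneg h(2))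
      also have "\<dots> = ennreal (norm (v y * H y) / ?c)"
        using c i0 by (simp add: rep(2)[OF y] abs_mult ennreal_mult'[symmetric] mult.commute)
      finally show "(\<integral>\<^sup>+z. ennreal (norm (?F y z)) \<partial>lborel) = ennreal (norm (v y * H y) / ?c)" .
    qed
    also have "\<dots> < \<infinity>"
      using integrable_divide[OF integrable_norm[OF vH], of ?c] c by (subst nn_integral_eq_integral) auto
    finally show "(\<integral>\<^sup>+p. ennreal (norm (case p of (y, z) \<Rightarrow> ?F y z)) \<partial>(lborel \<Otimes>\<^sub>M lborel)) < \<infinity>" .
  qed
  have "(LINT y|lborel. v y * H y) = (LINT y|lborel. ?c * (LINT z|lborel. ?F y z))"
  proof (rule integral_cong_AE)
    show "(\<lambda>y. ?c * (LINT z|lborel. ?F y z)) \<in> borel_measurable lborel"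
      using lborel_pair.integrable_fst[OF Fi] by (intro borel_measurable_times borel_measurable_const borel_measurable_integrable)
    show "AE y in lborel. v y * H y = ?c * (LINT z|lborel. ?F y z)"
      using AE_neq[of "0::'a"] by eventually_elim (simp add: rep(2))
  qed measurable
  also have "\<dots> = ?c * (LINT z|lborel. LINT y|lborel. ?F y z)"
    using lborel_pair.Fubini_integral[OF Fi] by simp
  also have "\<dots> = (LINT z|lborel. ?c * (LINT y|lborel. ?F y z))" by simp
  also have "\<dots> = (LINT z|lborel. h z * \<phi> z)"
  proof (rule integral_cong_AE)
    show "(\<lambda>z. ?c * (LINT y|lborel. ?F y z)) \<in> borel_measurable lborel"
      using lborel_pair.integrable_snd[OF Fi] by (intro borel_measurable_times borel_measurable_const borel_measurable_integrable)
    show "AE z in lborel. ?c * (LINT y|lborel. ?F y z) = h z * \<phi> z"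
      using AE_neq[of "0::'a"] lborel_pair.AE_integrable_snd[OF Fi]
    proof eventually_elim
      case (elim z)
      have F: "?F y z = h z * (riesz k z y * H y)" for y by (simp add: riesz_commute[of k y z])
      have "integrable lborel (\<lambda>y. h z * (riesz k z y * H y))" using elim(2) by (simp only: F)
      then have i: "integrable lborel (\<lambda>y. riesz k z y * H y)" using h(3)[OF elim(1)] by simp
      have "\<phi> z = ?c * (LINT y|lborel. riesz k z y * H y)"
        using cap_power_representation[OF k t, of z x] i unfolding H_def \<phi>_def by blast
      then show ?case by (simp only: F) simp
    qed
  qed measurable
  finally show ?thesis unfolding H_def .
qed

text \<open>
  Both sides are continuous away from the origin. If they differed at \<open>x\<close>, their difference would have
  constant sign on a small ball around \<open>x\<close>, and testing with a bump in this ball would contradict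
  \<open>potential_weak\<close>.
\<close>

lemma neg_laplacian_power_potential:
  fixes v h :: "'a::euclidean_space \<Rightarrow> real"
  assumes k: "1 \<le> k" "2 * k < DIM('a)" and v: "continuous_on UNIV v" "C_diff_on (2 * k) (- {0}) v"
    and h: "h \<in> borel_measurable borel" "\<And>y. 0 \<le> h y" "\<And>y. y \<noteq> 0 \<Longrightarrow> 0 < h y" "continuous_on (- {0}) h"
    and rep: "\<And>x. x \<noteq> 0 \<Longrightarrow> integrable lborel (\<lambda>y. riesz k x y * h y)"
      "\<And>x. x \<noteq> 0 \<Longrightarrow> v x = riesz_const TYPE('a) k * (LINT y|lborel. riesz k x y * h y)"
    and x: "x \<noteq> 0"
  shows "neg_laplacian_power k v x = h x"
proof (rule ccontr)
  define D where "D y = neg_laplacian_power k v y - h y" for y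
  \<comment> \<open>The sign makes the difference positive at \<open>x\<close>.\<close>
  define D' where "D' y = sgn (D x) * D y" for y
  assume "neg_laplacian_power k v x \<noteq> h x"
  then have Dx: "0 < D' x" by (auto simp: D'_def D_def sgn_if)
  have cn: "C_diff_on 0 (- {0}) (neg_laplacian_power k v)"
    by (rule C_diff_on_neg_laplacian_power) (use v in auto)
  have "continuous_on (- {0}) D'"
    unfolding D'_def D_def using cn h(4) by (auto intro!: continuous_intros)
  then have "open (D' -` {0<..} \<inter> (- {0}))"
    by (intro continuous_on_open_vimage[THEN iffD1, rule_format]) auto
  then obtain r where r: "0 < r" "ball x r \<subseteq> D' -` {0<..} \<inter> (- {0})"
    by (rule openE[of _ x]) (use Dx x in auto)
  \<comment> \<open>Half the radius keeps the closed support of the bump inside the open ball.\<close>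
  define t where "t = (r / 2)\<^sup>2"
  have t: "0 < t" "sqrt t = r / 2" using r(1) by (auto simp: t_def real_sqrt_abs)
  have sub: "cball x (sqrt t) \<subseteq> ball x r" unfolding t(2) using r(1) by auto
  define \<phi> where "\<phi> = (\<lambda>y. cap x t y ^ (2 * k + 2))"
  have \<phi>0: "\<phi> y = 0" if "y \<notin> cball x (sqrt t)" for y
    unfolding \<phi>_def by (rule cap_power_outside[OF t(1) _ that]) simp
  have C: "C_diff_on (2 * k) UNIV \<phi>" unfolding \<phi>_def by (rule C_diff_on_cap_power) simp
  have C0: "C_diff_on 0 (- {0}) \<phi>" 
    using C_diff_on_continuous[OF C] continuous_on_subset by auto
  have K: "cball x (sqrt t) \<subseteq> - {0}" using sub r(2) by blast
  have i1: "integrable lborel (\<lambda>y. neg_laplacian_power k v y * \<phi> y)"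
    using C_diff_on_mult_support[OF _ compact_cball K cn C0 \<phi>0] \<phi>0
    by (intro compact_support_integrable[OF _ compact_cball[of x "sqrt t"]]) auto
  have i2: "integrable lborel (\<lambda>y. h y * \<phi> y)"
    using C_diff_on_mult_support[OF _ compact_cball K _ C0 \<phi>0, of h] h(4) \<phi>0
    by (intro compact_support_integrable[OF _ compact_cball[of x "sqrt t"]]) auto
  have "(LINT y|lborel. neg_laplacian_power k v y * \<phi> y) = (LINT y|lborel. v y * neg_laplacian_power k \<phi> y)"
    by (rule green_neg_laplacian_power[OF _ v(2) C compact_cball K \<phi>0, symmetric]) auto
  also have "\<dots> = (LINT y|lborel. h y * \<phi> y)"
    unfolding \<phi>_def by (rule potential_weak[OF k v(1) h(1-3) rep t(1)])
  finally have eq: "(LINT y|lborel. D y * \<phi> y) = 0"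
    unfolding D_def left_diff_distrib by (simp add: Bochner_Integration.integral_diff[OF i1 i2])
  have iD: "integrable lborel (\<lambda>y. D' y * \<phi> y)"
    unfolding D'_def D_def left_diff_distrib right_diff_distrib mult.assoc 
    by (intro Bochner_Integration.integrable_diff integrable_mult_right i1 i2)
  have pos: "0 < D' y" if "y \<in> cball x (sqrt t)" for y using that sub r(2) by auto
  have "0 < (LINT y|lborel. D' y * \<phi> y)"
  proof (rule LINT_pos_open[OF iD, of "ball x (r / 2)"])
    show "0 \<le> D' y * \<phi> y" for y
    proof (cases "y \<in> cball x (sqrt t)")
      case True
      have "0 \<le> \<phi> y" unfolding \<phi>_def by (intro zero_le_power cap_nonneg)
      then show ?thesis using pos[OF True] by simp
    next
      case False
      show ?thesis unfolding \<phi>0[OF False] by simp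
    qed
    show "0 < D' y * \<phi> y" if y: "y \<in> ball x (r / 2)" for y
    proof -
      have "(norm (y - x))\<^sup>2 < t" unfolding t_def using y
        by (intro power_strict_mono) (auto simp: dist_norm norm_minus_commute)
      then have "0 < cap x t y" using t(1) by (simp add: cap_def)
      then show ?thesis using pos[of y] y t(2) by (auto simp: \<phi>_def intro!: mult_pos_pos)
    qed
  qed (use r in auto)
  also have "(LINT y|lborel. D' y * \<phi> y) = sgn (D x) * (LINT y|lborel. D y * \<phi> y)"
    unfolding D'_def mult.assoc by simp
  finally show False using eq by simp
qed

section \<open>The two systems\<close>

text \<open>
  The right-hand side of the \<open>i\<close>-th differential equation along \<open>u\<close>.
\<close>

definition source :: "('l \<Rightarrow> real) \<Rightarrow> ('l \<Rightarrow> real^'n \<Rightarrow> real^'l \<Rightarrow> real) \<Rightarrow> (real^'n \<Rightarrow> real^'l) \<Rightarrow> 'l \<Rightarrow> real^'n \<Rightarrow> real" where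
  "source \<sigma> f u i y = norm y powr (- \<sigma> i) * f i y (u y)"

lemma riesz_integrand_source:
  fixes u :: "real^'n \<Rightarrow> real^'l"
  shows "riesz_integrand k \<sigma> f u i x = (\<lambda>y. riesz k x y * source \<sigma> f u i y)"
  by (simp add: fun_eq_iff riesz_integrand_def riesz_def source_def powr_minus divide_inverse)

lemma positive_classicalD:
  fixes u :: "real^'n \<Rightarrow> real^'l"
  assumes "positive_classical k u"
  shows "0 < u x $ i" "continuous_on UNIV (\<lambda>y. u y $ i)" "C_diff_on (2 * k) (- {0}) (\<lambda>y. u y $ i)"
  using assms C_diff_on_bounded_linear[OF _ bounded_linear_vec_nth, of "- {0}" "2 * k" u i]
  by (auto simp: positive_classical_def intro!: continuous_intros)

lemma source_continuous:
  fixes u :: "real^'n \<Rightarrow> real^'l"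
  assumes "positive_classical k u" "smooth_nonlinearity (f i)"
  shows "continuous_on (- {0}) (source \<sigma> f u i)" "source \<sigma> f u i \<in> borel_measurable borel"
proof -
  have "continuous_on {(x, v). \<forall>j. 0 < v $ j} (\<lambda>(x, v). f i x v)"
    using assms(2) unfolding smooth_nonlinearity_def C_inf_on_def by (metis C_diff_on.simps(1))
  moreover have "continuous_on UNIV (\<lambda>y. (y, u y))"
    using assms(1) unfolding positive_classical_def by (auto intro!: continuous_intros)
  ultimately have c: "continuous_on UNIV (\<lambda>y. f i y (u y))"
    using continuous_on_compose2[of "{(x, v). \<forall>j. 0 < v $ j}" "\<lambda>(x, v). f i x v" UNIV "\<lambda>y. (y, u y)"]
      assms(1) by (auto simp: positive_classical_def)
  show "continuous_on (- {0}) (source \<sigma> f u i)"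
    unfolding source_def[abs_def] by (intro continuous_intros continuous_on_subset[OF c]) auto
  have "(\<lambda>y. f i y (u y)) \<in> borel_measurable borel" by (rule borel_measurable_continuous_onI[OF c])
  then show "source \<sigma> f u i \<in> borel_measurable borel"
    unfolding source_def[abs_def] by measurable
qed

lemma bounded_linear_scale_components: "bounded_linear (scale_components \<mu>)"
  unfolding linear_conv_bounded_linear[symmetric] scale_components_def
  by (rule linearI) (auto simp: vec_eq_iff algebra_simps)

lemma positive_classical_scale:
  assumes "positive_classical k u" "\<And>i. 0 < \<mu> $ i"
  shows "positive_classical k (\<lambda>x. scale_components \<mu> (u x))"
  using assms C_diff_on_bounded_linear[OF _ bounded_linear_scale_components, of "- {0}" "2 * k" u \<mu>]
    bounded_linear.continuous_on[OF bounded_linear_scale_components, of UNIV u \<mu>]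
  by (auto simp: positive_classical_def scale_components_def)

text \<open>
  The factors \<open>a\<close> and \<open>b\<close> cover the normalised system (\<open>a\<close> the Riesz constant, \<open>b = 1\<close>) and the
  unnormalised system with a rescaled component (\<open>a = 1\<close>).
\<close>

lemma IE_imp_PDE:
  fixes u :: "real^'n \<Rightarrow> real^'l" and w :: "real^'n \<Rightarrow> real"
  assumes k: "1 \<le> k" "2 * k < CARD('n)"
    and sol: "positive_solution_IE k a \<sigma> f u" and a: "0 < a"
    and f: "smooth_nonlinearity (f i)" "\<And>x. 0 < f i x (u x)"
    and b: "0 < b" and x: "x \<noteq> 0"
  shows "neg_laplacian_power k (\<lambda>y. b * u y $ i) x = b * a / riesz_const TYPE(real^'n) k * source \<sigma> f u i x"
proof -
  let ?c = "riesz_const TYPE(real^'n) k"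
  have kn: "2 * k < DIM(real^'n)" using k by simp
  have c: "0 < ?c" by (rule riesz_const_pos[OF kn])
  have u: "positive_classical k u" using sol by (simp add: positive_solution_IE_def)
  let ?h = "\<lambda>y. b * a / ?c * source \<sigma> f u i y"
  have s0: "0 \<le> source \<sigma> f u i y" for y using f(2)[of y] by (simp add: source_def less_imp_le)
  have s1: "0 < source \<sigma> f u i y" if "y \<noteq> 0" for y using f(2)[of y] that by (simp add: source_def)
  have int: "integrable lborel (\<lambda>y. riesz k z y * source \<sigma> f u i y)"
    "u z $ i = a * (LINT y|lborel. riesz k z y * source \<sigma> f u i y)" if "z \<noteq> 0" for z
    using sol that by (auto simp: positive_solution_IE_def riesz_integrand_source)
  show ?thesis
  proof (rule neg_laplacian_power_potential[OF k(1) kn, where h="?h"])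
    show "continuous_on UNIV (\<lambda>y. b * u y $ i)" by (intro continuous_intros positive_classicalD[OF u])
    show "C_diff_on (2 * k) (- {0}) (\<lambda>y. b * u y $ i)"
      by (intro C_diff_on_cmult positive_classicalD[OF u]) auto
    show "?h \<in> borel_measurable borel" using source_continuous(2)[OF u, of f i, OF f(1)] by simp
    show "0 \<le> ?h y" for y using a b c s0 by simp
    show "0 < ?h y" if "y \<noteq> 0" for y using a b c s1[OF that] by simp
    show "continuous_on (- {0}) ?h" by (intro continuous_intros source_continuous(1)[OF u, of f i, OF f(1)])
    fix z :: "real^'n" assume z: "z \<noteq> 0"
    have e: "(\<lambda>y. riesz k z y * ?h y) = (\<lambda>y. b * a / ?c * (riesz k z y * source \<sigma> f u i y))" by auto
    show "integrable lborel (\<lambda>y. riesz k z y * ?h y)"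
      unfolding e by (intro integrable_mult_right int(1) z)
    show "b * u z $ i = ?c * (LINT y|lborel. riesz k z y * ?h y)"
      unfolding e using c by (simp add: int(2)[OF z])
  qed (rule x)
qed

lemma PDE_imp_IE:
  fixes u :: "real^'n \<Rightarrow> real^'l::finite"
  assumes k: "1 \<le> k" "2 * k < CARD('n)"
    and sol: "positive_solution_PDE k \<sigma> f u" and f: "\<And>i. smooth_nonlinearity (f i)" 
    and sc: "structural_conditions k a \<sigma> f"
  shows "positive_solution_IE k (riesz_const TYPE(real^'n) k) \<sigma> f u"
proof -
  have kn: "2 * k < DIM(real^'n)" using k by simp
  have u: "positive_classical k u" using sol by (simp add: positive_solution_PDE_def)
  note u' = positive_classicalD[OF u]
  have f0: "\<And>i x. 0 < f i x (u x)"
    using sc sol unfolding structural_conditions_def by blast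
  obtain p s C where p: "\<And>i. 1 < p i" "0 \<le> s" "s < 2 * real k" "0 < C"
    "\<And>x. x \<noteq> 0 \<Longrightarrow> C * norm x powr (- s) * (\<Sum>i\<in>UNIV. (u x $ i) powr p i) \<le> (\<Sum>i\<in>UNIV. source \<sigma> f u i x)"
    using sc sol unfolding structural_conditions_def source_def by blast
  have s0: "0 \<le> source \<sigma> f u i y" for i y using f0[of i y] by (simp add: source_def less_imp_le)
  have pde: "neg_laplacian_power k (\<lambda>y. u y $ i) x = source \<sigma> f u i x" if "x \<noteq> 0" for i x
    using sol that by (simp add: positive_solution_PDE_def source_def)
  have test: "integrable lborel (\<lambda>y. source \<sigma> f u i y * cap x t y ^ M)"
    "(LINT y|lborel. source \<sigma> f u i y * cap x t y ^ M) = 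
       (LINT y|lborel. u y $ i * neg_laplacian_power k (\<lambda>y. cap x t y ^ M) y)"
    if "2 * k < M" "0 < t" for i x t M
    by (rule origin_removable[OF kn u'(2,3) pde s0 source_continuous(2)[OF u f] C_diff_on_cap_power[OF that(1)] _ compact_cball[of x "sqrt t"]],
       use that in \<open>auto simp: cap_nonneg cap_outside\<close>)+
  have decay0: "(ball_mean (\<lambda>y. u y $ i) 0 \<longlongrightarrow> 0) at_top" for i
    by (rule averages_vanish[where u="\<lambda>i y. u y $ i" and h="source \<sigma> f u" and p=p and k=k and s=s])
      (use u' p test in auto)
  have decay: "(ball_mean (\<lambda>y. u y $ i) x \<longlongrightarrow> 0) at_top" for i x
    by (rule ball_mean_shift[OF u'(2) decay0])
  have m: "2 * k < 2 * k + 2" by simp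
  have ri: "integrable lborel (\<lambda>y. riesz k x y * source \<sigma> f u i y)" for i x
    by (rule riesz_integrable[OF k(1) kn u'(2) source_continuous(2)[OF u f] s0 test(1)[OF m] test(2)[OF m] decay])
  have "u x $ i = riesz_const TYPE(real^'n) k * (LINT y|lborel. riesz k x y * source \<sigma> f u i y)" for i x
    by (rule riesz_representation[OF k(1) kn u'(2) source_continuous(2)[OF u f] ri test(2)[OF m] decay])
  then show ?thesis using ri u by (simp add: positive_solution_IE_def riesz_integrand_source)
qed

theorem theorem1:
  fixes k :: nat
  assumes "3 \<le> CARD('n::finite)" and "1 \<le> k" and "2 * k < CARD('n)"
  shows "\<exists>c>0. \<forall>(\<sigma> :: 'l::finite \<Rightarrow> real) (f :: 'l \<Rightarrow> real^'n \<Rightarrow> real^'l \<Rightarrow> real).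
    (\<forall>i. 0 \<le> \<sigma> i \<and> \<sigma> i < 2 * real k) \<longrightarrow>
    (\<forall>i. smooth_nonlinearity (f i)) \<longrightarrow>
    (structural_conditions k c \<sigma> f \<longrightarrow>
       (\<forall>u. positive_solution_IE k c \<sigma> f u \<longleftrightarrow> positive_solution_PDE k \<sigma> f u)) \<and>
    (structural_conditions k 1 \<sigma> f \<longrightarrow>
       (\<forall>\<mu>. absorbs_constant c \<mu> f \<longrightarrow>
          (\<forall>u. positive_solution_IE k 1 \<sigma> f u \<longrightarrow>
               positive_solution_PDE k \<sigma> f (\<lambda>x. scale_components \<mu> (u x))) \<and>
          (\<forall>u. positive_solution_PDE k \<sigma> f u \<longrightarrow>
               positive_solution_IE k 1 \<sigma> f (\<lambda>x. scale_components (\<chi> i. 1 / \<mu> $ i) (u x)))))"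
proof -
  define c where "c = riesz_const TYPE(real^'n) k"
  have kn: "2 * k < DIM(real^'n)" using assms by simp
  have c: "0 < c" unfolding c_def by (rule riesz_const_pos[OF kn])
  note k = assms(2,3)
  show ?thesis
  proof (intro exI[of _ c] conjI c allI impI iffI)
    fix \<sigma> :: "'l \<Rightarrow> real" and f :: "'l \<Rightarrow> real^'n \<Rightarrow> real^'l \<Rightarrow> real" and u
    assume f: "\<forall>i. smooth_nonlinearity (f i)" and sc: "structural_conditions k c \<sigma> f"
    {
      assume ie: "positive_solution_IE k c \<sigma> f u"
      then have f0: "0 < f i x (u x)" for i x using sc unfolding structural_conditions_def by blast
      have "neg_laplacian_power k (\<lambda>y. u y $ i) x = source \<sigma> f u i x" if "x \<noteq> 0" for i x
        using IE_imp_PDE[OF k ie c _ f0, of i 1 x] f that c by (simp add: c_def)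
      then show "positive_solution_PDE k \<sigma> f u" using ie
        by (simp add: positive_solution_PDE_def positive_solution_IE_def source_def)
    }
    {
      assume "positive_solution_PDE k \<sigma> f u"
      then show "positive_solution_IE k c \<sigma> f u" unfolding c_def by (rule PDE_imp_IE[OF k _ _ sc]) (use f in auto)
    }
  next
    fix \<sigma> :: "'l \<Rightarrow> real" and f :: "'l \<Rightarrow> real^'n \<Rightarrow> real^'l \<Rightarrow> real" and \<mu> u
    assume f: "\<forall>i. smooth_nonlinearity (f i)" and sc: "structural_conditions k 1 \<sigma> f" 
      and ab: "absorbs_constant c \<mu> f"
    have \<mu>: "0 < \<mu> $ i" for i using ab by (simp add: absorbs_constant_def)
    have scale: "c * f i x (scale_components \<mu> v) = \<mu> $ i * f i x v" if "\<And>j. 0 < v $ j" for i x v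
      using ab that by (simp add: absorbs_constant_def)
    {
      assume ie: "positive_solution_IE k 1 \<sigma> f u"
      then have f0: "0 < f i x (u x)" for i x using sc unfolding structural_conditions_def by blast
      have u: "positive_classical k u" using ie by (simp add: positive_solution_IE_def)
      have "neg_laplacian_power k (\<lambda>y. \<mu> $ i * u y $ i) x = norm x powr (- \<sigma> i) * f i x (scale_components \<mu> (u x))" 
        if "x \<noteq> 0" for i x
      proof -
        have "f i x (scale_components \<mu> (u x)) = \<mu> $ i * f i x (u x) / c"
          using scale[OF positive_classicalD(1)[OF u], of i x x] c by (simp add: field_simps)
        then show ?thesis 
          using IE_imp_PDE[OF k ie _ _ f0, of i "\<mu> $ i" x] f that \<mu> by (simp add: c_def source_def)
      qed
      then show "positive_solution_PDE k \<sigma> f (\<lambda>x. scale_components \<mu> (u x))" 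
        using positive_classical_scale[OF u \<mu>] by (simp add: positive_solution_PDE_def scale_components_def)
    }
    {
      assume pde: "positive_solution_PDE k \<sigma> f u"
      let ?\<nu> = "(\<chi> i. 1 / \<mu> $ i) :: real^'l"
      let ?w = "\<lambda>x. scale_components ?\<nu> (u x)"
      have ie: "positive_solution_IE k c \<sigma> f u" unfolding c_def by (rule PDE_imp_IE[OF k pde _ sc]) (use f in auto)
      have u: "positive_classical k u" using pde by (simp add: positive_solution_PDE_def)
      have w: "positive_classical k ?w" by (rule positive_classical_scale[OF u]) (simp add: \<mu>)
      have "scale_components \<mu> (?w x) = u x" for x
        using \<mu> by (simp add: vec_eq_iff scale_components_def less_imp_neq[symmetric])
      then have fw: "f i x (?w x) = c / \<mu> $ i * f i x (u x)" for i x
        using scale[OF positive_classicalD(1)[OF w], of i x x] \<mu>[of i] by (simp add: field_simps)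
      have e: "riesz_integrand k \<sigma> f ?w i x = (\<lambda>y. c / \<mu> $ i * riesz_integrand k \<sigma> f u i x y)" for i x
        by (simp add: fun_eq_iff riesz_integrand_def fw)
      show "positive_solution_IE k 1 \<sigma> f ?w"
        unfolding positive_solution_IE_def e using w ie
        by (auto simp: positive_solution_IE_def scale_components_def)
    }
  qed
qed

end
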